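(* Let $\alpha\in(1,2]$ and let $\mathbf{S}(n)=\sum_{i=1}^n\mathbf{Y}_i$, $\mathbf{S}(0)=0$, be a random walk in $\mathbb{R}^d$ with i.i.d. steps with mean $\mu=\mathbb{E}[\mathbf{Y}_1]\neq0$, such that $$\frac{\mathbf{S}(n)-n\mu}{b_n}\xrightarrow[n\to\infty]{\mathcal{D}}\mathbf{X}(1)$$ for a sequence $b_n>0$ and an $\alpha$-stable Lévy process $\{\mathbf{X}(t)\}_{t\ge0}$ in $\mathbb{R}^d$. Let $\{\bar e_1,\dots,\bar e_d\}$ be an orthonormal basis of $\mathbb{R}^d$ with $\bar e_1=\mu/\|\mu\|$, let $D_n=\mathrm{diag}(1/n,1/b_n,\dots,1/b_n)\in\mathbb{R}^{d\times d}$, and $\widetilde{\mathbf{X}}(t)=\bigl(\|\mu\|t,\langle\mathbf{X}(t),\bar e_2\rangle,\dots,\langle\mathbf{X}(t),\bar e_d\rangle\bigr)$, $t\ge0$. Then for every $m\in\{1,\ldots,d\}$, $$V_m\Bigl(D_n\bigl(\mathrm{conv}\{\mathbf{S}(0),\ldots,\mathbf{S}(n)\}\bigr)\Bigr)\xrightarrow[n\to\infty]{\mathcal{D}}V_m\bigl(\mathrm{conv}\,\widetilde{\mathbf{X}}[0,1]\bigr).$$ In particular, $$\frac{V_d\bigl(\mathrm{conv}\{\mathbf{S}(0),\ldots,\mathbf{S}(n)\}\bigr)}{n\,b_n^{d-1}}\xrightarrow[n\to\infty]{\mathcal{D}}V_d\bigl(\mathrm{conv}\,\widetilde{\mathbf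{X}}[0,1]\bigr).$$
   Context: $\mathrm{conv}$ is the convex hull and, for a càdlàg process, $\widetilde{\mathbf{X}}[0,1]=\mathrm{cl}\{\widetilde{\mathbf{X}}(t):t\in[0,1]\}$. $D_n(A)=\{D_nx:x\in A\}$. In the normalization $b_n=n^{1/\alpha}\ell(n)$ with $\ell$ slowly varying at infinity. $\xrightarrow{\mathcal{D}}$ is convergence in distribution. Intrinsic volumes $V_0(A),\dots,V_d(A)$ of a convex body $A\subset\mathbb{R}^d$ are defined by the Steiner formula $\mathrm{Vol}_d(A+\rho B^d)=\sum_{m=0}^d\rho^{d-m}\kappa_{d-m}V_m(A)$, $\rho\ge0$, where $B^d$ is the closed unit ball and $\kappa_d=\mathrm{Vol}_d(B^d)$; in particular $V_d$ is $d$-dimensional Lebesgue measure. *)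

theory Defs
  imports "HOL-Probability.Probability"
begin

section \<open>Convergence in distribution\<close>

text \<open>
  The library only has weak convergence of distributions on the real line
  (\<^const>\<open>weak_conv_m\<close>).  The following version, in terms of bounded continuous test
  functions, makes sense for random vectors as well; the two agree on the real line, see
  \<open>conv_in_distr_real_iff\<close> below.  The limit may live on a different probability space.
\<close>

definition conv_in_distr ::
    "'w measure \<Rightarrow> (nat \<Rightarrow> 'w \<Rightarrow> 'b::topological_space) \<Rightarrow> 'v measure \<Rightarrow> ('v \<Rightarrow> 'b) \<Rightarrow> bool" where
  "conv_in_distr M Z N Z' \<longleftrightarrow>
     (\<forall>n. Z n \<in> borel_measurable M) \<and> Z' \<in> borel_measurable N \<and>
     (\<forall>f :: 'b \<Rightarrow> real. continuous_on UNIV f \<longrightarrow> bounded (range f) \<longrightarrow>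
        (\<lambda>n. \<integral>\<omega>. f (Z n \<omega>) \<partial>M) \<longlonglongrightarrow> (\<integral>\<omega>. f (Z' \<omega>) \<partial>N))"

lemma conv_in_distr_real_iff:
  fixes Z :: "nat \<Rightarrow> 'w \<Rightarrow> real" and Z' :: "'v \<Rightarrow> real"
  assumes "prob_space M" "prob_space N"
  assumes Z [measurable]: "\<And>n. Z n \<in> borel_measurable M"
    and Z' [measurable]: "Z' \<in> borel_measurable N"
  shows "conv_in_distr M Z N Z' \<longleftrightarrow> weak_conv_m (\<lambda>n. distr M borel (Z n)) (distr N borel Z')"
proof -
  interpret M: prob_space M by fact
  interpret N: prob_space N by fact
  have D: "real_distribution (distr M borel (Z n))" for n
    using M.real_distribution_distr Z by blast
  have D': "real_distribution (distr N borel Z')"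
    using N.real_distribution_distr Z' by blast
  have int: "integral\<^sup>L (distr M borel (Z n)) f = (\<integral>\<omega>. f (Z n \<omega>) \<partial>M)"
    and int': "integral\<^sup>L (distr N borel Z') f = (\<integral>\<omega>. f (Z' \<omega>) \<partial>N)"
    if "continuous_on UNIV f" for n and f :: "real \<Rightarrow> real"
    using that by (auto intro!: integral_distr borel_measurable_continuous_onI)
  show ?thesis
  proof
    assume *: "conv_in_distr M Z N Z'"
    show "weak_conv_m (\<lambda>n. distr M borel (Z n)) (distr N borel Z')"
    proof (rule integral_bdd_continuous_conv_imp_weak_conv[OF D D'])
      fix f :: "real \<Rightarrow> real"
      assume "\<And>x. isCont f x" and f: "\<And>x. \<bar>f x\<bar> \<le> 1"
      then have cont: "continuous_on UNIV f"
        by (simp add: continuous_at_imp_continuous_on)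
      moreover have "bounded (range f)"
        using f by (auto simp: bounded_iff)
      ultimately show "(\<lambda>n. integral\<^sup>L (distr M borel (Z n)) f) \<longlonglongrightarrow> integral\<^sup>L (distr N borel Z') f"
        using * by (simp add: int int' conv_in_distr_def)
    qed
  next
    assume *: "weak_conv_m (\<lambda>n. distr M borel (Z n)) (distr N borel Z')"
    have "(\<lambda>n. \<integral>\<omega>. f (Z n \<omega>) \<partial>M) \<longlonglongrightarrow> (\<integral>\<omega>. f (Z' \<omega>) \<partial>N)"
      if cont: "continuous_on UNIV f" and bdd: "bounded (range f)" for f :: "real \<Rightarrow> real"
    proof -
      obtain B where "norm (f x) \<le> B" for x
        using bdd by (auto simp: bounded_iff)
      moreover have "isCont f x" for x
        using cont by (simp add: continuous_on_eq_continuous_at)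
      ultimately show ?thesis
        using weak_conv_imp_integral_bdd_continuous_conv[OF D D' *, of f B] cont
        by (simp add: int int')
    qed
    then show "conv_in_distr M Z N Z'"
      by (simp add: conv_in_distr_def)
  qed
qed

section \<open>Stable Levy processes\<close>

definition cadlag :: "(real \<Rightarrow> 'b::topological_space) \<Rightarrow> bool" where
  "cadlag x \<longleftrightarrow>
     (\<forall>t\<ge>0. (x \<longlongrightarrow> x t) (at_right t)) \<and> (\<forall>t>0. \<exists>l. (x \<longlongrightarrow> l) (at_left t))"

text \<open>
  Time is indexed by all reals, but only nonnegative times are constrained.
\<close>

definition levy_process :: "'w measure \<Rightarrow> (real \<Rightarrow> 'w \<Rightarrow> 'b::euclidean_space) \<Rightarrow> bool" where
  "levy_process M X \<longleftrightarrow>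
     prob_space M \<and>
     (\<forall>t\<ge>0. X t \<in> borel_measurable M) \<and>
     (AE \<omega> in M. X 0 \<omega> = 0) \<and>
     (\<forall>(t :: nat \<Rightarrow> real) k. 0 \<le> t 0 \<longrightarrow> (\<forall>i<k. t i < t (Suc i)) \<longrightarrow>
        prob_space.indep_vars M (\<lambda>_. borel) (\<lambda>i \<omega>. X (t (Suc i)) \<omega> - X (t i) \<omega>) {..<k}) \<and>
     (\<forall>s\<ge>0. \<forall>h\<ge>0. distr M borel (\<lambda>\<omega>. X (s + h) \<omega> - X s \<omega>)
                   = distr M borel (\<lambda>\<omega>. X h \<omega> - X 0 \<omega>)) \<and>
     (\<forall>t\<ge>0. \<forall>\<epsilon>>0. ((\<lambda>s. measure M {\<omega> \<in> space M. norm (X s \<omega> - X t \<omega>) > \<epsilon>}) \<longlongrightarrow> 0)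
                     (at t within {0..})) \<and>
     (\<forall>\<omega>\<in>space M. cadlag (\<lambda>t. X t \<omega>))"

text \<open>
  \<open>a Z\<^sub>1 + c Z\<^sub>2\<close> has the law of \<open>(a\<^sup>\<alpha> + c\<^sup>\<alpha>)\<^sup>1\<^sup>/\<^sup>\<alpha> Z\<^sub>1 + v\<close>, where
  \<open>Z\<^sub>1\<close> and \<open>Z\<^sub>2\<close> are independent with law \<open>\<nu>\<close>.
\<close>

definition stable_law :: "real \<Rightarrow> 'b::euclidean_space measure \<Rightarrow> bool" where
  "stable_law \<alpha> \<nu> \<longleftrightarrow>
     prob_space \<nu> \<and> sets \<nu> = sets borel \<and>
     (\<forall>a>0. \<forall>c>0. \<exists>v.
        distr (\<nu> \<Otimes>\<^sub>M \<nu>) borel (\<lambda>(x, y). a *\<^sub>R x + c *\<^sub>R y) =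
        distr \<nu> borel (\<lambda>x. ((a powr \<alpha> + c powr \<alpha>) powr (1 / \<alpha>)) *\<^sub>R x + v))"

definition stable_levy_process ::
    "real \<Rightarrow> 'w measure \<Rightarrow> (real \<Rightarrow> 'w \<Rightarrow> 'b::euclidean_space) \<Rightarrow> bool" where
  "stable_levy_process \<alpha> M X \<longleftrightarrow> levy_process M X \<and> stable_law \<alpha> (distr M borel (X 1))"

definition slowly_varying :: "(real \<Rightarrow> real) \<Rightarrow> bool" where
  "slowly_varying L \<longleftrightarrow>
     L \<in> borel_measurable borel \<and> (\<forall>\<^sub>F x in at_top. L x > 0) \<and>
     (\<forall>c>0. ((\<lambda>x. L (c * x) / L x) \<longlongrightarrow> 1) at_top)"

section \<open>Random walks\<close>

definition random_walk :: "(nat \<Rightarrow> 'w \<Rightarrow> 'b::real_vector) \<Rightarrow> nat \<Rightarrow> 'w \<Rightarrow> 'b" where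
  "random_walk Y n \<omega> = (\<Sum>i=1..n. Y i \<omega>)"

definition iid_steps :: "'w measure \<Rightarrow> (nat \<Rightarrow> 'w \<Rightarrow> 'b::topological_space) \<Rightarrow> bool" where
  "iid_steps M Y \<longleftrightarrow>
     prob_space.indep_vars M (\<lambda>_. borel) Y {1..} \<and>
     (\<forall>i\<ge>1. distr M borel (Y i) = distr M borel (Y 1))"

section \<open>Intrinsic volumes\<close>

text \<open>
  The intrinsic volumes of a convex body are the coefficients in the Steiner formula.
  These are determined by the formula only for indices up to the dimension, whence the
  normalisation beyond.  \<^term>\<open>unit_ball_vol (real k)\<close> is the \<open>k\<close>-dimensional volume of
  the unit ball (with value \<open>1\<close> for \<open>k = 0\<close>).
\<close>

definition steiner_formula :: "'b::euclidean_space set \<Rightarrow> (nat \<Rightarrow> real) \<Rightarrow> bool" where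
  "steiner_formula A V \<longleftrightarrow>
     (\<forall>\<rho>\<ge>0. measure lebesgue {x + \<rho> *\<^sub>R u | x u. x \<in> A \<and> u \<in> cball 0 1} =
        (\<Sum>m\<le>DIM('b). \<rho> ^ (DIM('b) - m) * unit_ball_vol (real (DIM('b) - m)) * V m))"

definition intrinsic_volume :: "nat \<Rightarrow> 'b::euclidean_space set \<Rightarrow> real" where
  "intrinsic_volume m A = (THE V. steiner_formula A V \<and> (\<forall>k>DIM('b). V k = 0)) m"

lemma steiner_formula_unique:
  fixes A :: "'b::euclidean_space set"
  assumes "steiner_formula A V" "steiner_formula A W" "m \<le> DIM('b)"
  shows "V m = W m"
proof -
  define d where "d = DIM('b)"
  define c where "c = (\<lambda>j. unit_ball_vol (real j) * (V (d - j) - W (d - j)))"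
  have zero: "(\<Sum>j\<le>d. c j * \<rho> ^ j) = 0" if "\<rho> \<ge> 0" for \<rho>
  proof -
    have "(\<Sum>m\<le>d. \<rho> ^ (d - m) * unit_ball_vol (real (d - m)) * V m) =
          (\<Sum>m\<le>d. \<rho> ^ (d - m) * unit_ball_vol (real (d - m)) * W m)"
      using assms(1,2) that unfolding steiner_formula_def d_def by simp
    then have "(\<Sum>m\<le>d. c (d - m) * \<rho> ^ (d - m)) = 0"
      by (simp add: c_def algebra_simps sum_subtractf)
    then show ?thesis
      by (subst (asm) sum.nat_diff_reindex[symmetric, where n = "Suc d", simplified lessThan_Suc_atMost])
         simp
  qed
  have "c j = 0" if "j \<le> d" for j
  proof (rule ccontr)
    assume "c j \<noteq> 0"
    then have "finite {x. (\<Sum>i\<le>d. c i * x ^ i) = 0}"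
      using that polyfun_roots_finite by blast
    moreover have "{0..1} \<subseteq> {x. (\<Sum>i\<le>d. c i * x ^ i) = 0}"
      using zero by auto
    ultimately have "finite {0..1::real}"
      by (rule rev_finite_subset)
    then show False
      by (simp add: infinite_Icc)
  qed
  moreover have "unit_ball_vol (real (d - m)) \<noteq> 0"
    using unit_ball_vol_pos[of "real (d - m)"] by linarith
  ultimately have "V (d - (d - m)) - W (d - (d - m)) = 0"
    unfolding c_def by (metis diff_le_self mult_eq_0_iff)
  then show ?thesis
    using assms(3) by (simp add: d_def)
qed

section \<open>The rescaling and the limit process\<close>

text \<open>
  The first element of the orthonormal basis is singled out by an index \<open>i\<^sub>1\<close>.  Both the
  diagonal matrix and the limit process refer to coordinates with respect to this basis.
\<close>

definition basis_coords :: "('n \<Rightarrow> real^'n) \<Rightarrow> real^'n \<Rightarrow> real^'n::finite" where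
  "basis_coords e x = (\<chi> i. x \<bullet> e i)"

definition scaling_matrix :: "'n \<Rightarrow> (nat \<Rightarrow> real) \<Rightarrow> nat \<Rightarrow> real^'n^'n::finite" where
  "scaling_matrix i\<^sub>1 b n =
     (\<chi> i j. if i = j then if i = i\<^sub>1 then 1 / real n else 1 / b n else 0)"

definition limit_process ::
    "'n \<Rightarrow> ('n \<Rightarrow> real^'n) \<Rightarrow> real^'n \<Rightarrow> (real \<Rightarrow> 'w \<Rightarrow> real^'n) \<Rightarrow> real \<Rightarrow> 'w \<Rightarrow> real^'n::finite" where
  "limit_process i\<^sub>1 e \<mu> X t \<omega> =
     (\<chi> i. if i = i\<^sub>1 then norm \<mu> * t else X t \<omega> \<bullet> e i)"

definition closed_range :: "(real \<Rightarrow> 'w \<Rightarrow> 'b::topological_space) \<Rightarrow> 'w \<Rightarrow> 'b set" where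
  "closed_range Z \<omega> = closure ((\<lambda>t. Z t \<omega>) ` {0..1})"

end

theory Submission
  imports Defs
begin

text \<open>
  By nearest points, the parallel body at distance \<open>\<rho>\<close> of a polytope splits into finitely many pieces,
  one for each active set of constraints, whose volumes are monomials in \<open>\<rho>\<close>; hence the Steiner formula
  for polytopes and, by approximation, for convex bodies.  Interpolation at \<open>\<rho> = 1, \<dots>, d + 1\<close> writes
  intrinsic volumes as linear combinations of volumes of parallel bodies, which are uniformly continuous
  in the Hausdorff metric because \<open>A + (\<rho> + \<delta>) B\<close> lies in a dilate of \<open>A + \<rho> B\<close> by \<open>1 + \<delta> / \<rho>\<close>.

  On the probabilistic side no functional limit theorem is needed.  The characteristic function of the
  limit has no zeros, so the \<open>n\<close>-th root of that of the normalised walk can be taken continuously; this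
  yields convergence of the increments over a grid of \<open>K\<close> blocks and the tail bound \<open>C k / n\<close> for
  \<open>k\<close> steps.  By Ottaviani's inequality a block contains a point far from both its ends only if it makes
  two independent excursions, which happens in some block with probability at most \<open>K O(1 / K\<^sup>2)\<close>.  So
  the hull of the walk is close to the hull of its \<open>K\<close>-skeleton, which converges in law for fixed \<open>K\<close>,
  while the skeletons of a cadlag path exhaust the hull of its closed range.  In the direction of the
  mean the weak law of large numbers replaces the fluctuations.
\<close>

section \<open>Parallel bodies of polytopes\<close>

text \<open>A single large jump inside a block separates the walk from its skeleton at matching
  times, and such jumps may persist in the limit. The Hausdorff distance of point sets ignores time,
  however, so it is enough that every point is near one of the two ends of its block. Spoiling this
  takes two large moves, each of probability \<open>O(1/K)\<close>, and the square beats the number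
  \<open>K\<close> of blocks. The tail bound must be uniform over all windows of
  \<open>k \<le> n\<close> steps. Writing the characteristic function of one step at frequency
  \<open>s / b n\<close> as \<open>exp (h n s / n)\<close> with bounded \<open>h n\<close> gives it
  directly, since the \<open>k\<close>-th power then differs from 1 by \<open>O(k/n)\<close>. The
  dilation factor \<open>1 + \<delta> / \<rho>\<close> blows up at radius 0, so even the volume of
  the body itself is controlled only through its parallel bodies at positive radii. The limit in
  \<open>n\<close> comes first and the limit in \<open>K\<close> second: estimates for fixed
  \<open>K\<close> are asked for large \<open>n\<close> only, but with constants independent of
  \<open>K\<close>.\<close>

definition parallel_body :: "'b::euclidean_space set \<Rightarrow> real \<Rightarrow> 'b set" where
  "parallel_body A \<rho> = {x + \<rho> *\<^sub>R u | x u. x \<in> A \<and> u \<in> cball 0 1}"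

lemma steiner_formula_parallel_body:
  "steiner_formula A V \<longleftrightarrow> (\<forall>\<rho>\<ge>0. measure lebesgue (parallel_body A \<rho>) =
        (\<Sum>m\<le>DIM('b). \<rho> ^ (DIM('b) - m) * unit_ball_vol (real (DIM('b) - m)) * V m))"
  for A :: "'b::euclidean_space set"
  by (simp add: steiner_formula_def parallel_body_def)

lemma mem_parallel_body_iff:
  assumes "\<rho> \<ge> 0"
  shows "x \<in> parallel_body A \<rho> \<longleftrightarrow> (\<exists>a\<in>A. dist x a \<le> \<rho>)"
proof
  assume "x \<in> parallel_body A \<rho>"
  then obtain a u where "a \<in> A" "norm u \<le> 1" "x = a + \<rho> *\<^sub>R u"
    by (auto simp: parallel_body_def)
  then have "dist x a \<le> \<rho>"
    using assms by (simp add: dist_norm mult_left_le)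
  with \<open>a \<in> A\<close> show "\<exists>a\<in>A. dist x a \<le> \<rho>" by blast
next
  assume "\<exists>a\<in>A. dist x a \<le> \<rho>"
  then obtain a where a: "a \<in> A" "dist x a \<le> \<rho>" by blast
  show "x \<in> parallel_body A \<rho>"
  proof (cases "\<rho> = 0")
    case True
    then show ?thesis
      using a unfolding parallel_body_def by (auto intro!: exI[of _ a] exI[of _ 0])
  next
    case False
    then have "norm ((1 / \<rho>) *\<^sub>R (x - a)) \<le> 1" "x = a + \<rho> *\<^sub>R ((1 / \<rho>) *\<^sub>R (x - a))"
      using a assms by (auto simp: dist_norm divide_simps)
    with a show ?thesis
      unfolding parallel_body_def by (metis (mono_tags, lifting) mem_Collect_eq mem_cball_0)
  qed
qed

lemma parallel_body_0: "parallel_body A 0 = A"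
  by (auto simp: parallel_body_def intro!: exI[of _ "0"])

lemma compact_parallel_body:
  assumes "compact A"
  shows "compact (parallel_body A \<rho>)"
proof -
  have "parallel_body A \<rho> = {x + y | x y. x \<in> A \<and> y \<in> (\<lambda>u. \<rho> *\<^sub>R u) ` cball 0 1}"
    unfolding parallel_body_def by blast
  then show ?thesis
    using assms by (simp add: compact_sums compact_scaling)
qed

lemma parallel_body_mono: "A \<subseteq> B \<Longrightarrow> parallel_body A \<rho> \<subseteq> parallel_body B \<rho>"
  unfolding parallel_body_def by blast

section \<open>Lebesgue measure under translations, isometries and diagonal maps\<close>

lemma emeasure_lborel_translation:
  fixes A :: "'b::euclidean_space set"
  assumes "A \<in> sets borel"
  shows "emeasure lborel ((\<lambda>x. x + a) -` A) = emeasure lborel A"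
proof -
  have "emeasure lborel A = emeasure (distr lborel borel ((+) a)) A"
    by (simp add: lborel_distr_plus)
  also have "\<dots> = emeasure lborel ((+) a -` A)"
    using assms by (subst emeasure_distr) auto
  also have "(+) a = (\<lambda>x. x + a)" by (auto simp: add.commute)
  finally show ?thesis by simp
qed

lemma nn_integral_lborel_translation:
  fixes h :: "'b::euclidean_space \<Rightarrow> ennreal"
  assumes [measurable]: "h \<in> borel_measurable borel"
  shows "(\<integral>\<^sup>+x. h (x + a) \<partial>lborel) = (\<integral>\<^sup>+x. h x \<partial>lborel)"
proof -
  have "(\<integral>\<^sup>+x. h x \<partial>lborel) = (\<integral>\<^sup>+x. h x \<partial>distr lborel borel ((+) a))"
    by (simp add: lborel_distr_plus)
  also have "\<dots> = (\<integral>\<^sup>+x. h (a + x) \<partial>lborel)"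
    by (subst nn_integral_distr) auto
  finally show ?thesis by (simp add: add.commute)
qed

lemma lborel_distr_uminus_euclidean:
  "distr lborel borel uminus = (lborel :: 'b::euclidean_space measure)"
  using lborel_affine[of "-1" "0 :: 'b"] by (simp add: density_1 one_ennreal_def[symmetric])

text \<open>By Fubini, for Borel \<open>B\<close> the measure of the preimage of \<open>A\<close>
  times that of \<open>B\<close> equals the measure of \<open>A\<close> times that of the preimage
  of \<open>B\<close>. The unit ball is its own preimage and has positive finite measure, so it
  cancels.\<close>

lemma emeasure_lborel_orthogonal_transformation:
  fixes f :: "'b::euclidean_space \<Rightarrow> 'b"
  assumes f: "orthogonal_transformation f" and A [measurable]: "A \<in> sets borel"
  shows "emeasure lborel (f -` A) = emeasure lborel A"
proof -
  define g where "g = inv f"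
  have fg: "f (g x) = x" for x
    using orthogonal_transformation_surj[OF f] by (simp add: g_def surj_f_inv_f)
  have lin: "linear f" using f orthogonal_transformation_linear by blast
  have "orthogonal_transformation g"
    unfolding g_def by (rule orthogonal_transformation_inv[OF f])
  then have ling: "linear g" by (rule orthogonal_transformation_linear)
  have [measurable]: "f \<in> borel_measurable borel" "g \<in> borel_measurable borel"
    using lin ling by (auto intro!: borel_measurable_continuous_onI linear_continuous_on
        simp: linear_conv_bounded_linear)
  define B where "B = (ball 0 1 :: 'b set)"
  have [measurable]: "B \<in> sets borel" by (simp add: B_def)
  have fB: "f -` B = B"
    using orthogonal_transformation_norm[OF f] by (auto simp: B_def)
  have vim: "(\<integral>\<^sup>+x. indicator S (f x) \<partial>lborel) = emeasure lborel (f -` S)" if "S \<in> sets borel" for S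
  proof -
    have "(\<lambda>x. indicator S (f x)) = (indicator (f -` S) :: 'b \<Rightarrow> ennreal)"
      by (auto simp: indicator_def)
    then show ?thesis
      using measurable_sets_borel[of f borel S] that by simp
  qed
  have "emeasure lborel (f -` A) * emeasure lborel B
      = (\<integral>\<^sup>+x. indicator A (f x) * emeasure lborel B \<partial>lborel)"
    by (simp add: vim[symmetric] nn_integral_multc)
  also have "\<dots> = (\<integral>\<^sup>+x. (\<integral>\<^sup>+y. indicator A (f x) * indicator B (y + f x) \<partial>lborel) \<partial>lborel)"
    by (intro nn_integral_cong)
      (simp add: nn_integral_cmult nn_integral_lborel_translation[where h="indicator B"])
  also have "\<dots> = (\<integral>\<^sup>+y. (\<integral>\<^sup>+x. indicator A (f x) * indicator B (y + f x) \<partial>lborel) \<partial>lborel)"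
    by (rule lborel_pair.Fubini') measurable
  \<comment> \<open>Shifting \<open>x\<close> by \<open>g (- y)\<close> turns \<open>f x\<close>
    into \<open>f x - y\<close> and \<open>y + f x\<close> into \<open>f x\<close>, so that
    \<open>y\<close> enters only through \<open>A\<close>.\<close>
  also have "\<dots> = (\<integral>\<^sup>+y. (\<integral>\<^sup>+x. indicator A (f (x + g (- y))) * indicator B (y + f (x + g (- y))) \<partial>lborel) \<partial>lborel)"
    by (intro nn_integral_cong nn_integral_lborel_translation[symmetric]) measurable
  also have "\<dots> = (\<integral>\<^sup>+y. (\<integral>\<^sup>+x. indicator A (f x - y) * indicator B (f x) \<partial>lborel) \<partial>lborel)"
    by (simp add: linear_add[OF lin] fg)
  also have "\<dots> = (\<integral>\<^sup>+x. (\<integral>\<^sup>+y. indicator A (f x - y) * indicator B (f x) \<partial>lborel) \<partial>lborel)"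
    by (rule lborel_pair.Fubini') measurable
  also have "\<dots> = (\<integral>\<^sup>+x. emeasure lborel A * indicator B (f x) \<partial>lborel)"
  proof (intro nn_integral_cong)
    fix x
    have "(\<integral>\<^sup>+y. (indicator A (f x - y) :: ennreal) \<partial>lborel) = (\<integral>\<^sup>+y. indicator A (f x - y) \<partial>distr lborel borel uminus)"
      by (simp add: lborel_distr_uminus_euclidean)
    also have "\<dots> = (\<integral>\<^sup>+y. indicator A (y + f x) \<partial>lborel)"
      by (subst nn_integral_distr) (auto simp: add.commute)
    also have "\<dots> = emeasure lborel A"
      by (simp add: nn_integral_lborel_translation[where h="indicator A"])
    finally show "(\<integral>\<^sup>+y. indicator A (f x - y) * indicator B (f x) \<partial>lborel) = emeasure lborel A * indicator B (f x)"
      by (simp add: nn_integral_multc)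
  qed
  also have "\<dots> = emeasure lborel A * emeasure lborel (f -` B)"
    by (subst nn_integral_cmult) (simp_all add: vim)
  finally have eq: "emeasure lborel (f -` A) * emeasure lborel B = emeasure lborel A * emeasure lborel B"
    by (simp add: fB)
  have "unit_ball_vol (real DIM('b)) \<noteq> 0"
    using unit_ball_vol_pos[of "real DIM('b)"] by linarith
  then have "emeasure lborel B \<noteq> 0" "emeasure lborel B \<noteq> \<top>"
    by (auto simp: B_def emeasure_ball)
  with eq show ?thesis
    by (simp add: ennreal_mult_cancel_left mult.commute[of _ "emeasure lborel B"])
qed

lemma emeasure_lborel_diagonal:
  fixes c :: "'b::euclidean_space \<Rightarrow> real"
  assumes c: "\<And>j. j \<in> Basis \<Longrightarrow> c j > 0" and A [measurable]: "A \<in> sets borel"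
  shows "emeasure lborel A
    = ennreal (\<Prod>j\<in>Basis. c j) * emeasure lborel ((\<lambda>x. \<Sum>j\<in>Basis. (c j * (x \<bullet> j)) *\<^sub>R j) -` A)"
proof -
  define T where "T = (\<lambda>x::'b. \<Sum>j\<in>Basis. (c j * (x \<bullet> j)) *\<^sub>R j)"
  have [measurable]: "T \<in> borel_measurable borel"
    unfolding T_def by measurable
  have "lborel = density (distr lborel borel T) (\<lambda>_. ennreal (\<Prod>j\<in>Basis. \<bar>c j\<bar>))"
    using lborel_affine_euclidean[of c 0] c unfolding T_def by fastforce
  moreover have "(\<Prod>j\<in>Basis. \<bar>c j\<bar>) = (\<Prod>j\<in>Basis. c j)"
    using c by (intro prod.cong) (auto simp: abs_of_pos)
  ultimately have "emeasure lborel A = emeasure (density (distr lborel borel T) (\<lambda>_. ennreal (\<Prod>j\<in>Basis. c j))) A"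
    by simp
  then show ?thesis
    unfolding T_def[symmetric] by (simp add: emeasure_density_const emeasure_distr)
qed

text \<open>The orthonormal vectors are indexed by the standard basis, so that the change of
  coordinates is an endomorphism of the space. Orthonormal bases of \<open>L\<close> and of its
  orthogonal complement together have \<open>DIM('b)\<close> elements, whence the bijection
  \<open>h\<close>.\<close>

lemma orthonormal_basis_adapted:
  fixes L :: "'b::euclidean_space set"
  assumes L: "subspace L"
  shows "\<exists>(h :: 'b \<Rightarrow> 'b) J. J \<subseteq> Basis \<and> (\<forall>i\<in>Basis. \<forall>j\<in>Basis. h i \<bullet> h j = (if i = j then 1 else 0)) \<and>
    (\<forall>j\<in>J. h j \<in> L) \<and> (\<forall>j\<in>Basis - J. \<forall>x\<in>L. x \<bullet> h j = 0)"
proof -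
  define L' where "L' = {y. \<forall>x\<in>L. orthogonal x y}"
  have L': "subspace L'" by (simp add: L'_def subspace_orthogonal_to_vectors)
  obtain B where B: "B \<subseteq> L" "pairwise orthogonal B" "\<And>x. x \<in> B \<Longrightarrow> norm x = 1"
    "independent B" "card B = dim L" "span B = L"
    using orthonormal_basis_subspace[OF L] by metis
  obtain B' where B': "B' \<subseteq> L'" "pairwise orthogonal B'" "\<And>x. x \<in> B' \<Longrightarrow> norm x = 1"
    "independent B'" "card B' = dim L'" "span B' = L'"
    using orthonormal_basis_subspace[OF L'] by metis
  have fin: "finite B" "finite B'" using B(4) B'(4) independent_imp_finite by blast+
  have orth: "x \<bullet> y = 0" if "x \<in> L" "y \<in> L'" for x y
    using that by (auto simp: L'_def orthogonal_def)
  have disj: "B \<inter> B' = {}"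
  proof (rule ccontr)
    assume "B \<inter> B' \<noteq> {}"
    then obtain x where "x \<in> B" "x \<in> B'" by blast
    with orth[of x x] B(1,3) B'(1) show False by force
  qed
  have "dim L' + dim L = DIM('b)"
    using dim_subspace_orthogonal_to_vectors[OF L subspace_UNIV] by (simp add: L'_def)
  then have card: "card (B \<union> B') = DIM('b)"
    using disj fin B(5) B'(5) by (simp add: card_Un_disjoint)
  have "card (Basis :: 'b set) = card (B \<union> B')" using card by simp
  then obtain h where h: "bij_betw h (Basis :: 'b set) (B \<union> B')"
    using finite_same_card_bij[OF finite_Basis] fin by blast
  define J where "J = {j\<in>Basis. h j \<in> B}"
  have "h i \<bullet> h j = (if i = j then 1 else 0)" if ij: "i \<in> Basis" "j \<in> Basis" for i j
  proof -
    have *: "h i \<in> B \<union> B'" "h j \<in> B \<union> B'" using h ij by (auto simp: bij_betw_def)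
    show "h i \<bullet> h j = (if i = j then 1 else 0)"
    proof (cases "i = j")
      case True
      have "norm (h i) = 1" using * B(3) B'(3) by auto
      with True show ?thesis by (simp add: norm_eq_1)
    next
      case False
      then have "h i \<noteq> h j" using h ij by (auto simp: bij_betw_def inj_on_def)
      moreover have "h i \<bullet> h j = 0" if "h i \<in> B" "h j \<in> B'"
        using orth that B(1) B'(1) by blast
      moreover have "h i \<bullet> h j = 0" if "h j \<in> B" "h i \<in> B'"
        using orth that B(1) B'(1) by (metis inner_commute subsetD)
      ultimately show ?thesis
        using * B(2) B'(2) False by (auto simp: pairwise_def orthogonal_def)
    qed
  qed
  moreover have "x \<bullet> h j = 0" if "j \<in> Basis - J" "x \<in> L" for j x
  proof -
    have "h j \<in> B'" using that h by (auto simp: bij_betw_def J_def)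
    then show ?thesis using orth that B'(1) by blast
  qed
  moreover have "J \<subseteq> Basis" "\<forall>j\<in>J. h j \<in> L" using B(1) by (auto simp: J_def)
  ultimately show ?thesis by blast
qed

lemma orthogonal_transformation_orthonormal:
  fixes h :: "'b::euclidean_space \<Rightarrow> 'b"
  assumes h: "\<And>i j. i \<in> Basis \<Longrightarrow> j \<in> Basis \<Longrightarrow> h i \<bullet> h j = (if i = j then 1 else 0)"
  defines "U \<equiv> \<lambda>x. \<Sum>j\<in>Basis. (x \<bullet> j) *\<^sub>R h j" and "W \<equiv> \<lambda>x. \<Sum>j\<in>Basis. (x \<bullet> h j) *\<^sub>R j"
  shows "orthogonal_transformation U" "orthogonal_transformation W" "U (W x) = x" "W (U x) = x"
proof -
  have Uh: "U x \<bullet> h j = x \<bullet> j" if "j \<in> Basis" for x j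
    using that by (simp add: U_def inner_sum_left h if_distrib sum.delta' cong: if_cong)
  have linU: "linear U"
    unfolding U_def by (rule linearI) (simp_all add: inner_add_left scaleR_add_left sum.distrib scaleR_sum_right)
  have linW: "linear W"
    unfolding W_def by (rule linearI) (simp_all add: inner_add_left scaleR_add_left sum.distrib scaleR_sum_right)
  have Wj: "W x \<bullet> j = x \<bullet> h j" if "j \<in> Basis" for x j
    using that by (simp add: W_def)
  have WU: "W (U x) = x" for x
    by (rule euclidean_eqI) (simp add: Wj Uh)
  have "U x \<bullet> U y = x \<bullet> y" for x y
  proof -
    have "U x \<bullet> U y = (\<Sum>j\<in>Basis. (y \<bullet> j) * (U x \<bullet> h j))"
      by (subst (2) U_def) (simp add: inner_sum_right)
    also have "\<dots> = x \<bullet> y"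
      by (subst euclidean_inner[of x y]) (simp add: Uh mult.commute)
    finally show ?thesis .
  qed
  then show oU: "orthogonal_transformation U" using linU by (simp add: orthogonal_transformation_def)
  have UW: "U (W x) = x" for x
    using orthogonal_transformation_surj[OF oU] WU by (metis surjD)
  show "U (W x) = x" "W (U x) = x" by (fact UW, fact WU)
  have "W x \<bullet> W y = x \<bullet> y" for x y
    using oU UW by (metis orthogonal_transformation_def)
  then show "orthogonal_transformation W" using linW by (simp add: orthogonal_transformation_def)
qed

text \<open>
  In an orthonormal basis adapted to the span of \<open>F - p\<^sub>0\<close>, passing from \<open>1\<close> to \<open>\<rho>\<close> dilates the
  coordinates orthogonal to that span and fixes the others.
\<close>

lemma emeasure_orthogonal_sum_scaling:
  fixes F N :: "'b::euclidean_space set" and p\<^sub>0 :: 'b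
  assumes orth: "\<And>p u. p \<in> F \<Longrightarrow> u \<in> N \<Longrightarrow> u \<bullet> (p - p\<^sub>0) = 0"
    and cone: "\<And>u c. u \<in> N \<Longrightarrow> c > 0 \<Longrightarrow> c *\<^sub>R u \<in> N"
    and meas: "{p + u | p u. p \<in> F \<and> u \<in> N \<and> norm u \<le> 1} \<in> sets borel"
  shows "\<exists>k\<le>DIM('b). \<forall>\<rho>>0. emeasure lborel {p + u | p u. p \<in> F \<and> u \<in> N \<and> norm u \<le> \<rho>}
     = ennreal (\<rho> ^ k) * emeasure lborel {p + u | p u. p \<in> F \<and> u \<in> N \<and> norm u \<le> 1}"
proof -
  define E where "E = (\<lambda>\<rho>. {p + u | p u. p \<in> F \<and> u \<in> N \<and> norm u \<le> \<rho>})"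
  define L where "L = span ((\<lambda>p. p - p\<^sub>0) ` F)"
  have "subspace L" by (simp add: L_def subspace_span)
  obtain h :: "'b \<Rightarrow> 'b" and J where J: "J \<subseteq> Basis"
    and h: "\<forall>i\<in>Basis. \<forall>j\<in>Basis. h i \<bullet> h j = (if i = j then 1 else 0)"
    and hL: "\<forall>j\<in>J. h j \<in> L" "\<forall>j\<in>Basis - J. \<forall>x\<in>L. x \<bullet> h j = 0"
    using orthonormal_basis_adapted[OF \<open>subspace L\<close>] by metis
  define U where "U = (\<lambda>x::'b. \<Sum>j\<in>Basis. (x \<bullet> j) *\<^sub>R h j)"
  define W where "W = (\<lambda>x::'b. \<Sum>j\<in>Basis. (x \<bullet> h j) *\<^sub>R j)"
  have U: "orthogonal_transformation U" and W: "orthogonal_transformation W"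
    and UW: "U (W x) = x" and WU: "W (U x) = x" for x
    using orthogonal_transformation_orthonormal[OF h[rule_format]] unfolding U_def W_def by auto
  have Wj: "W x \<bullet> j = x \<bullet> h j" if "j \<in> Basis" for x j
    using that by (simp add: W_def)
  have [measurable]: "U \<in> borel_measurable borel" "W \<in> borel_measurable borel"
    using orthogonal_transformation_linear[OF U] orthogonal_transformation_linear[OF W]
    by (auto intro!: borel_measurable_continuous_onI linear_continuous_on simp: linear_conv_bounded_linear)
  \<comment> \<open>\<open>D \<rho>\<close> divides the coordinates outside \<open>J\<close> by
    \<rho> and so carries \<open>E \<rho>\<close>, in adapted coordinates centred at
    \<open>p\<^sub>0\<close>, onto \<open>E 1\<close>. Its factor \<open>1 / \<rho> ^ k\<close>,
    with \<open>k\<close> the number of such coordinates, produces the power in the claim.\<close>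
  define c where "c = (\<lambda>\<rho>::real. \<lambda>j. if j \<in> J then 1 else 1 / \<rho>)"
  define D where "D = (\<lambda>\<rho>::real. \<lambda>x::'b. \<Sum>j\<in>Basis. (c \<rho> j * (x \<bullet> j)) *\<^sub>R j)"
  have [measurable]: "D \<rho> \<in> borel_measurable borel" for \<rho>
    unfolding D_def by measurable
  have [measurable]: "E 1 \<in> sets borel" using meas by (simp add: E_def)
  have N_J: "u \<bullet> h j = 0" if "u \<in> N" "j \<in> J" for u j
    using bspec[OF hL(1) that(2)] unfolding L_def
    by (rule orthogonal_to_span[unfolded orthogonal_def]) (auto simp: orth that)
  have F_J: "(p - p\<^sub>0) \<bullet> h j = 0" if "p \<in> F" "j \<in> Basis - J" for p j
    using that by (intro hL(2)[rule_format]) (auto simp: L_def intro: span_base)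
  have DW: "D \<rho> (W (p - p\<^sub>0 + u)) = W (p - p\<^sub>0 + (1 / \<rho>) *\<^sub>R u)" if "p \<in> F" "u \<in> N" for \<rho> p u
  proof (rule euclidean_eqI)
    fix j :: 'b assume j: "j \<in> Basis"
    show "D \<rho> (W (p - p\<^sub>0 + u)) \<bullet> j = W (p - p\<^sub>0 + (1 / \<rho>) *\<^sub>R u) \<bullet> j"
      using N_J[OF that(2), of j] F_J[OF that(1), of j] j
      by (auto simp: D_def Wj c_def inner_add_left)
  qed
  have E: "E \<rho> = (\<lambda>x. x + (- p\<^sub>0)) -` W -` D \<rho> -` U -` (\<lambda>x. x + p\<^sub>0) -` E 1" if "\<rho> > 0" for \<rho>
  proof (intro subset_antisym subsetI)
    fix x assume "x \<in> E \<rho>"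
    then obtain p u where pu: "x = p + u" "p \<in> F" "u \<in> N" "norm u \<le> \<rho>" by (auto simp: E_def)
    have "U (D \<rho> (W (x + (- p\<^sub>0)))) + p\<^sub>0 = p + (1 / \<rho>) *\<^sub>R u"
      using DW[OF pu(2,3), of \<rho>] by (simp add: pu(1) UW algebra_simps)
    moreover have "p + (1 / \<rho>) *\<^sub>R u \<in> E 1"
    proof -
      have "(1 / \<rho>) *\<^sub>R u \<in> N" "norm ((1 / \<rho>) *\<^sub>R u) \<le> 1"
        using pu cone[of u "1 / \<rho>"] that by auto
      then show ?thesis unfolding E_def using pu(2) by blast
    qed
    ultimately show "x \<in> (\<lambda>x. x + (- p\<^sub>0)) -` W -` D \<rho> -` U -` (\<lambda>x. x + p\<^sub>0) -` E 1" by simp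
  next
    fix x assume "x \<in> (\<lambda>x. x + (- p\<^sub>0)) -` W -` D \<rho> -` U -` (\<lambda>x. x + p\<^sub>0) -` E 1"
    then obtain p u where pu: "U (D \<rho> (W (x + (- p\<^sub>0)))) + p\<^sub>0 = p + u" "p \<in> F" "u \<in> N" "norm u \<le> 1"
      by (auto simp: E_def)
    have u: "\<rho> *\<^sub>R u \<in> N" using cone pu that by auto
    have "U (D \<rho> (W (x - p\<^sub>0))) = U (D \<rho> (W (p - p\<^sub>0 + \<rho> *\<^sub>R u)))"
      using DW[OF pu(2) u, of \<rho>] pu(1) that by (simp add: UW algebra_simps)
    then have "D \<rho> (W (x - p\<^sub>0)) = D \<rho> (W (p - p\<^sub>0 + \<rho> *\<^sub>R u))"
      by (metis WU)
    moreover have "y = z" if "D \<rho> y = D \<rho> z" for y z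
    proof (rule euclidean_eqI)
      fix j :: 'b assume j: "j \<in> Basis"
      have "D \<rho> y \<bullet> j = D \<rho> z \<bullet> j" using that by simp
      then show "y \<bullet> j = z \<bullet> j" using j \<open>\<rho> > 0\<close> by (auto simp: D_def c_def split: if_splits)
    qed
    ultimately have "W (x - p\<^sub>0) = W (p - p\<^sub>0 + \<rho> *\<^sub>R u)" by blast
    then have "x - p\<^sub>0 = p - p\<^sub>0 + \<rho> *\<^sub>R u" by (metis UW)
    then have "x = p + \<rho> *\<^sub>R u" by (simp add: algebra_simps)
    moreover have "norm (\<rho> *\<^sub>R u) \<le> \<rho>" using pu that by (simp add: mult_left_le)
    ultimately show "x \<in> E \<rho>" unfolding E_def using u pu(2) by blast
  qed
  define k where "k = card (Basis - J)"
  have prod: "(\<Prod>j\<in>Basis. c \<rho> j) = 1 / \<rho> ^ k" if "\<rho> > 0" for \<rho>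
  proof -
    have "(\<Prod>j\<in>Basis. c \<rho> j) = (\<Prod>j\<in>Basis - J. 1 / \<rho>)"
      using J by (intro prod.mono_neutral_cong_right) (auto simp: c_def)
    then show ?thesis by (simp add: k_def power_one_over)
  qed
  show ?thesis
  proof (intro exI[of _ k] conjI allI impI)
    show "k \<le> DIM('b)" unfolding k_def by (intro card_mono) auto
    fix \<rho> :: real assume \<rho>: "\<rho> > 0"
    define A where "A = U -` (\<lambda>x. x + p\<^sub>0) -` E 1"
    have tE: "(\<lambda>x. x + p\<^sub>0) -` E 1 \<in> sets borel"
      by (rule measurable_sets_borel[of _ borel]) measurable
    then have "A \<in> sets borel"
      unfolding A_def by (rule measurable_sets_borel[of U, rotated]) measurable
    then have DA: "D \<rho> -` A \<in> sets borel"
      by (rule measurable_sets_borel[of "D \<rho>", rotated]) measurable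
    then have WDA: "W -` D \<rho> -` A \<in> sets borel"
      by (rule measurable_sets_borel[of W, rotated]) measurable
    have 1: "emeasure lborel (E \<rho>) = emeasure lborel (D \<rho> -` A)"
      unfolding E[OF \<rho>] A_def[symmetric]
      by (simp only: emeasure_lborel_translation[OF WDA] emeasure_lborel_orthogonal_transformation[OF W DA])
    have 2: "emeasure lborel A = emeasure lborel (E 1)"
      unfolding A_def by (simp only: emeasure_lborel_orthogonal_transformation[OF U tE]
          emeasure_lborel_translation[OF \<open>E 1 \<in> sets borel\<close>])
    have 3: "emeasure lborel A = ennreal (1 / \<rho> ^ k) * emeasure lborel (D \<rho> -` A)"
      using emeasure_lborel_diagonal[of "c \<rho>" A] \<open>A \<in> sets borel\<close> prod[OF \<rho>] \<rho> by (auto simp: D_def c_def)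
    have 4: "ennreal (\<rho> ^ k) * ennreal (1 / \<rho> ^ k) = 1"
      using \<rho> by (simp flip: ennreal_mult)
    have "ennreal (\<rho> ^ k) * emeasure lborel (E 1) = emeasure lborel (E \<rho>)"
      by (simp only: 1 2[symmetric] 3 mult.assoc[symmetric] 4 mult_1)
    from sym[OF this] show "emeasure lborel {p + u | p u. p \<in> F \<and> u \<in> N \<and> norm u \<le> \<rho>}
       = ennreal (\<rho> ^ k) * emeasure lborel {p + u | p u. p \<in> F \<and> u \<in> N \<and> norm u \<le> 1}"
      unfolding E_def .
  qed
qed

section \<open>The volume polynomial of a polytope\<close>

lemma measure_lebesgue_borel:
  fixes A :: "'b::euclidean_space set"
  assumes "A \<in> sets borel"
  shows "measure lebesgue A = measure lborel A"
  using assms by (simp add: measure_completion)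

text \<open>Interpolation will use polynomiality and the degree bound only, so the coefficients stay
  unidentified. The pieces scale by positive factors, whence \<open>\<rho> > 0\<close>; radius 0 is
  recovered later by continuity, for all compact convex sets at once.\<close>

lemma polytope_parallel_volume:
  fixes P :: "'b::euclidean_space set"
  assumes "polytope P" "P \<noteq> {}"
  shows "\<exists>q. degree q \<le> DIM('b) \<and> (\<forall>\<rho>>0. measure lebesgue (parallel_body P \<rho>) = poly q \<rho>)"
proof -
  have cvx: "convex P" and cpt: "compact P" and cl: "closed P"
    using assms polytope_imp_convex polytope_imp_compact polytope_imp_closed by blast+
  obtain HS where HS: "finite HS" "P = \<Inter>HS" "\<forall>h\<in>HS. \<exists>a \<beta>. a \<noteq> 0 \<and> h = {x. a \<bullet> x \<le> \<beta>}"
    using polytope_imp_polyhedron[OF assms(1)] unfolding polyhedron_def by blast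
  then obtain a \<beta> where ab: "\<And>h. h \<in> HS \<Longrightarrow> h = {x. a h \<bullet> x \<le> \<beta> h}"
    by metis
  have memP: "x \<in> P \<longleftrightarrow> (\<forall>h\<in>HS. a h \<bullet> x \<le> \<beta> h)" for x
    using ab by (auto simp: HS(2))
  define J where "J = (\<lambda>x. {h\<in>HS. a h \<bullet> x = \<beta> h})"
  define F where "F = (\<lambda>K. {x\<in>P. J x = K})"
  \<comment> \<open>The normal cone at the points with active set \<open>K\<close>, described as the
    polar of the directions that violate no active constraint to first order. In this form it
    depends on the point only through \<open>K\<close>.\<close>
  define N where "N = (\<lambda>K. {u. \<forall>v. (\<forall>h\<in>K. a h \<bullet> v \<le> 0) \<longrightarrow> u \<bullet> v \<le> 0})"
  define E where "E = (\<lambda>K \<rho>. {p + u | p u. p \<in> F K \<and> u \<in> N K \<and> norm u \<le> \<rho>})"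
  define cp where "cp = closest_point P"
  have cpP: "cp x \<in> P" for x
    unfolding cp_def using cl assms(2) by (rule closest_point_in_set)
  have normal: "x - cp x \<in> N (J (cp x))" for x
  proof -
    define p where "p = cp x"
    have "(x - p) \<bullet> v \<le> 0" if v: "\<forall>h\<in>J p. a h \<bullet> v \<le> 0" for v
    proof -
      \<comment> \<open>No active constraint increases along \<open>v\<close> and the inactive ones
        have slack, so a short step along \<open>v\<close> stays in \<open>P\<close>. The obtuse
        angle at the nearest point then gives the sign.\<close>
      have "\<exists>t>0. p + t *\<^sub>R v \<in> P"
      proof -
        have "\<exists>t>0. \<forall>s. 0 < s \<longrightarrow> s \<le> t \<longrightarrow> a h \<bullet> (p + s *\<^sub>R v) \<le> \<beta> h" if h: "h \<in> HS" for h
        proof (cases "a h \<bullet> v \<le> 0")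
          case True
          have "a h \<bullet> p \<le> \<beta> h" using cpP[of x] memP h by (auto simp: p_def)
          then have "a h \<bullet> (p + s *\<^sub>R v) \<le> \<beta> h" if "s > 0" for s
            using mult_nonneg_nonpos[of s "a h \<bullet> v"] that True by (simp add: inner_add_right)
          then show ?thesis by (intro exI[of _ 1]) auto
        next
          case False
          then have "h \<notin> J p" using v by auto
          then have lt: "a h \<bullet> p < \<beta> h" using cpP[of x] memP h by (force simp: p_def J_def)
          show ?thesis
          proof (intro exI[of _ "(\<beta> h - a h \<bullet> p) / (a h \<bullet> v)"] conjI allI impI)
            show "0 < (\<beta> h - a h \<bullet> p) / (a h \<bullet> v)" using lt False by simp
            fix s assume "s \<le> (\<beta> h - a h \<bullet> p) / (a h \<bullet> v)"
            then show "a h \<bullet> (p + s *\<^sub>R v) \<le> \<beta> h"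
              using False by (simp add: inner_add_right field_simps)
          qed
        qed
        then obtain t where t: "\<And>h. h \<in> HS \<Longrightarrow> t h > 0"
          "\<And>h s. h \<in> HS \<Longrightarrow> 0 < s \<Longrightarrow> s \<le> t h \<Longrightarrow> a h \<bullet> (p + s *\<^sub>R v) \<le> \<beta> h"
          by metis
        \<comment> \<open>The inserted 1 keeps the minimum meaningful when \<open>HS\<close> is
          empty.\<close>
        define m where "m = Min (insert 1 (t ` HS))"
        have "m > 0" unfolding m_def using HS(1) t(1) by (subst Min_gr_iff) auto
        moreover have "m \<le> t h" if "h \<in> HS" for h
          unfolding m_def using that HS(1) by (intro Min_le) auto
        ultimately have "p + m *\<^sub>R v \<in> P" using t(2) memP by blast
        with \<open>m > 0\<close> show ?thesis by blast
      qed
      then obtain t where t: "t > 0" "p + t *\<^sub>R v \<in> P" by blast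
      have "(x - p) \<bullet> (p + t *\<^sub>R v - p) \<le> 0"
        unfolding p_def cp_def by (rule closest_point_dot[OF cvx cl]) (use t(2) in \<open>simp add: p_def cp_def\<close>)
      then show ?thesis using t(1) by (simp add: mult_le_0_iff)
    qed
    then show ?thesis by (simp add: N_def p_def)
  qed
  have closest: "cp (p + u) = p" if "p \<in> P" "u \<in> N (J p)" for p u
  proof -
    have "dist (p + u) p \<le> dist (p + u) z" if z: "z \<in> P" for z
    proof -
      have "\<forall>h\<in>J p. a h \<bullet> (z - p) \<le> 0"
        using z memP by (auto simp: J_def inner_diff_right)
      then have "u \<bullet> (z - p) \<le> 0" using \<open>u \<in> N (J p)\<close> by (simp add: N_def)
      then have "norm u ^ 2 \<le> norm (u - (z - p)) ^ 2"
        by (simp add: power2_norm_eq_inner inner_diff_left inner_diff_right inner_commute)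
          (smt (verit, ccfv_SIG) inner_commute inner_diff_right inner_ge_zero inner_diff_left)
      then have "norm u \<le> norm (u - (z - p))" by (rule power2_le_imp_le) simp
      then show ?thesis by (simp add: dist_norm algebra_simps)
    qed
    then show ?thesis
      unfolding cp_def using closest_point_unique[OF cvx cl that(1)] by metis
  qed
  \<comment> \<open>A point determines its decomposition into nearest point and normal vector, so
    \<open>cp\<close> alone describes \<open>E K \<rho>\<close>. This gives disjointness for
    different \<open>K\<close> and, \<open>cp\<close> being continuous, measurability.\<close>
  have E_eq: "E K \<rho> = {x. J (cp x) = K \<and> dist x (cp x) \<le> \<rho>}" for K \<rho>
  proof (intro subset_antisym subsetI)
    fix x assume "x \<in> E K \<rho>"
    then obtain p u where pu: "x = p + u" "p \<in> P" "J p = K" "u \<in> N K" "norm u \<le> \<rho>"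
      by (auto simp: E_def F_def)
    then show "x \<in> {x. J (cp x) = K \<and> dist x (cp x) \<le> \<rho>}"
      using closest[of p u] by (simp add: dist_norm)
  next
    fix x assume x: "x \<in> {x. J (cp x) = K \<and> dist x (cp x) \<le> \<rho>}"
    then have "x = cp x + (x - cp x)" "cp x \<in> F K" "x - cp x \<in> N K" "norm (x - cp x) \<le> \<rho>"
      using normal[of x] cpP[of x] by (auto simp: F_def dist_norm)
    then show "x \<in> E K \<rho>" unfolding E_def by blast
  qed
  have [measurable]: "cp \<in> borel_measurable borel"
    unfolding cp_def by (intro borel_measurable_continuous_onI continuous_on_closest_point cvx cl assms(2))
  have meas: "E K \<rho> \<in> sets borel" for K \<rho>
  proof (cases "K \<subseteq> HS")
    case True
    have "J y = K \<longleftrightarrow> (\<forall>h\<in>HS. (a h \<bullet> y = \<beta> h) = (h \<in> K))" for y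
      using True by (auto simp: J_def)
    then have "E K \<rho> = {x\<in>space borel. (\<forall>h\<in>HS. (a h \<bullet> cp x = \<beta> h) = (h \<in> K)) \<and> dist x (cp x) \<le> \<rho>}"
      by (simp add: E_eq)
    also have "\<dots> \<in> sets borel"
      using HS(1) countable_finite by measurable
    finally show ?thesis .
  next
    case False
    then have "E K \<rho> = {}" by (auto simp: E_eq J_def)
    then show ?thesis by simp
  qed
  have "\<exists>k\<le>DIM('b). \<forall>\<rho>>0. emeasure lborel (E K \<rho>) = ennreal (\<rho> ^ k) * emeasure lborel (E K 1)" for K
  proof (cases "F K = {}")
    case True
    then show ?thesis by (auto simp: E_def)
  next
    case False
    then obtain p\<^sub>0 where p0: "p\<^sub>0 \<in> F K" by blast
    show ?thesis
      unfolding E_def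
    proof (rule emeasure_orthogonal_sum_scaling[of _ _ p\<^sub>0])
      fix p u assume "p \<in> F K" "u \<in> N K"
      then have eq: "a h \<bullet> (p - p\<^sub>0) = 0" if "h \<in> K" for h
      proof -
        have "h \<in> J p" "h \<in> J p\<^sub>0" using p0 \<open>p \<in> F K\<close> that by (simp_all add: F_def)
        then show ?thesis by (simp add: J_def inner_diff_right)
      qed
      \<comment> \<open>Both \<open>p - p\<^sub>0\<close> and its negative keep the constraints in
        \<open>K\<close> active, so polarity bounds the inner product with \<open>u\<close> from
        both sides.\<close>
      have "\<forall>h\<in>K. a h \<bullet> (p - p\<^sub>0) \<le> 0" "\<forall>h\<in>K. a h \<bullet> - (p - p\<^sub>0) \<le> 0"
        using eq by (simp_all only: inner_minus_right) auto
      then have "u \<bullet> (p - p\<^sub>0) \<le> 0" "u \<bullet> - (p - p\<^sub>0) \<le> 0"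
        using \<open>u \<in> N K\<close> unfolding N_def by blast+
      then show "u \<bullet> (p - p\<^sub>0) = 0" by (simp only: inner_minus_right)
    next
      fix u and c :: real assume "u \<in> N K" "c > 0"
      then show "c *\<^sub>R u \<in> N K" by (auto simp: N_def mult_le_0_iff)
    next
      show "{p + u |p u. p \<in> F K \<and> u \<in> N K \<and> norm u \<le> 1} \<in> sets borel"
        using meas[of K 1] by (simp add: E_def)
    qed
  qed
  then obtain k where k: "\<And>K. k K \<le> DIM('b)"
    "\<And>K \<rho>. \<rho> > 0 \<Longrightarrow> emeasure lborel (E K \<rho>) = ennreal (\<rho> ^ k K) * emeasure lborel (E K 1)"
    by metis
  have union: "parallel_body P \<rho> = (\<Union>K\<in>Pow HS. E K \<rho>)" if \<rho>: "\<rho> > 0" for \<rho>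
  proof (intro subset_antisym subsetI)
    fix x assume "x \<in> parallel_body P \<rho>"
    then obtain y where "y \<in> P" "dist x y \<le> \<rho>" using \<rho> by (auto simp: mem_parallel_body_iff)
    then have "dist x (cp x) \<le> \<rho>"
      using closest_point_le[OF cl, of y x] by (simp add: cp_def)
    then show "x \<in> (\<Union>K\<in>Pow HS. E K \<rho>)" by (auto simp: E_eq J_def)
  next
    fix x assume "x \<in> (\<Union>K\<in>Pow HS. E K \<rho>)"
    then show "x \<in> parallel_body P \<rho>"
      using cpP[of x] \<rho> by (auto simp: E_eq mem_parallel_body_iff)
  qed
  have fin: "E K \<rho> \<in> fmeasurable lborel" if "\<rho> > 0" "K \<in> Pow HS" for K \<rho>
  proof (rule fmeasurableI2)
    show "parallel_body P \<rho> \<in> fmeasurable lborel"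
      by (rule fmeasurable_compact) (rule compact_parallel_body[OF cpt])
    show "E K \<rho> \<subseteq> parallel_body P \<rho>" using union[OF that(1)] that(2) by blast
    show "E K \<rho> \<in> sets lborel" using meas by simp
  qed
  define q where "q = (\<Sum>K\<in>Pow HS. monom (measure lborel (E K 1)) (k K))"
  have "degree q \<le> DIM('b)"
    unfolding q_def using HS(1) k(1) by (intro degree_sum_le) (auto intro: order.trans[OF degree_monom_le])
  moreover have "measure lebesgue (parallel_body P \<rho>) = poly q \<rho>" if \<rho>: "\<rho> > 0" for \<rho>
  proof -
    have "measure lebesgue (parallel_body P \<rho>) = measure lborel (\<Union>K\<in>Pow HS. E K \<rho>)"
      using union[OF \<rho>] meas HS(1) by (subst measure_lebesgue_borel) (auto intro!: sets.finite_UN)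
    also have "\<dots> = (\<Sum>K\<in>Pow HS. measure lborel (E K \<rho>))"
      using HS(1) fin[OF \<rho>] meas
      by (intro measure_finite_Union) (auto simp: disjoint_family_on_def E_eq fmeasurable_def less_top[symmetric])
    also have "\<dots> = (\<Sum>K\<in>Pow HS. \<rho> ^ k K * measure lborel (E K 1))"
      using k(2)[OF \<rho>] \<rho> by (simp add: measure_def enn2real_mult)
    also have "\<dots> = poly q \<rho>"
      by (simp add: q_def poly_sum poly_monom mult.commute)
    finally show ?thesis .
  qed
  ultimately show ?thesis by blast
qed

section \<open>Parallel bodies of sets at small Hausdorff distance\<close>

lemma parallel_body_subset:
  assumes "A \<subseteq> parallel_body B \<delta>" "0 \<le> \<rho>" "0 \<le> \<delta>"
  shows "parallel_body A \<rho> \<subseteq> parallel_body B (\<rho> + \<delta>)"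
proof
  fix x assume "x \<in> parallel_body A \<rho>"
  then obtain a where a: "a \<in> A" "dist x a \<le> \<rho>" using assms(2) by (auto simp: mem_parallel_body_iff)
  then obtain b where "b \<in> B" "dist a b \<le> \<delta>" using assms(1,3) by (auto simp: mem_parallel_body_iff subset_iff)
  moreover from this have "dist x b \<le> \<rho> + \<delta>" using a(2) dist_triangle[of x b a] by linarith
  ultimately show "x \<in> parallel_body B (\<rho> + \<delta>)" using assms(2,3) by (auto simp: mem_parallel_body_iff)
qed

lemma subset_parallel_body: "\<rho> \<ge> 0 \<Longrightarrow> A \<subseteq> parallel_body A \<rho>"
  by (force simp: mem_parallel_body_iff)

lemma parallel_body_dilation:
  fixes A :: "'b::euclidean_space set"
  assumes "convex A" "a \<in> A" "\<rho> > 0" "\<delta> \<ge> 0"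
  shows "parallel_body A (\<rho> + \<delta>) \<subseteq> (\<lambda>x. (1 + \<delta> / \<rho>) *\<^sub>R x + (- (\<delta> / \<rho>)) *\<^sub>R a) ` parallel_body A \<rho>"
proof
  fix y assume "y \<in> parallel_body A (\<rho> + \<delta>)"
  then obtain z u where zu: "y = z + (\<rho> + \<delta>) *\<^sub>R u" "z \<in> A" "u \<in> cball 0 1"
    by (auto simp: parallel_body_def)
  define t where "t = 1 + \<delta> / \<rho>"
  have t: "t \<ge> 1" "t * \<rho> = \<rho> + \<delta>" "\<delta> / \<rho> = t - 1"
    using assms by (auto simp: t_def field_simps)
  \<comment> \<open>The point of \<open>A\<close> that the dilation by \<open>t\<close> about
    \<open>a\<close> sends to \<open>z\<close>. As \<open>t * \<rho> = \<rho> + \<delta>\<close>,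
    the same dilation sends \<open>w + \<rho> *\<^sub>R u\<close> to \<open>y\<close>.\<close>
  define w where "w = (1 - 1 / t) *\<^sub>R a + (1 / t) *\<^sub>R z"
  have "w \<in> A"
    unfolding w_def using t(1) assms(1,2) zu(2) by (intro convexD) (auto simp: field_simps)
  then have "w + \<rho> *\<^sub>R u \<in> parallel_body A \<rho>"
    using zu(3) by (auto simp: parallel_body_def)
  moreover have "y = t *\<^sub>R (w + \<rho> *\<^sub>R u) + (- (t - 1)) *\<^sub>R a"
  proof -
    have "t *\<^sub>R w = (t - 1) *\<^sub>R a + z"
      using t(1) by (simp add: w_def scaleR_add_right right_diff_distrib)
    then show ?thesis by (simp only: zu(1) scaleR_add_right scaleR_scaleR t(2)) (simp add: scaleR_diff_left)
  qed
  ultimately show "y \<in> (\<lambda>x. (1 + \<delta> / \<rho>) *\<^sub>R x + (- (\<delta> / \<rho>)) *\<^sub>R a) ` parallel_body A \<rho>"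
    unfolding t(3) by (auto simp: t_def[symmetric])
qed

lemma measure_parallel_body_le:
  fixes A B :: "'b::euclidean_space set"
  assumes "compact A" "compact B" "convex B" "B \<noteq> {}" "A \<subseteq> parallel_body B \<delta>" "\<rho> > 0" "\<delta> \<ge> 0"
  shows "measure lebesgue (parallel_body A \<rho>) \<le> (1 + \<delta> / \<rho>) ^ DIM('b) * measure lebesgue (parallel_body B \<rho>)"
proof -
  obtain b where b: "b \<in> B" using assms(4) by blast
  have t: "1 + \<delta> / \<rho> > 0" using assms(6,7) by (simp add: add_pos_nonneg)
  let ?T = "\<lambda>x. (1 + \<delta> / \<rho>) *\<^sub>R x + (- (\<delta> / \<rho>)) *\<^sub>R b"
  have sub: "parallel_body A \<rho> \<subseteq> ?T ` parallel_body B \<rho>"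
    by (rule order.trans[OF parallel_body_subset[OF assms(5) less_imp_le[OF assms(6)] assms(7)]
          parallel_body_dilation[OF assms(3) b assms(6,7)]])
  have "compact (?T ` parallel_body B \<rho>)"
    by (intro compact_continuous_image continuous_intros compact_parallel_body assms(2))
  then have "measure lebesgue (parallel_body A \<rho>) \<le> measure lebesgue (?T ` parallel_body B \<rho>)"
    using sub compact_parallel_body[OF assms(1)]
    by (intro measure_mono_fmeasurable) (auto simp: lmeasurable_compact fmeasurableD)
  also have "\<dots> = \<bar>1 + \<delta> / \<rho>\<bar> ^ DIM('b) * measure lebesgue (parallel_body B \<rho>)"
    by (rule measure_lebesgue_affine)
  finally show ?thesis using t by (simp add: abs_of_pos)
qed

lemma measure_parallel_body_le_cball:
  fixes A :: "'b::euclidean_space set"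
  assumes "compact A" "A \<subseteq> cball 0 R" "\<rho> \<ge> 0"
  shows "measure lebesgue (parallel_body A \<rho>) \<le> measure lebesgue (cball (0::'b) (R + \<rho>))"
proof (intro measure_mono_fmeasurable)
  show "parallel_body A \<rho> \<subseteq> cball 0 (R + \<rho>)"
  proof
    fix x assume "x \<in> parallel_body A \<rho>"
    then obtain a where "a \<in> A" "dist x a \<le> \<rho>" using assms(3) by (auto simp: mem_parallel_body_iff)
    then show "x \<in> cball 0 (R + \<rho>)"
      using assms(2) norm_triangle_sub[of x a] by (force simp: dist_norm subset_iff)
  qed
qed (use compact_parallel_body[OF assms(1)] in \<open>auto simp: lmeasurable_compact fmeasurableD\<close>)

text \<open>Each one-sided comparison is multiplicative. Bounding the remaining volume by that of a
  ball turns it into an additive estimate that is uniform over all bodies in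
  \<open>cball 0 R\<close>.\<close>

lemma abs_measure_parallel_body_diff_le:
  fixes A B :: "'b::euclidean_space set"
  assumes "compact A" "convex A" "A \<noteq> {}" "compact B" "convex B" "B \<noteq> {}"
    and sub: "A \<subseteq> parallel_body B \<delta>" "B \<subseteq> parallel_body A \<delta>" "A \<subseteq> cball 0 R" "B \<subseteq> cball 0 R"
    and pos: "\<rho> > 0" "\<delta> \<ge> 0"
  shows "\<bar>measure lebesgue (parallel_body A \<rho>) - measure lebesgue (parallel_body B \<rho>)\<bar>
    \<le> ((1 + \<delta> / \<rho>) ^ DIM('b) - 1) * measure lebesgue (cball (0::'b) (R + \<rho>))"
proof -
  have *: "measure lebesgue (parallel_body A \<rho>) - measure lebesgue (parallel_body B \<rho>)
    \<le> ((1 + \<delta> / \<rho>) ^ DIM('b) - 1) * measure lebesgue (cball (0::'b) (R + \<rho>))"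
    if "compact A" "compact B" "convex B" "B \<noteq> {}" "A \<subseteq> parallel_body B \<delta>" "B \<subseteq> cball 0 R" for A B :: "'b set"
  proof -
    have "measure lebesgue (parallel_body A \<rho>) - measure lebesgue (parallel_body B \<rho>)
      \<le> ((1 + \<delta> / \<rho>) ^ DIM('b) - 1) * measure lebesgue (parallel_body B \<rho>)"
      using measure_parallel_body_le[OF that(1-5) pos] by (simp add: algebra_simps)
    also have "\<dots> \<le> ((1 + \<delta> / \<rho>) ^ DIM('b) - 1) * measure lebesgue (cball (0::'b) (R + \<rho>))"
      using that pos by (intro mult_left_mono measure_parallel_body_le_cball) (auto intro!: one_le_power)
    finally show ?thesis .
  qed
  show ?thesis
    using *[OF assms(1,4,5,6) sub(1,4)] *[OF assms(4,1,2,3) sub(2,3)] by linarith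
qed

section \<open>Intrinsic volumes of convex bodies\<close>

text \<open>The node 0 is excluded because \<open>abs_measure_parallel_body_diff_le\<close>
  degenerates as \<rho> tends to 0.\<close>

definition lagrange_poly :: "nat \<Rightarrow> nat \<Rightarrow> real poly" where
  "lagrange_poly d j = (\<Prod>i\<in>{1..Suc d} - {j}. smult (1 / (real j - real i)) [:- real i, 1:])"

lemma degree_lagrange_poly: "j \<in> {1..Suc d} \<Longrightarrow> degree (lagrange_poly d j) \<le> d"
proof -
  assume j: "j \<in> {1..Suc d}"
  have "degree (lagrange_poly d j) \<le> (\<Sum>i\<in>{1..Suc d} - {j}. (degree \<circ> (\<lambda>i. smult (1 / (real j - real i)) [:- real i, 1:])) i)"
    unfolding lagrange_poly_def by (rule degree_prod_sum_le) auto
  also have "\<dots> \<le> (\<Sum>i\<in>{1..Suc d} - {j}. 1)"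
    by (intro sum_mono) auto
  also have "\<dots> = d" using j by simp
  finally show ?thesis .
qed

lemma poly_lagrange_poly:
  "i \<in> {1..Suc d} \<Longrightarrow> j \<in> {1..Suc d} \<Longrightarrow> poly (lagrange_poly d j) (real i) = (if i = j then 1 else 0)"
  by (auto simp: lagrange_poly_def poly_prod divide_simps intro!: prod.neutral)

lemma lagrange_interpolation:
  assumes "degree p \<le> d"
  shows "p = (\<Sum>j\<in>{1..Suc d}. smult (poly p (real j)) (lagrange_poly d j))"
proof (rule poly_eqI_degree)
  let ?A = "real ` {1..Suc d}"
  have card: "card ?A = Suc d" by (simp add: card_image)
  show "card ?A > degree p" using assms card by simp
  have "degree (\<Sum>j\<in>{1..Suc d}. smult (poly p (real j)) (lagrange_poly d j)) \<le> d"
    by (intro degree_sum_le order.trans[OF degree_smult_le] degree_lagrange_poly) simp_all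
  then show "card ?A > degree (\<Sum>j\<in>{1..Suc d}. smult (poly p (real j)) (lagrange_poly d j))"
    using card by simp
  fix x assume "x \<in> ?A"
  then obtain i where i: "i \<in> {1..Suc d}" "x = real i" by blast
  have "poly (\<Sum>j\<in>{1..Suc d}. smult (poly p (real j)) (lagrange_poly d j)) x
      = (\<Sum>j\<in>{1..Suc d}. poly p (real j) * (if i = j then 1 else 0))"
    unfolding poly_sum i(2) by (intro sum.cong) (auto simp: poly_lagrange_poly[OF i(1)])
  also have "\<dots> = poly p x" using i by (simp add: if_distrib cong: if_cong)
  finally show "poly p x = poly (\<Sum>j\<in>{1..Suc d}. smult (poly p (real j)) (lagrange_poly d j)) x" by simp
qed

text \<open>The polytope is the hull of a finite \<epsilon>-net taken inside \<open>A\<close>, so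
  one of the two inclusions is exact and the volumes compare by monotonicity.\<close>

lemma compact_convex_polytope_approx:
  fixes A :: "'b::euclidean_space set"
  assumes "compact A" "convex A" "A \<noteq> {}" "\<epsilon> > 0"
  shows "\<exists>P. polytope P \<and> P \<noteq> {} \<and> P \<subseteq> A \<and> A \<subseteq> parallel_body P \<epsilon>"
proof -
  obtain k where k: "finite k" "k \<subseteq> A" "A \<subseteq> (\<Union>x\<in>k. ball x \<epsilon>)"
    using seq_compact_imp_totally_bounded[OF compact_imp_seq_compact[OF assms(1)]] assms(4) by auto
  show ?thesis
  proof (intro exI[of _ "convex hull k"] conjI)
    show "polytope (convex hull k)" using k(1) by (rule polytope_convex_hull)
    show "convex hull k \<noteq> {}" using k(3) assms(3) by auto
    show "convex hull k \<subseteq> A" using k(2) assms(2) by (rule hull_minimal)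
    show "A \<subseteq> parallel_body (convex hull k) \<epsilon>"
    proof
      fix x assume "x \<in> A"
      then obtain y where "y \<in> k" "dist x y \<le> \<epsilon>" using k(3) by (force simp: dist_commute)
      then show "x \<in> parallel_body (convex hull k) \<epsilon>"
        using assms(4) by (auto simp: mem_parallel_body_iff intro: hull_inc)
    qed
  qed
qed

text \<open>The interpolation identity is linear in finitely many volumes, with coefficients
  independent of the body. It therefore passes from polytopes to their limit without any control of
  the individual volume polynomials.\<close>

lemma measure_parallel_body_interpolation:
  fixes A :: "'b::euclidean_space set"
  assumes A: "compact A" "convex A" "A \<noteq> {}" and "\<rho> \<ge> 0"
  shows "measure lebesgue (parallel_body A \<rho>) =
    (\<Sum>j\<in>{1..Suc DIM('b)}. measure lebesgue (parallel_body A (real j)) * poly (lagrange_poly DIM('b) j) \<rho>)"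
    (is "?vol A \<rho> = ?p \<rho>")
proof -
  have pos: "?vol A \<rho> = ?p \<rho>" if \<rho>: "\<rho> > 0" for \<rho>
  proof -
    have "\<forall>n. \<exists>P. polytope P \<and> P \<noteq> {} \<and> P \<subseteq> A \<and> A \<subseteq> parallel_body P (1 / real (Suc n))"
      by (intro allI compact_convex_polytope_approx A) simp
    then obtain P where P: "\<And>n. polytope (P n)" "\<And>n. P n \<noteq> {}" "\<And>n. P n \<subseteq> A"
      "\<And>n. A \<subseteq> parallel_body (P n) (1 / real (Suc n))"
      by metis
    have Pc: "compact (P n)" "convex (P n)" for n
      using P(1) polytope_imp_compact polytope_imp_convex by blast+
    have lim: "(\<lambda>n. ?vol (P n) \<sigma>) \<longlonglongrightarrow> ?vol A \<sigma>" if \<sigma>: "\<sigma> > 0" for \<sigma>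
    proof (rule tendsto_sandwich)
      define c where "c = (\<lambda>n. (1 + 1 / real (Suc n) / \<sigma>) ^ DIM('b))"
      have c1: "c n > 0" for n unfolding c_def using \<sigma> by (intro zero_less_power add_pos_pos) auto
      have "c \<longlonglongrightarrow> (1 + 0 / \<sigma>) ^ DIM('b)"
        unfolding c_def by (intro tendsto_intros LIMSEQ_inverse_real_of_nat[unfolded inverse_eq_divide]) (use \<sigma> in auto)
      then have "(\<lambda>n. ?vol A \<sigma> / c n) \<longlonglongrightarrow> ?vol A \<sigma> / 1" by (intro tendsto_intros) auto
      then show "(\<lambda>n. ?vol A \<sigma> / c n) \<longlonglongrightarrow> ?vol A \<sigma>" by simp
      show "eventually (\<lambda>n. ?vol A \<sigma> / c n \<le> ?vol (P n) \<sigma>) sequentially"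
      proof (intro always_eventually allI)
        fix n
        have "?vol A \<sigma> \<le> c n * ?vol (P n) \<sigma>"
          unfolding c_def
          by (rule measure_parallel_body_le[OF A(1) Pc P(2) P(4) \<sigma>]) simp
        then show "?vol A \<sigma> / c n \<le> ?vol (P n) \<sigma>" using c1[of n] by (simp add: field_simps)
      qed
      show "eventually (\<lambda>n. ?vol (P n) \<sigma> \<le> ?vol A \<sigma>) sequentially"
        by (intro always_eventually allI measure_mono_fmeasurable parallel_body_mono P(3))
          (use A(1) Pc(1) in \<open>auto intro!: lmeasurable_compact compact_parallel_body fmeasurableD\<close>)
    qed simp
    obtain q where q: "\<And>n. degree (q n) \<le> DIM('b)" "\<And>n \<sigma>. \<sigma> > 0 \<Longrightarrow> ?vol (P n) \<sigma> = poly (q n) \<sigma>"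
      using polytope_parallel_volume[OF P(1,2)] by metis
    have "?vol (P n) \<rho> = (\<Sum>j\<in>{1..Suc DIM('b)}. ?vol (P n) (real j) * poly (lagrange_poly DIM('b) j) \<rho>)" for n
    proof -
      have "?vol (P n) \<rho> = poly (\<Sum>j\<in>{1..Suc DIM('b)}. smult (poly (q n) (real j)) (lagrange_poly DIM('b) j)) \<rho>"
        by (simp only: lagrange_interpolation[OF q(1), of n, symmetric] q(2)[OF \<rho>])
      also have "\<dots> = (\<Sum>j\<in>{1..Suc DIM('b)}. ?vol (P n) (real j) * poly (lagrange_poly DIM('b) j) \<rho>)"
        unfolding poly_sum by (intro sum.cong) (auto simp: q(2))
      finally show ?thesis .
    qed
    moreover have "(\<lambda>n. \<Sum>j\<in>{1..Suc DIM('b)}. ?vol (P n) (real j) * poly (lagrange_poly DIM('b) j) \<rho>) \<longlonglongrightarrow> ?p \<rho>"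
      by (intro tendsto_sum tendsto_mult lim tendsto_const) auto
    ultimately have "(\<lambda>n. ?vol (P n) \<rho>) \<longlonglongrightarrow> ?p \<rho>" by (simp only:)
    with lim[OF \<rho>] show ?thesis by (rule LIMSEQ_unique)
  qed
  show ?thesis
  proof (cases "\<rho> = 0")
    case False
    then have "\<rho> > 0" using \<open>\<rho> \<ge> 0\<close> by simp
    then show ?thesis by (rule pos)
  next
    \<comment> \<open>Both sides are right-continuous at 0: the left because a closed set is the
      intersection of its parallel bodies, the right as a polynomial in \<rho>.\<close>
    case True
    have "(\<lambda>n. ?vol A (1 / real (Suc n))) \<longlonglongrightarrow> measure lebesgue (\<Inter>n. parallel_body A (1 / real (Suc n)))"
    proof (rule Lim_measure_decseq)
      show "range (\<lambda>n. parallel_body A (1 / real (Suc n))) \<subseteq> sets lebesgue"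
        using A(1) by (auto intro!: lmeasurable_compact compact_parallel_body fmeasurableD)
      show "decseq (\<lambda>n. parallel_body A (1 / real (Suc n)))"
      proof (rule decseq_SucI, rule subsetI)
        fix n x assume "x \<in> parallel_body A (1 / real (Suc (Suc n)))"
        then obtain a where "a \<in> A" "dist x a \<le> 1 / real (Suc (Suc n))"
          by (auto simp: mem_parallel_body_iff simp del: of_nat_Suc)
        moreover have "1 / real (Suc (Suc n)) \<le> 1 / real (Suc n)"
          by (rule divide_left_mono) auto
        ultimately have "\<exists>a\<in>A. dist x a \<le> 1 / real (Suc n)" by (meson order.trans)
        then show "x \<in> parallel_body A (1 / real (Suc n))"
          by (simp add: mem_parallel_body_iff)
      qed
      show "emeasure lebesgue (parallel_body A (1 / real (Suc n))) \<noteq> \<infinity>" for n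
        using fmeasurableD2[OF lmeasurable_compact[OF compact_parallel_body[OF A(1)]]]
        by (simp only: infinity_ennreal_def not_False_eq_True)
    qed
    moreover have "(\<Inter>n. parallel_body A (1 / real (Suc n))) = A"
    proof (intro subset_antisym subsetI)
      fix x assume x: "x \<in> (\<Inter>n. parallel_body A (1 / real (Suc n)))"
      have "x \<in> closure A"
      proof (subst closure_approachable, intro allI impI)
        fix e :: real assume "e > 0"
        then obtain n where n: "1 / real (Suc n) < e"
          using reals_Archimedean[of e] by (auto simp: inverse_eq_divide)
        have "x \<in> parallel_body A (1 / real (Suc n))" using x by blast
        then obtain y where "y \<in> A" "dist x y \<le> 1 / real (Suc n)" by (auto simp: mem_parallel_body_iff)
        with n show "\<exists>y\<in>A. dist y x < e" by (auto simp: dist_commute intro!: bexI[of _ y])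
      qed
      then show "x \<in> A" using A(1) by (simp add: compact_imp_closed)
    next
      fix x assume "x \<in> A"
      then show "x \<in> (\<Inter>n. parallel_body A (1 / real (Suc n)))"
        by (intro INT_I subsetD[OF subset_parallel_body]) simp_all
    qed
    moreover have "(\<lambda>n. ?p (1 / real (Suc n))) \<longlonglongrightarrow> ?p 0"
      by (intro tendsto_sum tendsto_mult tendsto_const tendsto_poly
          LIMSEQ_inverse_real_of_nat[unfolded inverse_eq_divide])
    moreover have "?vol A (1 / real (Suc n)) = ?p (1 / real (Suc n))" for n
      by (rule pos) simp
    ultimately have "measure lebesgue A = ?p 0"
      by (intro LIMSEQ_unique[of "\<lambda>n. ?p (1 / real (Suc n))"]) simp_all
    then show ?thesis by (simp only: True parallel_body_0)
  qed
qed

text \<open>In the Steiner formula \<open>V m\<close> belongs to the power \<open>d - m\<close>,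
  together with the volume of the unit ball in that dimension, which the division removes.\<close>

definition intrinsic_volume_weight :: "nat \<Rightarrow> nat \<Rightarrow> nat \<Rightarrow> real" where
  "intrinsic_volume_weight d m j = coeff (lagrange_poly d j) (d - m) / unit_ball_vol (real (d - m))"

text \<open>Existence in the Steiner formula. With \<open>steiner_formula_unique\<close> it gives
  meaning to the definite description in \<open>intrinsic_volume\<close>; the value 0 above the
  dimension is the normalisation chosen there.\<close>

lemma steiner_formula_compact_convex:
  fixes A :: "'b::euclidean_space set"
  assumes A: "compact A" "convex A" "A \<noteq> {}"
  defines "V \<equiv> \<lambda>m. if m \<le> DIM('b) then (\<Sum>j\<in>{1..Suc DIM('b)}.
    intrinsic_volume_weight DIM('b) m j * measure lebesgue (parallel_body A (real j))) else 0"
  shows "steiner_formula A V"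
  unfolding steiner_formula_parallel_body
proof (intro allI impI)
  fix \<rho> :: real assume \<rho>: "\<rho> \<ge> 0"
  define d where "d = DIM('b)"
  define vol where "vol = (\<lambda>j. measure lebesgue (parallel_body A (real j)))"
  have poly: "poly (lagrange_poly d j) \<rho> = (\<Sum>m\<le>d. coeff (lagrange_poly d j) (d - m) * \<rho> ^ (d - m))"
    if "j \<in> {1..Suc d}" for j
  proof -
    have "poly (lagrange_poly d j) \<rho> = (\<Sum>i\<le>d. coeff (lagrange_poly d j) i * \<rho> ^ i)"
      unfolding poly_altdef using degree_lagrange_poly[OF that]
      by (intro sum.mono_neutral_left) (auto simp: coeff_eq_0)
    also have "\<dots> = (\<Sum>m\<le>d. coeff (lagrange_poly d j) (d - m) * \<rho> ^ (d - m))"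
      by (rule sum.nat_diff_reindex[symmetric, where n = "Suc d", simplified lessThan_Suc_atMost diff_Suc_Suc])
    finally show ?thesis .
  qed
  have ub: "unit_ball_vol (real k) \<noteq> 0" for k
    using unit_ball_vol_pos[of "real k"] by linarith
  have "(\<Sum>m\<le>d. \<rho> ^ (d - m) * unit_ball_vol (real (d - m)) * V m)
      = (\<Sum>m\<le>d. \<Sum>j\<in>{1..Suc d}. vol j * (coeff (lagrange_poly d j) (d - m) * \<rho> ^ (d - m)))"
  proof (intro sum.cong refl)
    fix m assume "m \<in> {..d}"
    then have "\<rho> ^ (d - m) * unit_ball_vol (real (d - m)) * V m =
      (\<Sum>j\<in>{1..Suc d}. \<rho> ^ (d - m) * unit_ball_vol (real (d - m)) * (intrinsic_volume_weight d m j * vol j))"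
      by (simp add: V_def d_def[symmetric] vol_def sum_distrib_left del: sum.cl_ivl_Suc)
    also have "\<dots> = (\<Sum>j\<in>{1..Suc d}. vol j * (coeff (lagrange_poly d j) (d - m) * \<rho> ^ (d - m)))"
      using ub[of "d - m"] by (intro sum.cong) (auto simp: intrinsic_volume_weight_def)
    finally show "\<rho> ^ (d - m) * unit_ball_vol (real (d - m)) * V m =
      (\<Sum>j\<in>{1..Suc d}. vol j * (coeff (lagrange_poly d j) (d - m) * \<rho> ^ (d - m)))" .
  qed
  also have "\<dots> = (\<Sum>j\<in>{1..Suc d}. vol j * poly (lagrange_poly d j) \<rho>)"
    by (subst sum.swap, intro sum.cong refl) (simp only: poly sum_distrib_left)
  also have "\<dots> = measure lebesgue (parallel_body A \<rho>)"
    using measure_parallel_body_interpolation[OF A \<rho>] by (simp only: vol_def d_def)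
  finally show "measure lebesgue (parallel_body A \<rho>) =
      (\<Sum>m\<le>DIM('b). \<rho> ^ (DIM('b) - m) * unit_ball_vol (real (DIM('b) - m)) * V m)"
    by (simp add: d_def)
qed

lemma steiner_formula_intrinsic_volume:
  fixes A :: "'b::euclidean_space set"
  assumes "steiner_formula A V" "m \<le> DIM('b)"
  shows "intrinsic_volume m A = V m"
proof -
  define W where "W = (\<lambda>k. if k \<le> DIM('b) then V k else 0)"
  have W: "steiner_formula A W" "\<forall>k>DIM('b). W k = 0"
    using assms(1) by (auto simp: W_def steiner_formula_def)
  have "(THE V. steiner_formula A V \<and> (\<forall>k>DIM('b). V k = 0)) = W"
  proof (rule the_equality)
    fix V assume V: "steiner_formula A V \<and> (\<forall>k>DIM('b). V k = 0)"
    show "V = W"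
    proof
      fix k show "V k = W k"
        using V W steiner_formula_unique[of A V W k] by (cases "k \<le> DIM('b)") auto
    qed
  qed (use W in auto)
  then show ?thesis using assms(2) by (simp add: intrinsic_volume_def W_def)
qed

text \<open>The gateway to all quantitative statements on intrinsic volumes: the radii on the right
  are at least 1, and the weights do not depend on \<open>A\<close>.\<close>

lemma intrinsic_volume_eq_sum:
  fixes A :: "'b::euclidean_space set"
  assumes A: "compact A" "convex A" "A \<noteq> {}" and m: "m \<le> DIM('b)"
  shows "intrinsic_volume m A = (\<Sum>j\<in>{1..Suc DIM('b)}.
    intrinsic_volume_weight DIM('b) m j * measure lebesgue (parallel_body A (real j)))"
  using steiner_formula_intrinsic_volume[OF steiner_formula_compact_convex[OF A] m] m by simp

lemma intrinsic_volume_DIM: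
  fixes A :: "'b::euclidean_space set"
  assumes A: "compact A" "convex A" "A \<noteq> {}"
  shows "intrinsic_volume DIM('b) A = measure lebesgue A"
proof -
  obtain V where V: "steiner_formula A V" using steiner_formula_compact_convex[OF A] by blast
  then have "measure lebesgue (parallel_body A 0) =
        (\<Sum>m\<le>DIM('b). 0 ^ (DIM('b) - m) * unit_ball_vol (real (DIM('b) - m)) * V m)"
    unfolding steiner_formula_parallel_body by blast
  \<comment> \<open>At radius 0 only the summand with exponent 0 survives, where
    \<open>0 ^ 0 = 1\<close>.\<close>
  also have "\<dots> = (\<Sum>m\<in>{DIM('b)}. 0 ^ (DIM('b) - m) * unit_ball_vol (real (DIM('b) - m)) * V m)"
    by (rule sum.mono_neutral_right) auto
  finally show ?thesis
    using steiner_formula_intrinsic_volume[OF V] by (simp add: parallel_body_0)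
qed

text \<open>\<open>\<delta>\<close> depends on the bodies only through \<open>R\<close>. This is
  essential later, when the bodies vary with the outcome and only a common bound for them is at
  hand.\<close>

lemma intrinsic_volume_uniformly_continuous:
  assumes m: "m \<le> DIM('b::euclidean_space)" and \<eta>: "\<eta> > 0"
  shows "\<exists>\<delta>>0. \<forall>A B :: 'b set. compact A \<longrightarrow> convex A \<longrightarrow> A \<noteq> {} \<longrightarrow> compact B \<longrightarrow> convex B \<longrightarrow> B \<noteq> {} \<longrightarrow>
    A \<subseteq> cball 0 R \<longrightarrow> B \<subseteq> cball 0 R \<longrightarrow> A \<subseteq> parallel_body B \<delta> \<longrightarrow> B \<subseteq> parallel_body A \<delta> \<longrightarrow>
    \<bar>intrinsic_volume m A - intrinsic_volume m B\<bar> < \<eta>"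
proof -
  let ?d = "DIM('b)"
  let ?w = "intrinsic_volume_weight ?d m"
  define g where "g = (\<lambda>\<delta>. \<Sum>j\<in>{1..Suc ?d}. \<bar>?w j\<bar> *
    (((1 + \<delta> / real j) ^ ?d - 1) * measure lebesgue (cball (0::'b) (R + real j))))"
  have "(g \<longlongrightarrow> (\<Sum>j\<in>{1..Suc ?d}. \<bar>?w j\<bar> *
    (((1 + 0 / real j) ^ ?d - 1) * measure lebesgue (cball (0::'b) (R + real j))))) (at_right 0)"
    unfolding g_def by (intro tendsto_intros) auto
  then have "(g \<longlongrightarrow> 0) (at_right 0)" by simp
  then have "eventually (\<lambda>\<delta>. g \<delta> < \<eta>) (at_right 0)" using \<eta> by (rule order_tendstoD)
  moreover have "eventually (\<lambda>\<delta>::real. \<delta> > 0) (at_right 0)" by (rule eventually_at_right_less)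
  ultimately have "eventually (\<lambda>\<delta>. g \<delta> < \<eta> \<and> \<delta> > 0) (at_right 0)" by eventually_elim simp
  then obtain \<delta> where \<delta>: "\<delta> > 0" "g \<delta> < \<eta>"
    using eventually_happens'[OF trivial_limit_at_right_real] by blast
  show ?thesis
  proof (intro exI[of _ \<delta>] conjI allI impI \<delta>)
    fix A B :: "'b set"
    assume A: "compact A" "convex A" "A \<noteq> {}" and B: "compact B" "convex B" "B \<noteq> {}"
      and sub: "A \<subseteq> cball 0 R" "B \<subseteq> cball 0 R" "A \<subseteq> parallel_body B \<delta>" "B \<subseteq> parallel_body A \<delta>"
    have "\<bar>intrinsic_volume m A - intrinsic_volume m B\<bar> = \<bar>\<Sum>j\<in>{1..Suc ?d}. ?w j *
        (measure lebesgue (parallel_body A (real j)) - measure lebesgue (parallel_body B (real j)))\<bar>"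
      by (simp only: intrinsic_volume_eq_sum[OF A m] intrinsic_volume_eq_sum[OF B m]
          sum_subtractf[symmetric] right_diff_distrib)
    also have "\<dots> \<le> (\<Sum>j\<in>{1..Suc ?d}. \<bar>?w j *
        (measure lebesgue (parallel_body A (real j)) - measure lebesgue (parallel_body B (real j)))\<bar>)"
      by (rule sum_abs)
    also have "\<dots> \<le> g \<delta>"
      unfolding g_def abs_mult
      by (intro sum_mono mult_left_mono abs_measure_parallel_body_diff_le A B sub) (use \<delta> in auto)
    also have "\<dots> < \<eta>" by (rule \<delta>)
    finally show "\<bar>intrinsic_volume m A - intrinsic_volume m B\<bar> < \<eta>" .
  qed
qed

section \<open>Convex hulls of finitely many points and of cadlag paths\<close>

lemma convex_parallel_body:
  assumes "convex A"
  shows "convex (parallel_body A \<rho>)"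
proof -
  have "parallel_body A \<rho> = (\<Union>x\<in>A. \<Union>y\<in>(\<lambda>u. \<rho> *\<^sub>R u) ` cball 0 1. {x + y})"
    unfolding parallel_body_def by blast
  then show ?thesis
    using convex_sums[OF assms convex_scaling[OF convex_cball]] by simp
qed

lemma convex_hull_subset_parallel_body:
  assumes "\<And>x. x \<in> X \<Longrightarrow> \<exists>y\<in>Y. dist x y \<le> \<epsilon>" "\<epsilon> \<ge> 0"
  shows "convex hull X \<subseteq> parallel_body (convex hull Y) \<epsilon>"
proof (rule hull_minimal)
  show "X \<subseteq> parallel_body (convex hull Y) \<epsilon>"
    using assms by (fastforce simp: mem_parallel_body_iff intro: hull_inc)
  show "convex (parallel_body (convex hull Y) \<epsilon>)"
    by (intro convex_parallel_body convex_convex_hull)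
qed

lemma convex_hull_subset_cball: "X \<subseteq> cball 0 R \<Longrightarrow> convex hull X \<subseteq> cball 0 R"
  for X :: "'b::euclidean_space set"
  by (intro hull_minimal convex_cball)

text \<open>A whole sequence is passed although only its entries up to \<open>N\<close> matter: the
  product topology on sequences then serves all \<open>N\<close> at once.\<close>

definition hull_volume :: "nat \<Rightarrow> nat \<Rightarrow> (nat \<Rightarrow> 'b::euclidean_space) \<Rightarrow> real" where
  "hull_volume m N x = intrinsic_volume m (convex hull (x ` {0..N}))"

lemma compact_hull_points: "compact (convex hull (x ` {0..N}))"
  for x :: "nat \<Rightarrow> 'b::euclidean_space"
  by (intro compact_convex_hull finite_imp_compact) simp

lemma continuous_on_hull_volume:
  assumes m: "m \<le> DIM('b::euclidean_space)"
  shows "continuous_on UNIV (hull_volume m N :: (nat \<Rightarrow> 'b) \<Rightarrow> real)"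
proof (rule continuous_at_imp_continuous_on, rule ballI)
  fix x :: "nat \<Rightarrow> 'b"
  show "isCont (hull_volume m N) x"
    unfolding continuous_at
  proof (rule tendstoI)
    fix \<eta> :: real assume "\<eta> > 0"
    \<comment> \<open>The added 1 leaves room for perturbed points, which will be within distance 1
      of the given ones.\<close>
    define R where "R = Max ((\<lambda>k. norm (x k)) ` {0..N}) + 1"
    obtain \<delta> where \<delta>: "\<delta> > 0" "\<And>A B :: 'b set. compact A \<Longrightarrow> convex A \<Longrightarrow> A \<noteq> {} \<Longrightarrow> compact B \<Longrightarrow> convex B \<Longrightarrow> B \<noteq> {} \<Longrightarrow>
      A \<subseteq> cball 0 R \<Longrightarrow> B \<subseteq> cball 0 R \<Longrightarrow> A \<subseteq> parallel_body B \<delta> \<Longrightarrow> B \<subseteq> parallel_body A \<delta> \<Longrightarrow>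
      \<bar>intrinsic_volume m A - intrinsic_volume m B\<bar> < \<eta>"
      using intrinsic_volume_uniformly_continuous[OF m \<open>\<eta> > 0\<close>, of R] by metis
    have norm_x: "norm (x k) \<le> R - 1" if "k \<in> {0..N}" for k
      unfolding R_def using that by (simp add: Max_ge)
    have "eventually (\<lambda>y. dist (y k) (x k) < min \<delta> 1) (at x)" for k
    proof -
      have "((\<lambda>y. y k) \<longlongrightarrow> x k) (at x)"
      proof -
        have "continuous_on UNIV (\<lambda>y :: nat \<Rightarrow> 'b. y k)" by (rule continuous_on_product_coordinates)
        then have "isCont (\<lambda>y. y k) x" by (rule continuous_on_interior) simp
        then show ?thesis by (simp only: continuous_at)
      qed
      then show ?thesis using \<delta>(1) by (intro tendstoD) auto
    qed
    then have "eventually (\<lambda>y. \<forall>k\<in>{0..N}. dist (y k) (x k) < min \<delta> 1) (at x)"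
      by (intro eventually_ball_finite) auto
    then show "eventually (\<lambda>y. dist (hull_volume m N y) (hull_volume m N x) < \<eta>) (at x)"
    proof eventually_elim
      case (elim y)
      have norm_y: "norm (y k) \<le> R" if "k \<in> {0..N}" for k
        using elim norm_x that norm_triangle_sub[of "y k" "x k"] by (fastforce simp: dist_norm)
      show ?case
        unfolding hull_volume_def dist_real_def
      proof (rule \<delta>(2))
        show "convex hull (y ` {0..N}) \<subseteq> cball 0 R" "convex hull (x ` {0..N}) \<subseteq> cball 0 R"
          using norm_x norm_y by (intro convex_hull_subset_cball; force)+
        show "convex hull (y ` {0..N}) \<subseteq> parallel_body (convex hull (x ` {0..N})) \<delta>"
          using elim \<delta>(1) by (intro convex_hull_subset_parallel_body) (auto intro: less_imp_le)
        show "convex hull (x ` {0..N}) \<subseteq> parallel_body (convex hull (y ` {0..N})) \<delta>"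
          using elim \<delta>(1) by (intro convex_hull_subset_parallel_body) (auto simp: dist_commute intro: less_imp_le)
      qed (auto intro: compact_hull_points)
    qed
  qed
qed

lemma borel_measurable_hull_volume:
  fixes x :: "nat \<Rightarrow> 'w \<Rightarrow> 'b::euclidean_space"
  assumes "m \<le> DIM('b)" "\<And>k. x k \<in> borel_measurable M"
  shows "(\<lambda>\<omega>. hull_volume m N (\<lambda>k. x k \<omega>)) \<in> borel_measurable M"
proof -
  have "(\<lambda>\<omega> k. x k \<omega>) \<in> borel_measurable M"
    by (rule measurable_coordinatewise_then_product) (rule assms(2))
  then show ?thesis
    using borel_measurable_continuous_on[OF continuous_on_hull_volume[OF assms(1)]] by blast
qed

text \<open>The nearest grid point may lie across a jump from \<open>t\<close>, so the side has to
  be chosen. If the claim fails, bad times accumulate at some \<open>l\<close>. Those at or after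
  \<open>l\<close> are compared with a grid point above them, by right-continuity; those before
  \<open>l\<close> with a grid point below them, by the left limit at \<open>l\<close>.\<close>

lemma cadlag_skeleton_approx:
  fixes x :: "real \<Rightarrow> 'b::metric_space"
  assumes x: "cadlag x" and \<epsilon>: "\<epsilon> > 0"
  shows "\<exists>K\<^sub>0>0. \<forall>K\<ge>K\<^sub>0. \<forall>t\<in>{0..1}. \<exists>j\<in>{0..K}. dist (x t) (x (real j / real K)) \<le> \<epsilon>"
proof (rule ccontr)
  assume contra: "\<not> ?thesis"
  have "\<exists>K t. K \<ge> Suc n \<and> t \<in> {0..1} \<and> (\<forall>j\<in>{0..K}. dist (x t) (x (real j / real K)) > \<epsilon>)" for n
    using contra by (metis not_le zero_less_Suc)
  then obtain K t where K: "\<And>n. K n \<ge> Suc n" and t: "\<And>n. t n \<in> {0..1}"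
    and far: "\<And>n j. j \<in> {0..K n} \<Longrightarrow> dist (x (t n)) (x (real j / real (K n))) > \<epsilon>"
    by metis
  have Kpos: "real (K n) > 0" for n using K[of n] by simp
  obtain l r where l: "l \<in> {0..1}" and r: "strict_mono (r :: nat \<Rightarrow> nat)" and lim: "(t \<circ> r) \<longlonglongrightarrow> l"
    using compact_imp_seq_compact[OF compact_Icc[of 0 "1::real"]] t unfolding seq_compact_def by meson
  have Kinv: "(\<lambda>n. 1 / real (K (r n))) \<longlonglongrightarrow> 0"
  proof (rule tendsto_sandwich[OF _ _ tendsto_const LIMSEQ_inverse_real_of_nat[unfolded inverse_eq_divide]])
    have "Suc n \<le> K (r n)" for n using K[of "r n"] seq_suble[OF r, of n] by linarith
    then show "eventually (\<lambda>n. 1 / real (K (r n)) \<le> 1 / real (Suc n)) sequentially"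
      by (intro always_eventually allI divide_left_mono) (use Kpos in \<open>auto simp del: of_nat_Suc\<close>)
  qed simp
  \<comment> \<open>The limit within \<open>S\<close> says nothing about the point \<open>l\<close>
    itself, so the last assumption covers terms equal to \<open>l\<close>. The uses are
    \<open>S = {l..}\<close> and \<open>S = {..<l}\<close>; for the latter that assumption is
    vacuous.\<close>
  have ev: "eventually (\<lambda>n. s n \<in> S \<longrightarrow> dist (x (s n)) y < \<epsilon> / 2) sequentially"
    if "s \<longlonglongrightarrow> l" "(x \<longlongrightarrow> y) (at l within S)" "l \<in> S \<Longrightarrow> x l = y" for s S y
  proof -
    have "eventually (\<lambda>u. dist (x u) y < \<epsilon> / 2) (at l within S)"
      using that(2) \<epsilon> by (intro tendstoD) auto
    then have "eventually (\<lambda>u. u \<in> S \<longrightarrow> dist (x u) y < \<epsilon> / 2) (nhds l)"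
      unfolding eventually_at_filter
      by eventually_elim (use that(3) \<epsilon> in force)
    then show ?thesis using that(1) by (rule eventually_compose_filterlim)
  qed
  have right: "(x \<longlongrightarrow> x l) (at l within {l..})"
    using x l by (simp add: cadlag_def at_within_Ici_at_right)
  have floor: "\<exists>j\<in>{0..K n}. real j / real (K n) \<le> t n \<and> t n - 1 / real (K n) \<le> real j / real (K n)" for n
  proof (intro bexI conjI)
    let ?j = "nat \<lfloor>t n * real (K n)\<rfloor>"
    have nn: "t n * real (K n) \<ge> 0" using t[of n] by simp
    have j: "real ?j \<le> t n * real (K n)" "real ?j \<ge> t n * real (K n) - 1" using nn by linarith+
    have "real ?j / real (K n) \<le> t n * real (K n) / real (K n)"
      "(t n * real (K n) - 1) / real (K n) \<le> real ?j / real (K n)"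
      by (intro divide_right_mono j; simp)+
    then show "real ?j / real (K n) \<le> t n" "t n - 1 / real (K n) \<le> real ?j / real (K n)"
      using Kpos[of n] by (simp_all add: diff_divide_distrib)
    have "t n * real (K n) \<le> real (K n)" using t[of n] Kpos[of n] by (simp add: mult_left_le_one_le)
    then show "?j \<in> {0..K n}" using j(1) by simp
  qed
  have ceil: "\<exists>j\<in>{0..K n}. t n \<le> real j / real (K n) \<and> real j / real (K n) \<le> t n + 1 / real (K n)" for n
  proof (intro bexI conjI)
    let ?j = "nat \<lceil>t n * real (K n)\<rceil>"
    have nn: "t n * real (K n) \<ge> 0" using t[of n] by simp
    have j: "real ?j \<ge> t n * real (K n)" "real ?j \<le> t n * real (K n) + 1" using nn by linarith+
    have "t n * real (K n) / real (K n) \<le> real ?j / real (K n)"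
      "real ?j / real (K n) \<le> (t n * real (K n) + 1) / real (K n)"
      by (intro divide_right_mono j; simp)+
    then show "t n \<le> real ?j / real (K n)" "real ?j / real (K n) \<le> t n + 1 / real (K n)"
      using Kpos[of n] by (simp_all add: add_divide_distrib)
    have "t n * real (K n) \<le> real (K n)" using t[of n] Kpos[of n] by (simp add: mult_left_le_one_le)
    then have "\<lceil>t n * real (K n)\<rceil> \<le> int (K n)" by linarith
    then have "?j \<le> K n" by (simp only: nat_le_iff)
    then show "?j \<in> {0..K n}" by simp
  qed
  obtain f where f: "\<And>n. f n \<in> {0..K n}" "\<And>n. real (f n) / real (K n) \<le> t n"
    "\<And>n. t n - 1 / real (K n) \<le> real (f n) / real (K n)"
    using floor by metis
  obtain c where c: "\<And>n. c n \<in> {0..K n}" "\<And>n. t n \<le> real (c n) / real (K n)"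
    "\<And>n. real (c n) / real (K n) \<le> t n + 1 / real (K n)"
    using ceil by metis
  define fs where "fs = (\<lambda>n. real (f (r n)) / real (K (r n)))"
  define cs where "cs = (\<lambda>n. real (c (r n)) / real (K (r n)))"
  have "fs \<longlonglongrightarrow> l"
    by (rule tendsto_sandwich[OF _ _ tendsto_diff[OF lim Kinv, simplified] lim]) (auto simp: fs_def f intro!: always_eventually)
  have "cs \<longlonglongrightarrow> l"
    by (rule tendsto_sandwich[OF _ _ lim tendsto_add[OF lim Kinv, simplified]]) (auto simp: cs_def c intro!: always_eventually)
  have lim': "(\<lambda>n. t (r n)) \<longlonglongrightarrow> l" using lim by (simp add: comp_def)
  have 1: "eventually (\<lambda>n. t (r n) \<in> {l..} \<longrightarrow> dist (x (t (r n))) (x l) < \<epsilon> / 2) sequentially"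
    by (rule ev[OF lim' right]) simp
  have 2: "eventually (\<lambda>n. cs n \<in> {l..} \<longrightarrow> dist (x (cs n)) (x l) < \<epsilon> / 2) sequentially"
    by (rule ev[OF \<open>cs \<longlonglongrightarrow> l\<close> right]) simp
  \<comment> \<open>At \<open>l = 0\<close> no left limit is available, but then no time in the unit
    interval precedes \<open>l\<close>.\<close>
  have "\<exists>y. l > 0 \<longrightarrow> (x \<longlongrightarrow> y) (at_left l)" using x by (auto simp: cadlag_def)
  then obtain y where y: "l > 0 \<Longrightarrow> (x \<longlongrightarrow> y) (at_left l)" by blast
  have 3: "eventually (\<lambda>n. l > 0 \<longrightarrow> t (r n) \<in> {..<l} \<longrightarrow> dist (x (t (r n))) y < \<epsilon> / 2) sequentially"
    using ev[OF lim' y] by (cases "l > 0") auto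
  have 4: "eventually (\<lambda>n. l > 0 \<longrightarrow> fs n \<in> {..<l} \<longrightarrow> dist (x (fs n)) y < \<epsilon> / 2) sequentially"
    using ev[OF \<open>fs \<longlonglongrightarrow> l\<close> y] by (cases "l > 0") auto
  have "eventually (\<lambda>n. False) sequentially"
    using 1 2 3 4
  proof eventually_elim
    case (elim n)
    have tn: "t (r n) \<ge> 0" using t by simp
    show False
    proof (cases "t (r n) \<ge> l")
      case True
      moreover have "cs n \<ge> l" using True c(2)[of "r n"] by (simp add: cs_def)
      ultimately have "dist (x (t (r n))) (x (cs n)) < \<epsilon>"
        using elim(1,2) dist_triangle_half_r[of "x l" "x (t (r n))" \<epsilon> "x (cs n)"] by (simp add: dist_commute)
      then show False using far[OF c(1), of "r n"] by (simp add: cs_def)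
    next
      case False
      then have "l > 0" "fs n < l" using tn f(2)[of "r n"] by (auto simp: fs_def)
      then have "dist (x (t (r n))) (x (fs n)) < \<epsilon>"
        using elim(3,4) False dist_triangle_half_r[of y "x (t (r n))" \<epsilon> "x (fs n)"] by (simp add: dist_commute)
      then show False using far[OF f(1), of "r n"] by (simp add: fs_def)
    qed
  qed
  then show False by simp
qed

lemma bounded_cadlag_image:
  fixes x :: "real \<Rightarrow> 'b::real_normed_vector"
  assumes "cadlag x"
  shows "bounded (x ` {0..1})"
proof -
  obtain K where K: "\<forall>t\<in>{0..1}. \<exists>j\<in>{0..K}. dist (x t) (x (real j / real K)) \<le> 1"
    using cadlag_skeleton_approx[OF assms, of 1] by auto
  have "x ` {0..1} \<subseteq> (\<Union>j\<in>{0..K}. cball (x (real j / real K)) 1)"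
    using K by (auto simp: dist_commute)
  then show ?thesis
    by (rule bounded_subset[rotated]) (intro bounded_UN, auto)
qed

lemma compact_hull_closure_cadlag:
  fixes x :: "real \<Rightarrow> 'b::euclidean_space"
  assumes "cadlag x"
  shows "compact (convex hull (closure (x ` {0..1})))"
  using bounded_cadlag_image[OF assms] by (intro compact_convex_hull) (simp add: compact_closure)

lemma hull_volume_skeleton_tendsto:
  fixes x :: "real \<Rightarrow> 'b::euclidean_space"
  assumes x: "cadlag x" and m: "m \<le> DIM('b)"
  shows "(\<lambda>K. hull_volume m K (\<lambda>j. x (real j / real K))) \<longlonglongrightarrow>
    intrinsic_volume m (convex hull (closure (x ` {0..1})))"
proof (rule LIMSEQ_I)
  fix \<eta> :: real assume "\<eta> > 0"
  define A where "A = convex hull (closure (x ` {0..1}))"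
  have A: "compact A" "convex A" "A \<noteq> {}"
    using compact_hull_closure_cadlag[OF x] by (auto simp: A_def convex_convex_hull)
  obtain R where R: "A \<subseteq> cball 0 R"
    using compact_imp_bounded[OF A(1)] by (auto simp: bounded_iff subset_iff)
  obtain \<delta> where \<delta>: "\<delta> > 0" "\<And>A B :: 'b set. compact A \<Longrightarrow> convex A \<Longrightarrow> A \<noteq> {} \<Longrightarrow> compact B \<Longrightarrow> convex B \<Longrightarrow> B \<noteq> {} \<Longrightarrow>
    A \<subseteq> cball 0 R \<Longrightarrow> B \<subseteq> cball 0 R \<Longrightarrow> A \<subseteq> parallel_body B \<delta> \<Longrightarrow> B \<subseteq> parallel_body A \<delta> \<Longrightarrow>
    \<bar>intrinsic_volume m A - intrinsic_volume m B\<bar> < \<eta>"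
    using intrinsic_volume_uniformly_continuous[OF m \<open>\<eta> > 0\<close>, of R] by metis
  obtain K\<^sub>0 where K0: "K\<^sub>0 > 0" "\<And>K t. K \<ge> K\<^sub>0 \<Longrightarrow> t \<in> {0..1} \<Longrightarrow> \<exists>j\<in>{0..K}. dist (x t) (x (real j / real K)) \<le> \<delta>"
    using cadlag_skeleton_approx[OF x \<delta>(1)] by blast
  show "\<exists>K\<^sub>0. \<forall>K\<ge>K\<^sub>0. norm (hull_volume m K (\<lambda>j. x (real j / real K)) -
      intrinsic_volume m (convex hull (closure (x ` {0..1})))) < \<eta>"
  proof (intro exI[of _ K\<^sub>0] allI impI)
    fix K assume K: "K \<ge> K\<^sub>0"
    define B where "B = convex hull ((\<lambda>j. x (real j / real K)) ` {0..K})"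
    have B: "compact B" "convex B" "B \<noteq> {}"
      unfolding B_def by (auto intro: compact_hull_points convex_convex_hull)
    have BA: "B \<subseteq> A"
      unfolding A_def B_def
    proof (rule hull_mono)
      have "real j / real K \<in> {0..1}" if "j \<le> K" for j using that by (auto simp: divide_le_eq)
      then show "(\<lambda>j. x (real j / real K)) ` {0..K} \<subseteq> closure (x ` {0..1})"
        by (intro subset_trans[OF _ closure_subset]) auto
    qed
    have "x ` {0..1} \<subseteq> parallel_body B \<delta>"
      using K0(2)[OF K] \<delta>(1) unfolding B_def
      by (fastforce simp: mem_parallel_body_iff intro: hull_inc)
    \<comment> \<open>A closed convex set containing the path contains the hull of its closure, so
      it is enough to test the points of the path.\<close>
    then have "A \<subseteq> parallel_body B \<delta>"
      unfolding A_def
      by (intro hull_minimal closure_minimal convex_parallel_body B compact_imp_closed compact_parallel_body)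
    then have "\<bar>intrinsic_volume m B - intrinsic_volume m A\<bar> < \<eta>"
      using \<delta>(2)[OF B A] BA R subset_parallel_body[of \<delta> A] \<delta>(1) by auto
    then show "norm (hull_volume m K (\<lambda>j. x (real j / real K)) -
      intrinsic_volume m (convex hull (closure (x ` {0..1})))) < \<eta>"
      by (simp add: hull_volume_def A_def B_def)
  qed
qed

section \<open>The linear rescaling and its determinant\<close>

lemma scaling_basis_coords_component:
  "(scaling_matrix i\<^sub>1 b n *v basis_coords e x) $ i = (if i = i\<^sub>1 then 1 / real n else 1 / b n) * (x \<bullet> e i)"
proof -
  have "(scaling_matrix i\<^sub>1 b n *v basis_coords e x) $ i
    = (\<Sum>j\<in>UNIV. (if i = j then if i = i\<^sub>1 then 1 / real n else 1 / b n else 0) * (x \<bullet> e j))"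
    by (simp only: matrix_vector_mult_def scaling_matrix_def basis_coords_def vec_lambda_beta)
  also have "\<dots> = (\<Sum>j\<in>UNIV. (if i = j then (if i = i\<^sub>1 then 1 / real n else 1 / b n) * (x \<bullet> e j) else 0))"
    by (intro sum.cong) auto
  finally show ?thesis by simp
qed

lemma linear_scaling_basis_coords:
  "linear (\<lambda>x. scaling_matrix i\<^sub>1 b n *v basis_coords e x)"
  by (rule linearI) (simp_all add: vec_eq_iff scaling_basis_coords_component inner_add_left distrib_left)

text \<open>The map is the isometry \<open>W\<close> of taking coordinates with respect to
  \<open>e\<close>, followed by the diagonal map \<open>D\<close> with one entry
  \<open>1 / real n\<close> and \<open>CARD('n) - 1\<close> entries \<open>1 / b n\<close>.\<close>

lemma measure_scaling_basis_coords:
  fixes e :: "'n::finite \<Rightarrow> real^'n" and A :: "(real^'n) set"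
  assumes e: "\<And>i j. e i \<bullet> e j = (if i = j then 1 else 0)"
    and n: "n \<ge> 1" and b: "b n > 0" and A: "compact A"
  shows "measure lebesgue ((\<lambda>x. scaling_matrix i\<^sub>1 b n *v basis_coords e x) ` A)
    = measure lebesgue A / (real n * b n ^ (CARD('n) - 1))"
proof -
  let ?f = "\<lambda>x. scaling_matrix i\<^sub>1 b n *v basis_coords e x"
  \<comment> \<open>\<open>h\<close> reindexes \<open>e\<close> by the standard basis, the form in
    which \<open>orthogonal_transformation_orthonormal\<close> is stated.\<close>
  define h :: "real^'n \<Rightarrow> real^'n" where "h = (\<lambda>v. e (axis_index v))"
  define c where "c = (\<lambda>i. if i = i\<^sub>1 then 1 / real n else 1 / b n)"
  have c_pos: "c i > 0" for i using n b by (simp add: c_def)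
  define W where "W = (\<lambda>x::real^'n. \<Sum>j\<in>Basis. (x \<bullet> h j) *\<^sub>R j)"
  define D where "D = (\<lambda>x::real^'n. \<Sum>j\<in>Basis. (c (axis_index j) * (x \<bullet> j)) *\<^sub>R j)"
  have Basis: "(Basis :: (real^'n) set) = (\<lambda>i. axis i 1) ` UNIV"
    by (auto simp: Basis_vec_def)
  have inj: "inj (\<lambda>i::'n. axis i (1::real))" by (rule injI) (simp add: axis_eq_axis)
  have h: "h i \<bullet> h j = (if i = j then 1 else 0)" if "i \<in> Basis" "j \<in> Basis" for i j
    using that by (auto simp: h_def e Basis axis_eq_axis)
  have W: "orthogonal_transformation W"
    using orthogonal_transformation_orthonormal(2)[OF h] by (simp add: W_def)
  have Dk: "D x $ k = c k * x $ k" for x k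
  proof -
    have "D x $ k = D x \<bullet> axis k 1" by (simp add: inner_axis)
    also have "\<dots> = c k * (x \<bullet> axis k 1)" by (simp add: D_def)
    finally show ?thesis by (simp add: inner_axis)
  qed
  have Wk: "W x $ k = x \<bullet> e k" for x k
  proof -
    have "W x $ k = W x \<bullet> axis k 1" by (simp add: inner_axis)
    also have "\<dots> = x \<bullet> h (axis k 1)" by (simp add: W_def)
    finally show ?thesis by (simp add: h_def)
  qed
  have f: "?f x = D (W x)" for x
  proof (subst vec_eq_iff, rule allI)
    fix k
    show "?f x $ k = D (W x) $ k"
      by (simp add: scaling_basis_coords_component Dk Wk c_def)
  qed
  have injD: "x = y" if "D x = D y" for x y
  proof (subst vec_eq_iff, rule allI)
    fix k
    have "D x $ k = D y $ k" using that by simp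
    then show "x $ k = y $ k" using c_pos[of k] by (simp add: Dk)
  qed
  have K: "compact (?f ` A)"
    using A linear_scaling_basis_coords
    by (intro compact_continuous_image linear_continuous_on) (simp_all add: linear_conv_bounded_linear)
  then have Kb: "?f ` A \<in> sets borel" by (simp add: borel_compact)
  have [measurable]: "D \<in> borel_measurable borel" unfolding D_def by measurable
  have DK: "D -` ?f ` A \<in> sets borel" by (rule measurable_sets_borel[OF _ Kb]) measurable
  have "W -` D -` ?f ` A = A"
    using orthogonal_transformation_inj[OF W] injD by (auto simp: f inj_def)
  then have "emeasure lborel A = emeasure lborel (D -` ?f ` A)"
    using emeasure_lborel_orthogonal_transformation[OF W DK] by simp
  moreover have "emeasure lborel (?f ` A) = ennreal (\<Prod>j\<in>Basis. c (axis_index (j :: real^'n))) * emeasure lborel (D -` ?f ` A)"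
    unfolding D_def by (rule emeasure_lborel_diagonal[OF _ Kb]) (rule c_pos)
  moreover have "(\<Prod>j\<in>Basis. c (axis_index (j :: real^'n))) = 1 / (real n * b n ^ (CARD('n) - 1))"
  proof -
    have "(\<Prod>j\<in>Basis. c (axis_index (j :: real^'n))) = (\<Prod>i\<in>UNIV. c i)"
      unfolding Basis by (subst prod.reindex[OF inj]) simp
    also have "\<dots> = c i\<^sub>1 * (\<Prod>i\<in>UNIV - {i\<^sub>1}. c i)" by (rule prod.remove) auto
    also have "(\<Prod>i\<in>UNIV - {i\<^sub>1}. c i) = (1 / b n) ^ (CARD('n) - 1)"
      by (subst prod.cong[OF refl, of _ _ "\<lambda>_. 1 / b n"]) (auto simp: c_def card_Diff_singleton)
    finally show ?thesis by (simp add: c_def power_one_over)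
  qed
  ultimately have "measure lborel (?f ` A) = measure lborel A / (real n * b n ^ (CARD('n) - 1))"
    using n b by (simp add: measure_def enn2real_mult)
  then show ?thesis
    using A Kb by (simp add: measure_lebesgue_borel borel_compact)
qed

section \<open>A continuity theorem for finite families of random vectors\<close>

lemma (in prob_space) abs_expectation_diff_le:
  fixes f g :: "'a \<Rightarrow> real"
  assumes [measurable]: "f \<in> borel_measurable M" "g \<in> borel_measurable M" "B \<in> sets M"
    and f: "\<And>\<omega>. \<omega> \<in> space M \<Longrightarrow> \<bar>f \<omega>\<bar> \<le> C" and g: "\<And>\<omega>. \<omega> \<in> space M \<Longrightarrow> \<bar>g \<omega>\<bar> \<le> D"
    and diff: "\<And>\<omega>. \<omega> \<in> space M \<Longrightarrow> \<omega> \<notin> B \<Longrightarrow> \<bar>f \<omega> - g \<omega>\<bar> \<le> a" and a: "a \<ge> 0"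
  shows "\<bar>expectation f - expectation g\<bar> \<le> a + (C + D) * prob B"
proof -
  have int: "integrable M f" "integrable M g"
    using f g by (auto intro!: integrable_const_bound AE_I2)
  have "\<bar>expectation f - expectation g\<bar> = \<bar>expectation (\<lambda>\<omega>. f \<omega> - g \<omega>)\<bar>"
    using int by simp
  also have "\<dots> \<le> expectation (\<lambda>\<omega>. \<bar>f \<omega> - g \<omega>\<bar>)"
    by (rule integral_abs_bound)
  also have "\<dots> \<le> expectation (\<lambda>\<omega>. a + (C + D) * indicator B \<omega>)"
  proof (rule integral_mono)
    fix \<omega> assume \<omega>: "\<omega> \<in> space M"
    show "\<bar>f \<omega> - g \<omega>\<bar> \<le> a + (C + D) * indicator B \<omega>"
      using f[OF \<omega>] g[OF \<omega>] diff[OF \<omega>] a by (cases "\<omega> \<in> B") (auto simp: indicator_def)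
  qed (use int in \<open>auto intro!: integrable_add integrable_mult_right simp: emeasure_eq_measure\<close>)
  also have "\<dots> = a + (C + D) * prob B"
    by (subst Bochner_Integration.integral_add) (auto simp: prob_space emeasure_eq_measure)
  finally show ?thesis .
qed

text \<open>
  A Stone--Weierstrass approximant on a compact set may be large elsewhere; composing it with a
  polynomial that approximates truncation at the level of \<open>F\<close> keeps it in the algebra and makes it
  globally bounded.
\<close>

lemma expectation_tendsto_of_separating_algebra:
  fixes Z :: "nat \<Rightarrow> 'w \<Rightarrow> 'a::t2_space" and Z' :: "'v \<Rightarrow> 'a" and R :: "('a \<Rightarrow> real) set"
    and F :: "'a \<Rightarrow> real"
  assumes "prob_space M" "prob_space N"
    and Z [measurable]: "\<And>n. Z n \<in> borel_measurable M" and Z' [measurable]: "Z' \<in> borel_measurable N"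
    and const: "\<And>c. (\<lambda>_. c) \<in> R"
    and add: "\<And>f g. f \<in> R \<Longrightarrow> g \<in> R \<Longrightarrow> (\<lambda>x. f x + g x) \<in> R"
    and mult: "\<And>f g. f \<in> R \<Longrightarrow> g \<in> R \<Longrightarrow> (\<lambda>x. f x * g x) \<in> R"
    and cont: "\<And>f. f \<in> R \<Longrightarrow> continuous_on UNIV f" and bdd: "\<And>f. f \<in> R \<Longrightarrow> bounded (range f)"
    and conv: "\<And>f. f \<in> R \<Longrightarrow> (\<lambda>n. \<integral>\<omega>. f (Z n \<omega>) \<partial>M) \<longlonglongrightarrow> (\<integral>\<omega>. f (Z' \<omega>) \<partial>N)"
    and tight: "\<And>\<eta>. \<eta> > 0 \<Longrightarrow> \<exists>S. compact S \<and> (\<forall>x\<in>S. \<forall>y\<in>S. x \<noteq> y \<longrightarrow> (\<exists>f\<in>R. f x \<noteq> f y)) \<and>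
      (\<forall>\<^sub>F n in sequentially. measure M {\<omega>\<in>space M. Z n \<omega> \<notin> S} \<le> \<eta>) \<and> measure N {\<omega>\<in>space N. Z' \<omega> \<notin> S} \<le> \<eta>"
    and F: "continuous_on UNIV F" "bounded (range F)"
  shows "(\<lambda>n. \<integral>\<omega>. F (Z n \<omega>) \<partial>M) \<longlonglongrightarrow> (\<integral>\<omega>. F (Z' \<omega>) \<partial>N)"
proof (rule LIMSEQ_I)
  interpret M: prob_space M by fact
  interpret N: prob_space N by fact
  fix r :: real assume "r > 0"
  obtain B where B: "B > 0" "\<And>x. \<bar>F x\<bar> \<le> B"
    using F(2) unfolding bounded_pos by auto
  \<comment> \<open>Replacing \<open>F\<close> by \<open>Q\<close> is done twice and costs
    \<open>2 * \<eta>\<close> on \<open>S\<close> plus \<open>(2 * B + 1) * \<eta>\<close> off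
    \<open>S\<close>, where \<open>F\<close> is bounded by \<open>B\<close> and \<open>Q\<close> by
    \<open>B + 1\<close>. The convergence for \<open>Q\<close> costs another \<eta>, and the choice
    makes the total at most \<open>r\<close>.\<close>
  define \<eta> where "\<eta> = min 1 (r / (2 * (2 + (2 * B + 1)) + 1))"
  have den: "2 * (2 + (2 * B + 1)) + 1 > 0" using B(1) by simp
  have \<eta>: "\<eta> > 0" "\<eta> \<le> 1" using \<open>r > 0\<close> den by (auto simp: \<eta>_def)
  have "(2 * (2 + (2 * B + 1)) + 1) * \<eta> \<le> r"
    using den unfolding \<eta>_def by (subst mult.commute, subst pos_le_divide_eq[symmetric]) auto
  then have \<eta>r: "2 * (2 * \<eta> + (2 * B + 1) * \<eta>) + \<eta> \<le> r" by (simp add: algebra_simps)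
  obtain S where S: "compact S" "\<And>x y. x \<in> S \<Longrightarrow> y \<in> S \<Longrightarrow> x \<noteq> y \<Longrightarrow> \<exists>f\<in>R. f x \<noteq> f y"
    "\<forall>\<^sub>F n in sequentially. measure M {\<omega>\<in>space M. Z n \<omega> \<notin> S} \<le> \<eta>" "measure N {\<omega>\<in>space N. Z' \<omega> \<notin> S} \<le> \<eta>"
    using tight[OF \<eta>(1)] by auto
  have [measurable]: "S \<in> sets borel" using S(1) by (simp add: borel_closed compact_imp_closed)
  interpret SW: function_ring_on R S
    by unfold_locales (use S const add mult continuous_on_subset[OF cont, of _ S] in auto)
  obtain P where P: "P \<in> R" "\<And>x. x \<in> S \<Longrightarrow> \<bar>F x - P x\<bar> < \<eta>"
    using SW.Stone_Weierstrass_basic[OF continuous_on_subset[OF F(1)] \<eta>(1)] by auto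
  obtain C where C: "\<And>x. \<bar>P x\<bar> \<le> C"
    using bdd[OF P(1)] unfolding bounded_iff by auto
  define clamp where "clamp = (\<lambda>y::real. max (- B) (min B y))"
  have "continuous_on {-C..C} clamp" unfolding clamp_def by (intro continuous_intros)
  then obtain T where T: "real_polynomial_function T" "\<And>y. y \<in> {-C..C} \<Longrightarrow> \<bar>clamp y - T y\<bar> < \<eta>"
    using Stone_Weierstrass_real_polynomial_function[of "{-C..C}" clamp \<eta>] \<eta>(1) by auto
  have TP: "(\<lambda>x. T (P x)) \<in> R"
    using T(1)
  proof induction
    case (linear f)
    then obtain c where "f = (\<lambda>x. x * c)" by (metis real_bounded_linear)
    then show ?case using mult[OF P(1) const[of c]] by simp
  qed (auto intro: const add mult)
  define Q where "Q = (\<lambda>x. T (P x))"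
  have PC: "P x \<in> {-C..C}" for x using C[of x] by (auto simp: abs_le_iff)
  have Q_bdd: "\<bar>Q x\<bar> \<le> B + 1" for x
  proof -
    have "\<bar>clamp (P x)\<bar> \<le> B" using B(1) by (auto simp: clamp_def)
    then show ?thesis using T(2)[OF PC[of x]] \<eta>(2) by (simp add: Q_def)
  qed
  have QF: "\<bar>F x - Q x\<bar> \<le> 2 * \<eta>" if "x \<in> S" for x
  proof -
    have "\<bar>F x - clamp (P x)\<bar> \<le> \<bar>F x - P x\<bar>" using B(2)[of x] by (auto simp: clamp_def)
    then show ?thesis using T(2)[OF PC[of x]] P(2)[OF that] by (simp add: Q_def)
  qed
  have [measurable]: "F \<in> borel_measurable borel" "Q \<in> borel_measurable borel"
    using F(1) cont[OF TP] by (auto simp: Q_def intro!: borel_measurable_continuous_onI)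
  have bound: "2 * \<eta> + (B + (B + 1)) * p \<le> 2 * \<eta> + (2 * B + 1) * \<eta>" if "p \<le> \<eta>" for p
    using that B(1) by (simp add: mult_left_mono)
  have approx_M: "\<bar>(\<integral>\<omega>. F (Z n \<omega>) \<partial>M) - (\<integral>\<omega>. Q (Z n \<omega>) \<partial>M)\<bar> \<le> 2 * \<eta> + (B + (B + 1)) * measure M {\<omega>\<in>space M. Z n \<omega> \<notin> S}" for n
    by (rule M.abs_expectation_diff_le) (use B Q_bdd QF \<eta> in auto)
  have approx_N: "\<bar>(\<integral>\<omega>. F (Z' \<omega>) \<partial>N) - (\<integral>\<omega>. Q (Z' \<omega>) \<partial>N)\<bar> \<le> 2 * \<eta> + (B + (B + 1)) * measure N {\<omega>\<in>space N. Z' \<omega> \<notin> S}"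
    by (rule N.abs_expectation_diff_le) (use B Q_bdd QF \<eta> in auto)
  have "eventually (\<lambda>n. \<bar>(\<integral>\<omega>. Q (Z n \<omega>) \<partial>M) - (\<integral>\<omega>. Q (Z' \<omega>) \<partial>N)\<bar> < \<eta>) sequentially"
    using tendstoD[OF conv[OF TP] \<eta>(1)] by (simp add: Q_def dist_real_def)
  with S(3) have "eventually (\<lambda>n. norm ((\<integral>\<omega>. F (Z n \<omega>) \<partial>M) - (\<integral>\<omega>. F (Z' \<omega>) \<partial>N)) < r) sequentially"
  proof eventually_elim
    case (elim n)
    have tri: "\<bar>a - d\<bar> < t" if "\<bar>a - b\<bar> \<le> s" "\<bar>b - c\<bar> < \<eta>" "\<bar>d - c\<bar> \<le> s" "2 * s + \<eta> \<le> t" for a b c d s t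
      using that by linarith
    show ?case
      unfolding real_norm_def
      by (rule tri[OF order.trans[OF approx_M bound[OF elim(1)]] elim(2)
            order.trans[OF approx_N bound[OF S(4)]] \<eta>r])
  qed
  then show "\<exists>no. \<forall>n\<ge>no. norm ((\<integral>\<omega>. F (Z n \<omega>) \<partial>M) - (\<integral>\<omega>. F (Z' \<omega>) \<partial>N)) < r"
    by (simp add: eventually_sequentially)
qed

text \<open>Convergence in distribution does not act on indicators. The integrand on the right is
  bounded and continuous, dominates the indicator, and vanishes where the norm is at most
  \<open>R\<close>.\<close>

lemma (in prob_space) prob_norm_gt_le:
  fixes V :: "'a \<Rightarrow> 'b::real_normed_vector"
  assumes [measurable]: "V \<in> borel_measurable M"
  shows "prob {\<omega>\<in>space M. norm (V \<omega>) > R + 1} \<le> (\<integral>\<omega>. min 1 (max 0 (norm (V \<omega>) - R)) \<partial>M)"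
proof -
  have "prob {\<omega>\<in>space M. norm (V \<omega>) > R + 1} = (\<integral>\<omega>. indicator {\<omega>\<in>space M. norm (V \<omega>) > R + 1} \<omega> \<partial>M)"
    by simp
  also have "\<dots> \<le> (\<integral>\<omega>. min 1 (max 0 (norm (V \<omega>) - R)) \<partial>M)"
    by (intro integral_mono integrable_const_bound[of _ 1] AE_I2) (auto simp: indicator_def)
  finally show ?thesis .
qed

lemma conv_in_distr_tight:
  fixes W :: "nat \<Rightarrow> 'w \<Rightarrow> 'b::real_normed_vector" and W' :: "'v \<Rightarrow> 'b"
  assumes "prob_space M" "prob_space N" and conv: "conv_in_distr M W N W'" and \<eta>: "\<eta> > 0"
  shows "\<exists>R. (\<forall>\<^sub>F n in sequentially. measure M {\<omega>\<in>space M. norm (W n \<omega>) > R} \<le> \<eta>) \<and>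
    measure N {\<omega>\<in>space N. norm (W' \<omega>) > R} \<le> \<eta>"
proof -
  interpret M: prob_space M by fact
  interpret N: prob_space N by fact
  have [measurable]: "W n \<in> borel_measurable M" "W' \<in> borel_measurable N" for n
    using conv by (auto simp: conv_in_distr_def)
  define \<psi> where "\<psi> = (\<lambda>R (x::'b). min 1 (max 0 (norm x - R)))"
  have \<psi>_cont: "continuous_on UNIV (\<psi> R)" for R unfolding \<psi>_def by (intro continuous_intros)
  have \<psi>_bdd: "\<bar>\<psi> R x\<bar> \<le> 1" for R x by (auto simp: \<psi>_def)
  have [measurable]: "\<psi> R \<in> borel_measurable borel" for R
    by (rule borel_measurable_continuous_onI[OF \<psi>_cont])
  have "(\<lambda>k. \<integral>\<omega>. \<psi> (real k) (W' \<omega>) \<partial>N) \<longlonglongrightarrow> (\<integral>\<omega>. 0 \<partial>N)"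
  proof (rule integral_dominated_convergence[where w="\<lambda>_. 1"])
    show "AE \<omega> in N. (\<lambda>k. \<psi> (real k) (W' \<omega>)) \<longlonglongrightarrow> 0"
    proof (rule AE_I2)
      fix \<omega>
      obtain k0 :: nat where "norm (W' \<omega>) \<le> real k0" using real_arch_simple by blast
      then have "\<psi> (real k) (W' \<omega>) = 0" if "k \<ge> k0" for k
        using that by (auto simp: \<psi>_def max_def)
      then show "(\<lambda>k. \<psi> (real k) (W' \<omega>)) \<longlonglongrightarrow> 0"
        by (intro tendsto_eventually) (auto simp: eventually_sequentially)
    qed
  qed (use \<psi>_bdd in auto)
  then have "eventually (\<lambda>k. (\<integral>\<omega>. \<psi> (real k) (W' \<omega>) \<partial>N) < \<eta>) sequentially"
    using \<eta> by (auto dest: order_tendstoD(2))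
  then obtain k where k: "(\<integral>\<omega>. \<psi> (real k) (W' \<omega>) \<partial>N) < \<eta>"
    using eventually_happens'[OF sequentially_bot] by blast
  define R where "R = real k"
  have "bounded (range (\<psi> R))" using \<psi>_bdd by (auto simp: bounded_iff)
  then have "(\<lambda>n. \<integral>\<omega>. \<psi> R (W n \<omega>) \<partial>M) \<longlonglongrightarrow> (\<integral>\<omega>. \<psi> R (W' \<omega>) \<partial>N)"
    using conv \<psi>_cont by (simp add: conv_in_distr_def)
  then have "eventually (\<lambda>n. (\<integral>\<omega>. \<psi> R (W n \<omega>) \<partial>M) < \<eta>) sequentially"
    using k unfolding R_def by (rule order_tendstoD(2))
  then have "eventually (\<lambda>n. measure M {\<omega>\<in>space M. norm (W n \<omega>) > R + 1} \<le> \<eta>) sequentially"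
    by eventually_elim (use M.prob_norm_gt_le[of "W _" R] in \<open>auto simp: \<psi>_def intro: order.trans less_imp_le\<close>)
  moreover have "measure N {\<omega>\<in>space N. norm (W' \<omega>) > R + 1} \<le> \<eta>"
    using N.prob_norm_gt_le[of W' R] k by (simp add: R_def \<psi>_def)
  ultimately show ?thesis by blast
qed

section \<open>Trigonometric polynomials in finitely many vectors\<close>

definition block_inner :: "nat \<Rightarrow> (nat \<Rightarrow> 'b::euclidean_space) \<Rightarrow> (nat \<Rightarrow> 'b) \<Rightarrow> real" where
  "block_inner K u x = (\<Sum>j<K. u j \<bullet> x j)"

text \<open>The algebra fed into \<open>expectation_tendsto_of_separating_algebra\<close>.
  Expectations of its generators are multiples of real and imaginary parts of joint characteristic
  functions, and the product-to-sum formulas make it closed under multiplication.\<close>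

inductive_set trig_polys :: "nat \<Rightarrow> ((nat \<Rightarrow> 'b::euclidean_space) \<Rightarrow> real) set" for K where
  cos: "(\<lambda>x. a * cos (block_inner K u x)) \<in> trig_polys K"
| sin: "(\<lambda>x. a * sin (block_inner K u x)) \<in> trig_polys K"
| add: "f \<in> trig_polys K \<Longrightarrow> g \<in> trig_polys K \<Longrightarrow> (\<lambda>x. f x + g x) \<in> trig_polys K"

lemma block_inner_add: "block_inner K (\<lambda>j. u j + v j) x = block_inner K u x + block_inner K v x"
  and block_inner_diff: "block_inner K (\<lambda>j. u j - v j) x = block_inner K u x - block_inner K v x"
  by (simp_all add: block_inner_def inner_add_left inner_diff_left sum.distrib sum_subtractf)

lemma trig_polys_const: "(\<lambda>_. c) \<in> trig_polys K"
  using trig_polys.cos[of c K "\<lambda>_. 0"] by (simp add: block_inner_def)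

lemma trig_polys_mult:
  assumes "f \<in> trig_polys K" "g \<in> trig_polys K"
  shows "(\<lambda>x. f x * g x) \<in> trig_polys K"
  using assms
proof (induction arbitrary: g)
  case (cos a u)
  from cos show ?case
  proof induction
    case (cos b v)
    have "(\<lambda>x. a * cos (block_inner K u x) * (b * cos (block_inner K v x))) =
      (\<lambda>x. (a * b / 2) * cos (block_inner K (\<lambda>j. u j - v j) x) + (a * b / 2) * cos (block_inner K (\<lambda>j. u j + v j) x))"
      by (simp add: block_inner_add block_inner_diff cos_add cos_diff field_simps)
    then show ?case by (simp only: trig_polys.intros)
  next
    case (sin b v)
    have "(\<lambda>x. a * cos (block_inner K u x) * (b * sin (block_inner K v x))) =
      (\<lambda>x. (a * b / 2) * sin (block_inner K (\<lambda>j. u j + v j) x) + (- (a * b / 2)) * sin (block_inner K (\<lambda>j. u j - v j) x))"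
      by (simp add: block_inner_add block_inner_diff sin_add sin_diff field_simps)
    then show ?case by (simp only: trig_polys.intros)
  next
    case (add f g)
    from trig_polys.add[OF add.IH] show ?case by (simp add: distrib_left)
  qed
next
  case (sin a u)
  from sin show ?case
  proof induction
    case (cos b v)
    have "(\<lambda>x. a * sin (block_inner K u x) * (b * cos (block_inner K v x))) =
      (\<lambda>x. (a * b / 2) * sin (block_inner K (\<lambda>j. u j + v j) x) + (a * b / 2) * sin (block_inner K (\<lambda>j. u j - v j) x))"
      by (simp add: block_inner_add block_inner_diff sin_add sin_diff field_simps)
    then show ?case by (simp only: trig_polys.intros)
  next
    case (sin b v)
    have "(\<lambda>x. a * sin (block_inner K u x) * (b * sin (block_inner K v x))) =
      (\<lambda>x. (a * b / 2) * cos (block_inner K (\<lambda>j. u j - v j) x) + (- (a * b / 2)) * cos (block_inner K (\<lambda>j. u j + v j) x))"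
      by (simp add: block_inner_add block_inner_diff cos_add cos_diff field_simps)
    then show ?case by (simp only: trig_polys.intros)
  next
    case (add f g)
    from trig_polys.add[OF add.IH] show ?case by (simp add: distrib_left)
  qed
next
  case (add f h)
  then have "(\<lambda>x. f x * g x + h x * g x) \<in> trig_polys K" by (intro trig_polys.add) auto
  then show ?case by (simp add: distrib_right)
qed

lemma continuous_on_block_inner: "continuous_on UNIV (block_inner K u)"
  unfolding block_inner_def by (intro continuous_intros continuous_on_product_coordinates)

lemma continuous_on_trig_polys: "f \<in> trig_polys K \<Longrightarrow> continuous_on UNIV f"
  by (induction rule: trig_polys.induct) (intro continuous_intros continuous_on_block_inner; assumption)+

lemma bounded_trig_polys: "f \<in> trig_polys K \<Longrightarrow> bounded (range f)"
proof (induction rule: trig_polys.induct)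
  case (cos a u)
  show ?case unfolding bounded_iff
    by (intro exI[of _ "\<bar>a\<bar>"]) (auto simp: abs_mult mult_left_le)
next
  case (sin a u)
  show ?case unfolding bounded_iff
    by (intro exI[of _ "\<bar>a\<bar>"]) (auto simp: abs_mult mult_left_le)
next
  case (add f g)
  then show ?case by (intro bounded_plus_comp)
qed

text \<open>The frequency is a multiple of \<open>x j - y j\<close>, scaled down until both inner
  products lie in \<open>{-1..1}\<close>, where the sine is injective.\<close>

lemma trig_polys_separate:
  fixes x y :: "nat \<Rightarrow> 'b::euclidean_space"
  assumes "j < K" "x j \<noteq> y j"
  shows "\<exists>f\<in>trig_polys K. f x \<noteq> f y"
proof -
  define v where "v = (1 / (1 + \<bar>(x j - y j) \<bullet> x j\<bar> + \<bar>(x j - y j) \<bullet> y j\<bar>)) *\<^sub>R (x j - y j)"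
  define u where "u = (\<lambda>i. if i = j then v else 0)"
  have bi: "block_inner K u z = v \<bullet> z j" for z
    using assms(1) by (simp add: block_inner_def u_def if_distrib[where f="\<lambda>w. w \<bullet> _"] sum.delta cong: if_cong)
  have den: "1 + \<bar>(x j - y j) \<bullet> x j\<bar> + \<bar>(x j - y j) \<bullet> y j\<bar> > 0" by simp
  have "v \<bullet> x j \<noteq> v \<bullet> y j"
  proof -
    have "(x j - y j) \<bullet> (x j - y j) \<noteq> 0" using assms(2) by simp
    then have "(x j - y j) \<bullet> x j \<noteq> (x j - y j) \<bullet> y j" by (simp add: inner_diff_right)
    then show ?thesis using den by (simp add: v_def)
  qed
  moreover have "\<bar>v \<bullet> x j\<bar> \<le> 1" "\<bar>v \<bullet> y j\<bar> \<le> 1"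
    using den by (simp_all add: v_def abs_of_pos)
  ultimately have "sin (v \<bullet> x j) \<noteq> sin (v \<bullet> y j)"
    using pi_gt3 sin_inj_pi[of "v \<bullet> x j" "v \<bullet> y j"] by (force simp: abs_le_iff)
  then show ?thesis
    by (intro bexI[of _ "\<lambda>z. 1 * sin (block_inner K u z)"] trig_polys.sin) (simp add: bi)
qed

text \<open>Pinning the coordinates from \<open>K\<close> on to 0 makes the infinite product
  compact, and distinct points of it differ in one of the first \<open>K\<close> coordinates, where
  trigonometric polynomials can see them.\<close>

lemma compact_blocks: "compact {x :: nat \<Rightarrow> 'b::euclidean_space. \<forall>j. x j \<in> (if j < K then cball 0 (r j) else {0})}"
proof -
  have "{x :: nat \<Rightarrow> 'b. \<forall>j. x j \<in> (if j < K then cball 0 (r j) else {0})} =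
    PiE UNIV (\<lambda>j. if j < K then cball 0 (r j) else {0})"
    by (auto simp: PiE_def Pi_def extensional_def)
  moreover have "compactin (product_topology (\<lambda>_. euclidean) UNIV) (PiE UNIV (\<lambda>j. if j < K then cball (0::'b) (r j) else {0}))"
    unfolding compactin_PiE by auto
  ultimately show ?thesis by (simp add: euclidean_product_topology)
qed

lemma (in prob_space) integrable_iexp_borel:
  assumes [measurable]: "W \<in> borel_measurable M"
  shows "integrable M (\<lambda>\<omega>. iexp (W \<omega>))"
  by (intro integrable_const_bound[of _ 1]) auto

lemma (in prob_space) integral_cos_sin_iexp:
  assumes [measurable]: "W \<in> borel_measurable M"
  shows "(\<integral>\<omega>. cos (W \<omega>) \<partial>M) = Re (CLINT \<omega>|M. iexp (W \<omega>))"
    "(\<integral>\<omega>. sin (W \<omega>) \<partial>M) = Im (CLINT \<omega>|M. iexp (W \<omega>))"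
  using integral_Re[OF integrable_iexp_borel[OF assms]] integral_Im[OF integrable_iexp_borel[OF assms]]
  by (simp_all add: Re_exp Im_exp)

lemma char_distr:
  assumes [measurable]: "W \<in> borel_measurable M"
  shows "char (distr M borel W) t = (CLINT \<omega>|M. iexp (t * W \<omega>))"
  unfolding char_def by (subst integral_distr) auto

text \<open>One-dimensional Levy continuity serves here to obtain tightness of single coordinates;
  joint convergence comes from Stone--Weierstrass.\<close>

lemma conv_in_distr_real_iexp:
  fixes W :: "nat \<Rightarrow> 'w \<Rightarrow> real" and W' :: "'v \<Rightarrow> real"
  assumes "prob_space M" "prob_space N"
    and [measurable]: "\<And>n. W n \<in> borel_measurable M" "W' \<in> borel_measurable N"
    and "\<And>t. (\<lambda>n. CLINT \<omega>|M. iexp (t * W n \<omega>)) \<longlonglongrightarrow> (CLINT \<omega>|N. iexp (t * W' \<omega>))"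
  shows "conv_in_distr M W N W'"
proof -
  interpret M: prob_space M by fact
  interpret N: prob_space N by fact
  have "weak_conv_m (\<lambda>n. distr M borel (W n)) (distr N borel W')"
  proof (rule levy_continuity)
    show "real_distribution (distr M borel (W n))" for n
      by (rule M.real_distribution_distr) simp
    show "real_distribution (distr N borel W')"
      by (rule N.real_distribution_distr) simp
    show "(\<lambda>n. char (distr M borel (W n)) t) \<longlonglongrightarrow> char (distr N borel W') t" for t
      using assms(5)[of t] by (simp add: char_distr)
  qed
  then show ?thesis
    using conv_in_distr_real_iff[OF assms(1-4)] by simp
qed

lemma (in prob_space) prob_not_in_blocks_le:
  fixes V :: "'a \<Rightarrow> nat \<Rightarrow> 'b::euclidean_space" and R :: "nat \<Rightarrow> 'b \<Rightarrow> real"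
  assumes [measurable]: "\<And>j. (\<lambda>\<omega>. V \<omega> j) \<in> borel_measurable M"
    and zero: "\<And>\<omega> j. j \<ge> K \<Longrightarrow> V \<omega> j = 0"
  shows "prob {\<omega>\<in>space M. \<not> (\<forall>j. V \<omega> j \<in> (if j < K then cball 0 (\<Sum>i\<in>Basis. R j i) else {0}))}
    \<le> (\<Sum>j<K. \<Sum>i\<in>Basis. prob {\<omega>\<in>space M. norm (V \<omega> j \<bullet> i) > R j i})"
proof -
  have out: "\<exists>j<K. \<exists>i\<in>Basis. norm (x j \<bullet> i) > R j i"
    if "\<not> (\<forall>j. x j \<in> (if j < K then cball 0 (\<Sum>i\<in>Basis. R j i) else {0}))" "\<And>j. j \<ge> K \<Longrightarrow> x j = 0" for x
  proof (rule ccontr)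
    assume *: "\<not> ?thesis"
    have "norm (x j) \<le> (\<Sum>i\<in>Basis. R j i)" if "j < K" for j
    proof -
      have "norm (x j) \<le> (\<Sum>i\<in>Basis. \<bar>x j \<bullet> i\<bar>)" by (rule norm_le_l1)
      also have "\<dots> \<le> (\<Sum>i\<in>Basis. R j i)" using * that by (intro sum_mono) (metis not_less real_norm_def)
      finally show ?thesis .
    qed
    with that show False by (auto split: if_splits)
  qed
  have "prob {\<omega>\<in>space M. \<not> (\<forall>j. V \<omega> j \<in> (if j < K then cball 0 (\<Sum>i\<in>Basis. R j i) else {0}))}
    \<le> prob (\<Union>j\<in>{..<K}. \<Union>i\<in>Basis. {\<omega>\<in>space M. norm (V \<omega> j \<bullet> i) > R j i})"
  proof (rule finite_measure_mono)
    show "{\<omega>\<in>space M. \<not> (\<forall>j. V \<omega> j \<in> (if j < K then cball 0 (\<Sum>i\<in>Basis. R j i) else {0}))}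
      \<subseteq> (\<Union>j\<in>{..<K}. \<Union>i\<in>Basis. {\<omega>\<in>space M. norm (V \<omega> j \<bullet> i) > R j i})"
      using out[OF _ zero] by fast
    show "(\<Union>j\<in>{..<K}. \<Union>i\<in>Basis. {\<omega>\<in>space M. norm (V \<omega> j \<bullet> i) > R j i}) \<in> sets M"
      by (intro sets.finite_UN) auto
  qed
  also have "\<dots> \<le> (\<Sum>j<K. prob (\<Union>i\<in>Basis. {\<omega>\<in>space M. norm (V \<omega> j \<bullet> i) > R j i}))"
    by (intro finite_measure_subadditive_finite) auto
  also have "\<dots> \<le> (\<Sum>j<K. \<Sum>i\<in>Basis. prob {\<omega>\<in>space M. norm (V \<omega> j \<bullet> i) > R j i})"
    by (intro sum_mono finite_measure_subadditive_finite) auto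
  finally show ?thesis .
qed

text \<open>A multivariate Levy continuity theorem. The joint characteristic functions yield both
  ingredients: convergence on trigonometric polynomials and, specialised to one coordinate of one
  block, tightness.\<close>

theorem expectation_tendsto_blocks:
  fixes Z :: "nat \<Rightarrow> 'w \<Rightarrow> nat \<Rightarrow> 'b::euclidean_space" and Z' :: "'v \<Rightarrow> nat \<Rightarrow> 'b"
    and F :: "(nat \<Rightarrow> 'b) \<Rightarrow> real"
  assumes M: "prob_space M" and N: "prob_space N"
    and Z [measurable]: "\<And>n j. (\<lambda>\<omega>. Z n \<omega> j) \<in> borel_measurable M"
    and Z' [measurable]: "\<And>j. (\<lambda>\<omega>. Z' \<omega> j) \<in> borel_measurable N"
    and zero: "\<And>n \<omega> j. j \<ge> K \<Longrightarrow> Z n \<omega> j = 0" "\<And>\<omega> j. j \<ge> K \<Longrightarrow> Z' \<omega> j = 0"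
    and ch: "\<And>u. (\<lambda>n. CLINT \<omega>|M. iexp (block_inner K u (Z n \<omega>))) \<longlonglongrightarrow> (CLINT \<omega>|N. iexp (block_inner K u (Z' \<omega>)))"
    and F: "continuous_on UNIV F" "bounded (range F)"
  shows "(\<lambda>n. \<integral>\<omega>. F (Z n \<omega>) \<partial>M) \<longlonglongrightarrow> (\<integral>\<omega>. F (Z' \<omega>) \<partial>N)"
proof -
  interpret M: prob_space M by fact
  interpret N: prob_space N by fact
  have Zm [measurable]: "Z n \<in> borel_measurable M" for n
    by (rule measurable_coordinatewise_then_product) (rule Z)
  have Zm' [measurable]: "Z' \<in> borel_measurable N"
    by (rule measurable_coordinatewise_then_product) (rule Z')
  have bi [measurable]: "(\<lambda>\<omega>. block_inner K u (Z n \<omega>)) \<in> borel_measurable M"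
    "(\<lambda>\<omega>. block_inner K u (Z' \<omega>)) \<in> borel_measurable N" for u n
    unfolding block_inner_def by measurable
  show ?thesis
  proof (rule expectation_tendsto_of_separating_algebra[where R="trig_polys K", OF M N Zm Zm'])
    fix f :: "(nat \<Rightarrow> 'b) \<Rightarrow> real" assume "f \<in> trig_polys K"
    then show "(\<lambda>n. \<integral>\<omega>. f (Z n \<omega>) \<partial>M) \<longlonglongrightarrow> (\<integral>\<omega>. f (Z' \<omega>) \<partial>N)"
    proof (induction rule: trig_polys.induct)
      case (cos a u)
      show ?case
        using tendsto_Re[OF ch[of u]]
        by (simp add: M.integral_cos_sin_iexp N.integral_cos_sin_iexp tendsto_mult_left)
    next
      case (sin a u)
      show ?case
        using tendsto_Im[OF ch[of u]]
        by (simp add: M.integral_cos_sin_iexp N.integral_cos_sin_iexp tendsto_mult_left)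
    next
      case (add f g)
      have m: "h \<in> borel_measurable borel" and b: "\<exists>B. \<forall>x. \<bar>h x\<bar> \<le> B"
        if "h \<in> trig_polys K" for h :: "(nat \<Rightarrow> 'b) \<Rightarrow> real"
        using continuous_on_trig_polys[OF that] bounded_trig_polys[OF that]
        by (auto intro: borel_measurable_continuous_onI simp: bounded_iff)
      have int: "integrable M (\<lambda>\<omega>. h (Z n \<omega>))" "integrable N (\<lambda>\<omega>. h (Z' \<omega>))"
        if h: "h \<in> trig_polys K" for h n
      proof -
        note m[OF h, measurable]
        obtain B where "\<And>x. \<bar>h x\<bar> \<le> B" using b[OF h] by blast
        then show "integrable M (\<lambda>\<omega>. h (Z n \<omega>))" "integrable N (\<lambda>\<omega>. h (Z' \<omega>))"
          by (auto intro!: M.integrable_const_bound[of _ B] N.integrable_const_bound[of _ B])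
      qed
      show ?case
        using tendsto_add[OF add.IH] int[OF add.hyps(1)] int[OF add.hyps(2)] by simp
    qed
  next
    fix \<eta> :: real assume \<eta>: "\<eta> > 0"
    \<comment> \<open>One share for each coordinate of each block; the added 1 keeps the denominator
      positive for \<open>K = 0\<close>.\<close>
    define \<eta>' where "\<eta>' = \<eta> / (real K * DIM('b) + 1)"
    have den: "real K * DIM('b) + 1 > 0" by (simp add: add_nonneg_pos)
    then have "\<eta>' > 0" using \<eta> by (simp add: \<eta>'_def)
    have sum_\<eta>': "(\<Sum>j<K. \<Sum>i\<in>(Basis::'b set). \<eta>') \<le> \<eta>"
      using \<eta> den by (simp add: \<eta>'_def field_simps)
    define T where "T = (\<lambda>j i R. (\<forall>\<^sub>F n in sequentially. measure M {\<omega>\<in>space M. norm (Z n \<omega> j \<bullet> i) > R} \<le> \<eta>') \<and>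
      measure N {\<omega>\<in>space N. norm (Z' \<omega> j \<bullet> i) > R} \<le> \<eta>')"
    have "\<exists>R. T j i R" if "j < K" for i :: 'b and j
      unfolding T_def
    proof (rule conv_in_distr_tight[OF M N conv_in_distr_real_iexp[OF M N] \<open>\<eta>' > 0\<close>])
      fix t :: real
      \<comment> \<open>A frequency supported on block \<open>j\<close> and direction
        \<open>i\<close> isolates that coordinate.\<close>
      define u where "u = (\<lambda>k. if k = j then t *\<^sub>R i else 0)"
      have "block_inner K u x = t * (x j \<bullet> i)" for x
      proof -
        have "block_inner K u x = (\<Sum>k<K. if k = j then t * (x j \<bullet> i) else 0)"
          unfolding block_inner_def u_def by (intro sum.cong) (auto simp: inner_commute)
        then show ?thesis using that by simp
      qed
      then show "(\<lambda>n. CLINT \<omega>|M. iexp (t * (Z n \<omega> j \<bullet> i))) \<longlonglongrightarrow> (CLINT \<omega>|N. iexp (t * (Z' \<omega> j \<bullet> i)))"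
        using ch[of u] by simp
    qed measurable
    then obtain R where "\<And>i j. j < K \<Longrightarrow> T j i (R j i)"
      by metis
    then have R: "\<And>i j. j < K \<Longrightarrow> \<forall>\<^sub>F n in sequentially. measure M {\<omega>\<in>space M. norm (Z n \<omega> j \<bullet> i) > R j i} \<le> \<eta>'"
      "\<And>i j. j < K \<Longrightarrow> measure N {\<omega>\<in>space N. norm (Z' \<omega> j \<bullet> i) > R j i} \<le> \<eta>'"
      unfolding T_def by blast+
    define S where "S = {x :: nat \<Rightarrow> 'b. \<forall>j. x j \<in> (if j < K then cball 0 (\<Sum>i\<in>Basis. R j i) else {0})}"
    have le_M: "measure M {\<omega>\<in>space M. Z n \<omega> \<notin> S} \<le> (\<Sum>j<K. \<Sum>i\<in>Basis. measure M {\<omega>\<in>space M. norm (Z n \<omega> j \<bullet> i) > R j i})" for n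
      unfolding S_def mem_Collect_eq using Z zero(1) by (rule M.prob_not_in_blocks_le)
    have le_N: "measure N {\<omega>\<in>space N. Z' \<omega> \<notin> S} \<le> (\<Sum>j<K. \<Sum>i\<in>Basis. measure N {\<omega>\<in>space N. norm (Z' \<omega> j \<bullet> i) > R j i})"
      unfolding S_def mem_Collect_eq using Z' zero(2) by (rule N.prob_not_in_blocks_le)
    show "\<exists>S. compact S \<and> (\<forall>x\<in>S. \<forall>y\<in>S. x \<noteq> y \<longrightarrow> (\<exists>f\<in>trig_polys K. f x \<noteq> f y)) \<and>
      (\<forall>\<^sub>F n in sequentially. measure M {\<omega>\<in>space M. Z n \<omega> \<notin> S} \<le> \<eta>) \<and> measure N {\<omega>\<in>space N. Z' \<omega> \<notin> S} \<le> \<eta>"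
    proof (intro exI[of _ S] conjI ballI impI)
      show "compact S" unfolding S_def by (rule compact_blocks)
      fix x y assume "x \<in> S" "y \<in> S" "x \<noteq> y"
      then obtain j where "x j \<noteq> y j" by blast
      moreover from this have "j < K"
        using \<open>x \<in> S\<close> \<open>y \<in> S\<close> unfolding S_def mem_Collect_eq by (metis singletonD)
      ultimately show "\<exists>f\<in>trig_polys K. f x \<noteq> f y" by (intro trig_polys_separate)
    next
      have "\<forall>\<^sub>F n in sequentially. \<forall>j\<in>{..<K}. \<forall>i\<in>(Basis::'b set). measure M {\<omega>\<in>space M. norm (Z n \<omega> j \<bullet> i) > R j i} \<le> \<eta>'"
        using R(1) by (intro eventually_ball_finite ballI) auto
      then show "\<forall>\<^sub>F n in sequentially. measure M {\<omega>\<in>space M. Z n \<omega> \<notin> S} \<le> \<eta>"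
      proof eventually_elim
        case (elim n)
        have "(\<Sum>j<K. \<Sum>i\<in>Basis. measure M {\<omega>\<in>space M. norm (Z n \<omega> j \<bullet> i) > R j i}) \<le> (\<Sum>j<K. \<Sum>i\<in>(Basis::'b set). \<eta>')"
          using elim by (intro sum_mono) auto
        then show ?case using le_M[of n] sum_\<eta>' by linarith
      qed
      have "(\<Sum>j<K. \<Sum>i\<in>Basis. measure N {\<omega>\<in>space N. norm (Z' \<omega> j \<bullet> i) > R j i}) \<le> (\<Sum>j<K. \<Sum>i\<in>(Basis::'b set). \<eta>')"
        using R(2) by (intro sum_mono) auto
      then show "measure N {\<omega>\<in>space N. Z' \<omega> \<notin> S} \<le> \<eta>"
        using le_N sum_\<eta>' by linarith
    qed
  qed (use F trig_polys_const trig_polys.add trig_polys_mult continuous_on_trig_polys bounded_trig_polys in blast)+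
qed

section \<open>Characteristic functions of normalised sums\<close>

text \<open>A connected set has connected image, and the roots of unity are finitely many. Applied
  to the quotient of two continuous \<open>n\<close>-th roots, this shows that they agree once they
  agree at 0.\<close>

lemma continuous_root_of_unity:
  fixes q :: "real \<Rightarrow> complex"
  assumes "continuous_on {0..1} q" "q 0 = 1" "\<And>s. s \<in> {0..1} \<Longrightarrow> q s ^ n = 1" "n \<ge> 1" "s \<in> {0..1}"
  shows "q s = 1"
proof -
  have "q ` {0..1} \<subseteq> {z. z ^ n = 1}" using assms(3) by auto
  then have "finite (q ` {0..1})"
    using finite_roots_unity[OF assms(4)] finite_subset by blast
  then have "q constant_on {0..1}"
    using assms(1) by (intro continuous_finite_range_constant) auto
  then show ?thesis using assms(2,5) unfolding constant_on_def by force
qed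

text \<open>
  The continuous \<open>n\<close>-th root of a nonvanishing function on an interval is determined by its value
  at one point, so no assumption on the size of \<open>f n - 1\<close> is needed.
\<close>

lemma power_exp_uniform_limit_root:
  fixes f :: "nat \<Rightarrow> real \<Rightarrow> complex" and g :: "real \<Rightarrow> complex"
  assumes f: "\<And>n. continuous_on {0..1} (f n)" "\<And>n. f n 0 = 1"
    and g: "continuous_on {0..1} g" "g 0 = 0"
    and lim: "uniform_limit {0..1} (\<lambda>n s. f n s ^ n) (\<lambda>s. exp (g s)) sequentially"
  shows "\<exists>h. (\<forall>\<^sub>F n in sequentially. \<forall>s\<in>{0..1}. f n s = exp (h n s / of_nat n)) \<and>
    uniform_limit {0..1} h g sequentially"
proof -
  define w where "w = (\<lambda>n s. f n s ^ n * exp (- g s))"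
  \<comment> \<open>\<open>w n\<close> tends to 1 uniformly, so eventually the principal logarithm
    is continuous along it and \<open>h n\<close> is a continuous logarithm of
    \<open>f n s ^ n\<close> close to \<open>g\<close>.\<close>
  define h where "h = (\<lambda>n s. g s + Ln (w n s))"
  have "continuous_on {0..1} (\<lambda>s. exp (- g s))" by (intro continuous_intros g)
  then have "bounded ((\<lambda>s. exp (- g s)) ` {0..1})"
    by (intro compact_imp_bounded compact_continuous_image) auto
  then obtain B where B: "B > 0" "\<And>s. s \<in> {0..1} \<Longrightarrow> norm (exp (- g s)) \<le> B"
    by (auto simp: bounded_pos)
  have w_lim: "\<forall>\<^sub>F n in sequentially. \<forall>s\<in>{0..1}. norm (w n s - 1) < \<epsilon>" if "\<epsilon> > 0" for \<epsilon>
  proof -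
    have "\<forall>\<^sub>F n in sequentially. \<forall>s\<in>{0..1}. dist (f n s ^ n) (exp (g s)) < \<epsilon> / B"
      using lim that B(1) by (intro uniform_limitD) auto
    then show ?thesis
    proof eventually_elim
      case (elim n)
      show ?case
      proof
        fix s :: real assume s: "s \<in> {0..1}"
        have "w n s - 1 = (f n s ^ n - exp (g s)) * exp (- g s)"
          by (simp add: w_def left_diff_distrib flip: exp_add)
        then have "norm (w n s - 1) = norm (f n s ^ n - exp (g s)) * norm (exp (- g s))"
          by (simp only: norm_mult)
        also have "\<dots> \<le> norm (f n s ^ n - exp (g s)) * B"
          using B(2)[OF s] by (rule mult_left_mono) simp
        also have "\<dots> < \<epsilon>"
          using elim s B(1) by (auto simp: dist_norm pos_less_divide_eq)
        finally show "norm (w n s - 1) < \<epsilon>" .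
      qed
    qed
  qed
  have "uniform_limit {0..1} h g sequentially"
  proof (rule uniform_limitI)
    fix \<epsilon> :: real assume "\<epsilon> > 0"
    have "isCont Ln (1::complex)" by (rule continuous_at_Ln) simp
    then obtain \<delta> where \<delta>: "\<delta> > 0" "\<And>z. dist z 1 < \<delta> \<Longrightarrow> dist (Ln z) (Ln 1) < \<epsilon>"
      using \<open>\<epsilon> > 0\<close> unfolding continuous_at_eps_delta by blast
    show "\<forall>\<^sub>F n in sequentially. \<forall>s\<in>{0..1}. dist (h n s) (g s) < \<epsilon>"
      using w_lim[OF \<delta>(1)] by eventually_elim (use \<delta>(2) in \<open>force simp: h_def dist_norm\<close>)
  qed
  moreover have "\<forall>\<^sub>F n in sequentially. \<forall>s\<in>{0..1}. f n s = exp (h n s / of_nat n)"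
    using w_lim[of 1, simplified] eventually_ge_at_top[of 1]
  proof eventually_elim
    case (elim n)
    have Re_w: "Re (w n s) > 0" if "s \<in> {0..1}" for s
    proof -
      have "\<bar>Re (w n s - 1)\<bar> < 1" using elim(1) that abs_Re_le_cmod[of "w n s - 1"] by force
      then show ?thesis by simp
    qed
    have not_nonpos: "w n s \<notin> \<real>\<^sub>\<le>\<^sub>0" if "s \<in> {0..1}" for s
      using Re_w[OF that] by (auto simp: complex_nonpos_Reals_iff)
    have nz: "w n s \<noteq> 0" if "s \<in> {0..1}" for s using Re_w[OF that] by auto
    have w_cont: "continuous_on {0..1} (w n)"
      unfolding w_def by (intro continuous_intros f g)
    define q where "q = (\<lambda>s. f n s * exp (- (h n s / of_nat n)))"
    have "continuous_on {0..1} q"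
      unfolding q_def h_def using not_nonpos elim(2)
      by (intro continuous_intros f g w_cont continuous_on_Ln) auto
    moreover have qn: "q s ^ n = 1" if "s \<in> {0..1}" for s
    proof -
      have "q s ^ n = f n s ^ n * exp (- h n s)"
        using elim(2) by (simp add: q_def power_mult_distrib exp_of_nat_mult[symmetric])
      also have "exp (- h n s) = exp (- g s) * inverse (w n s)"
        using nz[OF that] by (simp add: h_def exp_diff exp_minus field_simps exp_add)
      also have "f n s ^ n * (exp (- g s) * inverse (w n s)) = 1"
      proof -
        have "f n s ^ n * (exp (- g s) * inverse (w n s)) = w n s * inverse (w n s)"
          by (simp only: w_def mult.assoc)
        then show ?thesis using nz[OF that] by simp
      qed
      finally show ?thesis .
    qed
    ultimately have "q s = 1" if "s \<in> {0..1}" for s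
      using continuous_root_of_unity[of q n s] that elim(2) f(2) g(2)
      by (simp add: q_def h_def w_def)
    then show ?case
      by (auto simp: q_def exp_minus field_simps)
  qed
  ultimately show ?thesis by blast
qed

lemma power_fraction_tendsto:
  fixes f :: "nat \<Rightarrow> real \<Rightarrow> complex" and k :: "nat \<Rightarrow> nat"
  assumes h: "\<forall>\<^sub>F n in sequentially. \<forall>s\<in>{0..1}. f n s = exp (h n s / of_nat n)"
    "uniform_limit {0..1} h g sequentially"
    and k: "(\<lambda>n. real (k n) / real n) \<longlonglongrightarrow> \<theta>" and s: "s \<in> {0..1}"
  shows "(\<lambda>n. f n s ^ k n) \<longlonglongrightarrow> exp (of_real \<theta> * g s)"
proof -
  have "(\<lambda>n. exp (of_real (real (k n) / real n) * h n s)) \<longlonglongrightarrow> exp (of_real \<theta> * g s)"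
    by (intro tendsto_exp tendsto_mult tendsto_of_real k tendsto_uniform_limitI[OF h(2) s])
  moreover have "\<forall>\<^sub>F n in sequentially. exp (of_real (real (k n) / real n) * h n s) = f n s ^ k n"
    using h(1) by eventually_elim (use s in \<open>simp add: exp_of_nat_mult[symmetric]\<close>)
  ultimately show ?thesis by (rule Lim_transform_eventually)
qed

text \<open>The source of the linear tail bound. For \<open>k \<le> n\<close> the exponent
  \<open>(k / n) * h n s\<close> has norm at most \<open>B + 1\<close>, where \<open>B\<close>
  bounds \<open>g\<close> and 1 is the distance of \<open>h n\<close> from \<open>g\<close>; then
  \<open>norm (exp z - 1) \<le> norm z * exp (norm z)\<close> is linear in
  \<open>k / n\<close>.\<close>

lemma power_minus_one_le:
  fixes f :: "nat \<Rightarrow> real \<Rightarrow> complex"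
  assumes h: "\<forall>\<^sub>F n in sequentially. \<forall>s\<in>{0..1}. f n s = exp (h n s / of_nat n)"
    "uniform_limit {0..1} h g sequentially" and g: "continuous_on {0..1} g"
  shows "\<exists>C\<ge>0. \<forall>\<^sub>F n in sequentially. \<forall>k\<le>n. \<forall>s\<in>{0..1}. norm (1 - f n s ^ k) \<le> C * (real k / real n)"
proof -
  have "bounded (g ` {0..1})"
    by (intro compact_imp_bounded compact_continuous_image g) auto
  then obtain B where B: "B > 0" "\<And>s. s \<in> {0..1} \<Longrightarrow> norm (g s) \<le> B"
    by (auto simp: bounded_pos)
  have "\<forall>\<^sub>F n in sequentially. \<forall>s\<in>{0..1}. dist (h n s) (g s) < 1"
    using h(2) by (rule uniform_limitD) simp
  with h(1) have "\<forall>\<^sub>F n in sequentially. \<forall>k\<le>n. \<forall>s\<in>{0..1}. norm (1 - f n s ^ k) \<le> ((B + 1) * exp (B + 1)) * (real k / real n)"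
    using eventually_gt_at_top[of 0]
  proof eventually_elim
    case (elim n)
    show ?case
    proof (intro allI impI ballI)
      fix k :: nat and s :: real assume k: "k \<le> n" and s: "s \<in> {0..1}"
      define z where "z = of_real (real k / real n) * h n s"
      have hB: "norm (h n s) \<le> B + 1"
        using elim(2) B(2)[OF s] s norm_triangle_sub[of "h n s" "g s"] by (fastforce simp: dist_norm)
      have nz: "norm z \<le> (real k / real n) * (B + 1)"
      proof -
        have "norm z = (real k / real n) * norm (h n s)"
          by (simp add: z_def norm_mult norm_divide)
        then show ?thesis using hB by (simp only:) (intro mult_left_mono; simp)
      qed
      also have "\<dots> \<le> 1 * (B + 1)"
        using k elim(3) B(1) by (intro mult_right_mono) auto
      finally have nz1: "norm z \<le> B + 1" by simp
      have "f n s ^ k = exp z"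
        using elim(1) s by (simp add: z_def exp_of_nat_mult[symmetric])
      moreover have "norm (exp z - 1) \<le> norm z * exp (norm z)"
        using Taylor_exp_field[of z 0] by (simp add: mult.commute)
      ultimately have "norm (1 - f n s ^ k) \<le> norm z * exp (norm z)"
        by (simp add: norm_minus_commute)
      also have "\<dots> \<le> ((real k / real n) * (B + 1)) * exp (B + 1)"
        using nz nz1 B(1) by (intro mult_mono) auto
      finally show "norm (1 - f n s ^ k) \<le> ((B + 1) * exp (B + 1)) * (real k / real n)"
        by (simp add: mult_ac)
    qed
  qed
  then show ?thesis using B(1) by (intro exI[of _ "(B + 1) * exp (B + 1)"]) auto
qed

text \<open>Averaging \<open>1 - cos (s * w)\<close> over \<open>s\<close> in the unit interval
  gives \<open>1 - sin w / w\<close>, which is at least 1/2 once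
  \<open>\<bar>w\<bar> \<ge> 2\<close>. This fixes the threshold 2 and the factor 2.\<close>

lemma (in prob_space) tail_bound_char:
  fixes W :: "'a \<Rightarrow> real"
  assumes W [measurable]: "W \<in> borel_measurable M"
    and ch: "\<And>s. s \<in> {0..1} \<Longrightarrow> norm (1 - (CLINT \<omega>|M. iexp (s * W \<omega>))) \<le> \<delta>"
  shows "prob {\<omega>\<in>space M. \<bar>W \<omega>\<bar> \<ge> 2} \<le> 2 * \<delta>"
proof -
  have \<delta>: "\<delta> \<ge> 0" using ch[of 0] by (rule order.trans[rotated]) auto
  define A where "A = {\<omega>\<in>space M. \<bar>W \<omega>\<bar> \<ge> 2}"
  have [measurable]: "A \<in> sets M" by (simp add: A_def)
  interpret P: pair_sigma_finite M lborel by unfold_locales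
  have lower: "ennreal (1 / 2) * indicator A \<omega> \<le> (\<integral>\<^sup>+s. ennreal (1 - cos (s * W \<omega>)) * indicator {0..1} s \<partial>lborel)" for \<omega>
  proof (cases "\<omega> \<in> A")
    case True
    define w where "w = W \<omega>"
    have w: "\<bar>w\<bar> \<ge> 2" using True by (simp add: A_def w_def)
    then have "w \<noteq> 0" by auto
    define G where "G = (\<lambda>s. s - sin (s * w) / w)"
    have "(\<integral>\<^sup>+s. ennreal (1 - cos (s * w)) * indicator {0..1} s \<partial>lborel) = ennreal (G 1 - G 0)"
    proof (rule nn_integral_FTC_Icc)
      fix s :: real
      show "(G has_real_derivative 1 - cos (s * w)) (at s)"
        unfolding G_def using \<open>w \<noteq> 0\<close> by (auto intro!: derivative_eq_intros)
    qed auto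
    moreover have "\<bar>sin w / w\<bar> \<le> 1 / 2"
    proof -
      have "\<bar>sin w / w\<bar> \<le> 1 / \<bar>w\<bar>" by (simp add: divide_right_mono)
      also have "\<dots> \<le> 1 / 2" using w by (intro divide_left_mono) auto
      finally show ?thesis .
    qed
    then have "sin w / w \<le> 1 / 2" by (rule order.trans[OF abs_ge_self])
    then have "G 1 - G 0 \<ge> 1 / 2" by (simp add: G_def)
    then have "ennreal (1 / 2) \<le> ennreal (G 1 - G 0)" by (rule ennreal_leI)
    ultimately show ?thesis
      unfolding w_def[symmetric] using True by (simp only: indicator_simps mult_1_right)
  qed simp
  have "ennreal (1 / 2) * emeasure M A = (\<integral>\<^sup>+\<omega>. ennreal (1 / 2) * indicator A \<omega> \<partial>M)"
    by (simp add: nn_integral_cmult)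
  also have "\<dots> \<le> (\<integral>\<^sup>+\<omega>. (\<integral>\<^sup>+s. ennreal (1 - cos (s * W \<omega>)) * indicator {0..1} s \<partial>lborel) \<partial>M)"
    by (intro nn_integral_mono lower)
  also have "\<dots> = (\<integral>\<^sup>+s. (\<integral>\<^sup>+\<omega>. ennreal (1 - cos (s * W \<omega>)) * indicator {0..1} s \<partial>M) \<partial>lborel)"
    by (rule P.Fubini'[symmetric]) measurable
  also have "\<dots> \<le> (\<integral>\<^sup>+s. ennreal \<delta> * indicator {0..1::real} s \<partial>lborel)"
  proof (intro nn_integral_mono)
    fix s :: real
    show "(\<integral>\<^sup>+\<omega>. ennreal (1 - cos (s * W \<omega>)) * indicator {0..1} s \<partial>M) \<le> ennreal \<delta> * indicator {0..1} s"
    proof (cases "s \<in> {0..1}")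
      case True
      have int: "integrable M (\<lambda>\<omega>. cos (s * W \<omega>))"
        by (intro integrable_const_bound[of _ 1]) auto
      have "(\<integral>\<^sup>+\<omega>. ennreal (1 - cos (s * W \<omega>)) \<partial>M) = ennreal (\<integral>\<omega>. 1 - cos (s * W \<omega>) \<partial>M)"
        using int by (intro nn_integral_eq_integral) auto
      also have "(\<integral>\<omega>. 1 - cos (s * W \<omega>) \<partial>M) = Re (1 - (CLINT \<omega>|M. iexp (s * W \<omega>)))"
        using int by (simp add: integral_cos_sin_iexp[of "\<lambda>\<omega>. s * W \<omega>"] prob_space)
      also have "\<dots> \<le> \<delta>"
        using complex_Re_le_cmod ch[OF True] by (rule order.trans)
      finally show ?thesis using True by (simp add: ennreal_leI)
    qed simp
  qed
  also have "\<dots> = ennreal \<delta>" by (simp add: nn_integral_cmult)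
  finally have "ennreal (1 / 2 * prob A) \<le> ennreal \<delta>"
    by (simp only: emeasure_eq_measure ennreal_mult[OF _ measure_nonneg] zero_le_divide_1_iff zero_le_numeral)
  then have "1 / 2 * prob A \<le> \<delta>" using \<delta> by (subst (asm) ennreal_le_iff)
  then show ?thesis by (simp add: A_def)
qed

section \<open>Characteristic functions and convergence in distribution\<close>

lemma norm_iexp_diff_le: "norm (iexp a - iexp b) \<le> min 2 \<bar>a - b\<bar>"
proof -
  have "iexp a - iexp b = iexp b * (iexp (a - b) - 1)"
    by (simp add: algebra_simps flip: exp_add)
  then have "norm (iexp a - iexp b) = norm (iexp (a - b) - 1)"
    by (simp add: norm_mult)
  moreover have "norm (iexp (a - b) - 1) \<le> \<bar>a - b\<bar>"
    using iexp_approx1[of "a - b" 0] by simp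
  moreover have "norm (iexp a - iexp b) \<le> norm (iexp a) + norm (iexp b)" by (rule norm_triangle_ineq4)
  ultimately show ?thesis by simp
qed

lemma conv_in_distr_continuous_map:
  fixes Z :: "nat \<Rightarrow> 'w \<Rightarrow> 'b::topological_space" and g :: "'b \<Rightarrow> 'c::topological_space"
  assumes "conv_in_distr M Z N Z'" "continuous_on UNIV g"
  shows "conv_in_distr M (\<lambda>n \<omega>. g (Z n \<omega>)) N (\<lambda>\<omega>. g (Z' \<omega>))"
  unfolding conv_in_distr_def
proof (intro conjI allI impI)
  have [measurable]: "g \<in> borel_measurable borel" using assms(2) by (rule borel_measurable_continuous_onI)
  show "(\<lambda>\<omega>. g (Z n \<omega>)) \<in> borel_measurable M" "(\<lambda>\<omega>. g (Z' \<omega>)) \<in> borel_measurable N" for n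
    using assms(1) measurable_compose[OF _ \<open>g \<in> borel_measurable borel\<close>] by (auto simp: conv_in_distr_def)
  fix f :: "'c \<Rightarrow> real" assume f: "continuous_on UNIV f" "bounded (range f)"
  have "continuous_on UNIV (\<lambda>x. f (g x))"
    by (rule continuous_on_compose2[OF f(1) assms(2)]) auto
  moreover have "bounded (range (\<lambda>x. f (g x)))"
    using f(2) by (rule bounded_subset) auto
  ultimately show "(\<lambda>n. \<integral>\<omega>. f (g (Z n \<omega>)) \<partial>M) \<longlonglongrightarrow> (\<integral>\<omega>. f (g (Z' \<omega>)) \<partial>N)"
    using assms(1) by (auto simp: conv_in_distr_def)
qed

lemma conv_in_distr_iexp:
  fixes W :: "nat \<Rightarrow> 'w \<Rightarrow> real" and W' :: "'v \<Rightarrow> real"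
  assumes M: "prob_space M" and N: "prob_space N" and conv: "conv_in_distr M W N W'"
  shows "(\<lambda>n. CLINT \<omega>|M. iexp (t * W n \<omega>)) \<longlonglongrightarrow> (CLINT \<omega>|N. iexp (t * W' \<omega>))"
proof -
  interpret M: prob_space M by fact
  interpret N: prob_space N by fact
  have [measurable]: "W n \<in> borel_measurable M" "W' \<in> borel_measurable N" for n
    using conv by (auto simp: conv_in_distr_def)
  have *: "(\<lambda>n. \<integral>\<omega>. f (W n \<omega>) \<partial>M) \<longlonglongrightarrow> (\<integral>\<omega>. f (W' \<omega>) \<partial>N)"
    if "continuous_on UNIV f" "\<And>x. \<bar>f x\<bar> \<le> 1" for f :: "real \<Rightarrow> real"
    using conv that by (auto simp: conv_in_distr_def bounded_iff)
  have cosM: "(\<integral>\<omega>. cos (t * W n \<omega>) \<partial>M) = Re (CLINT \<omega>|M. iexp (t * W n \<omega>))"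
    and sinM: "(\<integral>\<omega>. sin (t * W n \<omega>) \<partial>M) = Im (CLINT \<omega>|M. iexp (t * W n \<omega>))" for n
    by (rule M.integral_cos_sin_iexp[of "\<lambda>\<omega>. t * W n \<omega>"]; simp)+
  have cosN: "(\<integral>\<omega>. cos (t * W' \<omega>) \<partial>N) = Re (CLINT \<omega>|N. iexp (t * W' \<omega>))"
    and sinN: "(\<integral>\<omega>. sin (t * W' \<omega>) \<partial>N) = Im (CLINT \<omega>|N. iexp (t * W' \<omega>))"
    by (rule N.integral_cos_sin_iexp[of "\<lambda>\<omega>. t * W' \<omega>"]; simp)+
  show ?thesis
  proof (rule tendsto_complex_iff[THEN iffD2], intro conjI)
    show "(\<lambda>n. Re (CLINT \<omega>|M. iexp (t * W n \<omega>))) \<longlonglongrightarrow> Re (CLINT \<omega>|N. iexp (t * W' \<omega>))"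
      unfolding cosM[symmetric] cosN[symmetric] by (rule *[of "\<lambda>x. cos (t * x)"]) (auto intro!: continuous_intros)
    show "(\<lambda>n. Im (CLINT \<omega>|M. iexp (t * W n \<omega>))) \<longlonglongrightarrow> Im (CLINT \<omega>|N. iexp (t * W' \<omega>))"
      unfolding sinM[symmetric] sinN[symmetric] by (rule *[of "\<lambda>x. sin (t * x)"]) (auto intro!: continuous_intros)
  qed
qed

text \<open>The modulus of continuity is bounded by the expectation of a bounded continuous function
  of \<open>W\<close>. It therefore converges along with the laws, and one \<delta> serves almost
  the whole sequence.\<close>

lemma (in prob_space) norm_char_diff_le:
  fixes W :: "'a \<Rightarrow> real"
  assumes [measurable]: "W \<in> borel_measurable M" and "\<bar>s - t\<bar> \<le> \<delta>"
  shows "norm ((CLINT \<omega>|M. iexp (s * W \<omega>)) - (CLINT \<omega>|M. iexp (t * W \<omega>))) \<le> (\<integral>\<omega>. min 2 (\<delta> * \<bar>W \<omega>\<bar>) \<partial>M)"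
proof -
  have \<delta>: "\<delta> \<ge> 0" using assms(2) by linarith
  have int: "integrable M (\<lambda>\<omega>. iexp (r * W \<omega>))" for r
    by (rule integrable_iexp_borel[of "\<lambda>\<omega>. r * W \<omega>"]) simp
  have "(CLINT \<omega>|M. iexp (s * W \<omega>)) - (CLINT \<omega>|M. iexp (t * W \<omega>)) = (CLINT \<omega>|M. iexp (s * W \<omega>) - iexp (t * W \<omega>))"
    by (rule Bochner_Integration.integral_diff[symmetric]) (rule int)+
  also have "norm \<dots> \<le> (\<integral>\<omega>. norm (iexp (s * W \<omega>) - iexp (t * W \<omega>)) \<partial>M)"
    by (rule integral_norm_bound)
  also have "\<dots> \<le> (\<integral>\<omega>. min 2 (\<delta> * \<bar>W \<omega>\<bar>) \<partial>M)"
  proof (rule integral_mono)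
    show "integrable M (\<lambda>\<omega>. norm (iexp (s * W \<omega>) - iexp (t * W \<omega>)))"
      by (intro integrable_norm Bochner_Integration.integrable_diff int)
    show "integrable M (\<lambda>\<omega>. min 2 (\<delta> * \<bar>W \<omega>\<bar>))"
      using \<delta> by (intro integrable_const_bound[of _ 2]) auto
    fix \<omega>
    have "\<bar>s * W \<omega> - t * W \<omega>\<bar> = \<bar>s - t\<bar> * \<bar>W \<omega>\<bar>" by (simp add: abs_mult flip: left_diff_distrib)
    also have "\<dots> \<le> \<delta> * \<bar>W \<omega>\<bar>" using assms(2) by (rule mult_right_mono) simp
    finally show "norm (iexp (s * W \<omega>) - iexp (t * W \<omega>)) \<le> min 2 (\<delta> * \<bar>W \<omega>\<bar>)"
      using norm_iexp_diff_le[of "s * W \<omega>" "t * W \<omega>"] by linarith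
  qed
  finally show ?thesis .
qed

lemma (in prob_space) min_expectation_tendsto_0:
  fixes W :: "'a \<Rightarrow> real"
  assumes [measurable]: "W \<in> borel_measurable M"
  shows "(\<lambda>m. \<integral>\<omega>. min 2 (1 / real (Suc m) * \<bar>W \<omega>\<bar>) \<partial>M) \<longlonglongrightarrow> 0"
proof -
  have "(\<lambda>m. \<integral>\<omega>. min 2 (1 / real (Suc m) * \<bar>W \<omega>\<bar>) \<partial>M) \<longlonglongrightarrow> (\<integral>\<omega>. 0 \<partial>M)"
  proof (rule integral_dominated_convergence[where w="\<lambda>_. 2"])
    show "AE \<omega> in M. (\<lambda>m. min 2 (1 / real (Suc m) * \<bar>W \<omega>\<bar>)) \<longlonglongrightarrow> 0"
    proof (rule AE_I2)
      fix \<omega>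
      have "(\<lambda>m. min 2 (1 / real (Suc m) * \<bar>W \<omega>\<bar>)) \<longlonglongrightarrow> min 2 (0 * \<bar>W \<omega>\<bar>)"
        by (intro tendsto_intros LIMSEQ_inverse_real_of_nat[unfolded inverse_eq_divide])
      then show "(\<lambda>m. min 2 (1 / real (Suc m) * \<bar>W \<omega>\<bar>)) \<longlonglongrightarrow> 0" by simp
    qed
  qed auto
  then show ?thesis by simp
qed

lemma (in prob_space) continuous_on_char:
  fixes W :: "'a \<Rightarrow> real"
  assumes [measurable]: "W \<in> borel_measurable M"
  shows "continuous_on A (\<lambda>s. CLINT \<omega>|M. iexp (s * W \<omega>))"
proof -
  have "isCont (\<lambda>s. CLINT \<omega>|M. iexp (s * W \<omega>)) s" for s
    unfolding continuous_at_eps_delta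
  proof (intro allI impI)
    fix \<epsilon> :: real assume "\<epsilon> > 0"
    then have "eventually (\<lambda>m. (\<integral>\<omega>. min 2 (1 / real (Suc m) * \<bar>W \<omega>\<bar>) \<partial>M) < \<epsilon>) sequentially"
      using min_expectation_tendsto_0[OF assms] by (rule order_tendstoD(2)[rotated])
    then obtain m where m: "(\<integral>\<omega>. min 2 (1 / real (Suc m) * \<bar>W \<omega>\<bar>) \<partial>M) < \<epsilon>"
      using eventually_happens'[OF sequentially_bot] by blast
    show "\<exists>d>0. \<forall>t. dist t s < d \<longrightarrow> dist (CLINT \<omega>|M. iexp (t * W \<omega>)) (CLINT \<omega>|M. iexp (s * W \<omega>)) < \<epsilon>"
    proof (intro exI[of _ "1 / real (Suc m)"] conjI allI impI)
      fix t assume "dist t s < 1 / real (Suc m)"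
      then show "dist (CLINT \<omega>|M. iexp (t * W \<omega>)) (CLINT \<omega>|M. iexp (s * W \<omega>)) < \<epsilon>"
        using norm_char_diff_le[OF assms, of t s "1 / real (Suc m)"] m
        unfolding dist_norm real_norm_def by linarith
    qed simp
  qed
  then show ?thesis by (intro continuous_at_imp_continuous_on) blast
qed

text \<open>Pointwise convergence at the multiples of \<open>1 / real (Suc m)\<close> is combined
  with the common modulus of continuity from \<open>norm_char_diff_le\<close>. Uniformity is what
  allows \<open>n\<close>-th roots to be followed along the interval.\<close>

lemma conv_in_distr_char_uniform:
  fixes W :: "nat \<Rightarrow> 'w \<Rightarrow> real" and W' :: "'v \<Rightarrow> real"
  assumes M: "prob_space M" and N: "prob_space N" and conv: "conv_in_distr M W N W'"
  shows "uniform_limit {0..1} (\<lambda>n s. CLINT \<omega>|M. iexp (s * W n \<omega>)) (\<lambda>s. CLINT \<omega>|N. iexp (s * W' \<omega>)) sequentially"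
proof (rule uniform_limitI)
  interpret M: prob_space M by fact
  interpret N: prob_space N by fact
  have W [measurable]: "W n \<in> borel_measurable M" "W' \<in> borel_measurable N" for n
    using conv by (auto simp: conv_in_distr_def)
  fix \<epsilon> :: real assume \<epsilon>: "\<epsilon> > 0"
  have "eventually (\<lambda>m. (\<integral>\<omega>. min 2 (1 / real (Suc m) * \<bar>W' \<omega>\<bar>) \<partial>N) < \<epsilon> / 4) sequentially"
    using N.min_expectation_tendsto_0[OF W(2)] \<epsilon> by (intro order_tendstoD(2)) auto
  then obtain m where m: "(\<integral>\<omega>. min 2 (1 / real (Suc m) * \<bar>W' \<omega>\<bar>) \<partial>N) < \<epsilon> / 4"
    using eventually_happens'[OF sequentially_bot] by blast
  let ?D = "\<lambda>x. min 2 (1 / real (Suc m) * \<bar>x\<bar>)"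
  have "continuous_on UNIV ?D" "bounded (range ?D)"
    by (auto intro!: continuous_intros simp: bounded_iff intro: exI[of _ 2])
  then have "(\<lambda>n. \<integral>\<omega>. ?D (W n \<omega>) \<partial>M) \<longlonglongrightarrow> (\<integral>\<omega>. ?D (W' \<omega>) \<partial>N)"
    using conv unfolding conv_in_distr_def by blast
  then have 1: "eventually (\<lambda>n. (\<integral>\<omega>. ?D (W n \<omega>) \<partial>M) < \<epsilon> / 4) sequentially"
    using m by (rule order_tendstoD(2))
  have 2: "eventually (\<lambda>n. \<forall>i\<in>{0..Suc m}. dist (CLINT \<omega>|M. iexp (real i / real (Suc m) * W n \<omega>))
     (CLINT \<omega>|N. iexp (real i / real (Suc m) * W' \<omega>)) < \<epsilon> / 4) sequentially"
    by (intro eventually_ball_finite ballI tendstoD conv_in_distr_iexp[OF M N conv]) (use \<epsilon> in auto)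
  show "\<forall>\<^sub>F n in sequentially. \<forall>s\<in>{0..1}. dist (CLINT \<omega>|M. iexp (s * W n \<omega>)) (CLINT \<omega>|N. iexp (s * W' \<omega>)) < \<epsilon>"
    using 1 2
  proof eventually_elim
    case (elim n)
    show ?case
    proof
      fix s :: real assume s: "s \<in> {0..1}"
      define i where "i = nat \<lfloor>s * real (Suc m)\<rfloor>"
      have nn: "s * real (Suc m) \<ge> 0" using s by simp
      have i: "real i \<le> s * real (Suc m)" "s * real (Suc m) - real i \<le> 1"
        unfolding i_def using nn by linarith+
      have "s * real (Suc m) \<le> real (Suc m)" using s by (intro mult_left_le_one_le) auto
      then have "real i \<le> real (Suc m)" using i(1) by linarith
      then have iK: "i \<in> {0..Suc m}" by (simp only: of_nat_le_iff atLeastAtMost_iff) simp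
      have "s - real i / real (Suc m) = (s * real (Suc m) - real i) / real (Suc m)"
        by (simp add: diff_divide_distrib)
      then have close: "\<bar>s - real i / real (Suc m)\<bar> \<le> 1 / real (Suc m)"
        using i by (simp add: divide_right_mono)
      have tri: "dist a d < \<epsilon>" if "dist a b \<le> x" "dist b c < \<epsilon> / 4" "dist d c \<le> y" "x < \<epsilon> / 4" "y < \<epsilon> / 4"
        for a b c d :: complex and x y
        using that \<epsilon> dist_triangle[of a d b] dist_triangle[of b d c] by (simp add: dist_commute)
      show "dist (CLINT \<omega>|M. iexp (s * W n \<omega>)) (CLINT \<omega>|N. iexp (s * W' \<omega>)) < \<epsilon>"
      proof (rule tri)
        show "dist (CLINT \<omega>|M. iexp (s * W n \<omega>)) (CLINT \<omega>|M. iexp (real i / real (Suc m) * W n \<omega>)) \<le> (\<integral>\<omega>. ?D (W n \<omega>) \<partial>M)"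
          unfolding dist_norm by (rule M.norm_char_diff_le[OF W(1) close])
        show "dist (CLINT \<omega>|N. iexp (s * W' \<omega>)) (CLINT \<omega>|N. iexp (real i / real (Suc m) * W' \<omega>)) \<le> (\<integral>\<omega>. ?D (W' \<omega>) \<partial>N)"
          unfolding dist_norm by (rule N.norm_char_diff_le[OF W(2) close])
        show "dist (CLINT \<omega>|M. iexp (real i / real (Suc m) * W n \<omega>)) (CLINT \<omega>|N. iexp (real i / real (Suc m) * W' \<omega>)) < \<epsilon> / 4"
          using elim(2) iK by blast
      qed (use elim(1) m in simp_all)
    qed
  qed
qed

section \<open>Centred random walks\<close>

definition centred_walk :: "(nat \<Rightarrow> 'w \<Rightarrow> 'b::real_vector) \<Rightarrow> 'b \<Rightarrow> nat \<Rightarrow> 'w \<Rightarrow> 'b" where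
  "centred_walk Y \<mu> k \<omega> = random_walk Y k \<omega> - real k *\<^sub>R \<mu>"

lemma centred_walk_eq_sum: "centred_walk Y \<mu> k \<omega> = (\<Sum>i=1..k. Y i \<omega> - \<mu>)"
  by (simp add: centred_walk_def random_walk_def sum_subtractf sum_constant_scaleR)

lemma centred_walk_0 [simp]: "centred_walk Y \<mu> 0 \<omega> = 0"
  by (simp add: centred_walk_def random_walk_def)

lemma centred_walk_diff:
  assumes "j \<le> k"
  shows "centred_walk Y \<mu> k \<omega> - centred_walk Y \<mu> j \<omega> = (\<Sum>i=Suc j..k. Y i \<omega> - \<mu>)"
proof -
  have "{1..k} = {1..j} \<union> {Suc j..k}" using assms by auto
  then have "(\<Sum>i=1..k. Y i \<omega> - \<mu>) = (\<Sum>i=1..j. Y i \<omega> - \<mu>) + (\<Sum>i=Suc j..k. Y i \<omega> - \<mu>)"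
    by (simp add: sum.union_disjoint)
  then show ?thesis by (simp add: centred_walk_eq_sum)
qed

lemma iid_steps_measurable:
  assumes "prob_space M" "iid_steps M Y" "i \<ge> 1"
  shows "Y i \<in> borel_measurable M"
proof -
  have "prob_space.indep_vars M (\<lambda>_. borel) Y {1..}" using assms(2) by (simp add: iid_steps_def)
  then show ?thesis unfolding prob_space.indep_vars_def2[OF assms(1)] using assms(3) by auto
qed

lemma random_walk_measurable:
  fixes Y :: "nat \<Rightarrow> 'w \<Rightarrow> 'b::euclidean_space"
  assumes "prob_space M" "iid_steps M Y"
  shows "random_walk Y k \<in> borel_measurable M" "centred_walk Y \<mu> k \<in> borel_measurable M"
proof -
  have [measurable]: "Y i \<in> borel_measurable M" if "i \<in> {1..k}" for i
    using iid_steps_measurable[OF assms] that by auto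
  show rw [measurable]: "random_walk Y k \<in> borel_measurable M"
    unfolding random_walk_def[abs_def] by (intro borel_measurable_sum) simp
  show "centred_walk Y \<mu> k \<in> borel_measurable M"
    unfolding centred_walk_def[abs_def] by measurable
qed

lemma iid_steps_integral:
  fixes Y :: "nat \<Rightarrow> 'w \<Rightarrow> 'b::euclidean_space" and f :: "'b \<Rightarrow> 'c::{banach, second_countable_topology}"
  assumes "prob_space M" "iid_steps M Y" "i \<ge> 1" and [measurable]: "f \<in> borel_measurable borel"
  shows "(\<integral>\<omega>. f (Y i \<omega>) \<partial>M) = (\<integral>\<omega>. f (Y 1 \<omega>) \<partial>M)"
proof -
  have Y: "Y i \<in> borel_measurable M" "Y 1 \<in> borel_measurable M"
    using iid_steps_measurable[OF assms(1,2)] assms(3) by auto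
  have "(\<integral>\<omega>. f (Y i \<omega>) \<partial>M) = integral\<^sup>L (distr M borel (Y i)) f"
    by (rule integral_distr[OF Y(1) assms(4), symmetric])
  also have "distr M borel (Y i) = distr M borel (Y 1)"
    using assms(2,3) unfolding iid_steps_def by blast
  also have "integral\<^sup>L (distr M borel (Y 1)) f = (\<integral>\<omega>. f (Y 1 \<omega>) \<partial>M)"
    by (rule integral_distr[OF Y(2) assms(4)])
  finally show ?thesis .
qed

text \<open>The normalisation is carried by the frequency \<open>v\<close>, so that one function
  describes the steps for every \<open>n\<close>.\<close>

definition step_char :: "'w measure \<Rightarrow> (nat \<Rightarrow> 'w \<Rightarrow> 'b::euclidean_space) \<Rightarrow> 'b \<Rightarrow> 'b \<Rightarrow> complex" where
  "step_char M Y \<mu> v = (CLINT \<omega>|M. iexp (v \<bullet> (Y 1 \<omega> - \<mu>)))"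

lemma (in prob_space) indep_vars_iexp_sum:
  fixes W :: "'i \<Rightarrow> 'a \<Rightarrow> 'b::euclidean_space"
  assumes "finite I" and ind: "indep_vars (\<lambda>_. borel) W I"
  shows "(CLINT \<omega>|M. iexp (\<Sum>i\<in>I. v i \<bullet> W i \<omega>)) = (\<Prod>i\<in>I. CLINT \<omega>|M. iexp (v i \<bullet> W i \<omega>))"
proof -
  have W: "W i \<in> borel_measurable M" if "i \<in> I" for i
    using ind that by (auto simp: indep_vars_def2)
  have "(CLINT \<omega>|M. iexp (\<Sum>i\<in>I. v i \<bullet> W i \<omega>)) = (CLINT \<omega>|M. (\<Prod>i\<in>I. iexp (v i \<bullet> W i \<omega>)))"
    using assms(1) by (simp add: exp_sum[symmetric] sum_distrib_left)
  also have "\<dots> = (\<Prod>i\<in>I. CLINT \<omega>|M. iexp (v i \<bullet> W i \<omega>))"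
  proof (rule indep_vars_lebesgue_integral[OF assms(1)])
    show "indep_vars (\<lambda>_. borel) (\<lambda>i \<omega>. iexp (v i \<bullet> W i \<omega>)) I"
      by (rule indep_vars_compose2[OF ind]) measurable
    show "integrable M (\<lambda>\<omega>. iexp (v i \<bullet> W i \<omega>))" if "i \<in> I" for i
      using W[OF that] by (intro integrable_iexp_borel[of "\<lambda>\<omega>. v i \<bullet> W i \<omega>"]) simp
  qed
  finally show ?thesis .
qed

lemma iid_steps_char:
  fixes Y :: "nat \<Rightarrow> 'w \<Rightarrow> 'b::euclidean_space"
  assumes "prob_space M" "iid_steps M Y"
  shows "(CLINT \<omega>|M. iexp (\<Sum>i=1..n. v i \<bullet> (Y i \<omega> - \<mu>))) = (\<Prod>i=1..n. step_char M Y \<mu> (v i))"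
proof -
  interpret prob_space M by fact
  have "indep_vars (\<lambda>_. borel) Y {1..n}"
    using assms(2) by (auto simp: iid_steps_def intro: indep_vars_subset)
  then have "indep_vars (\<lambda>_. borel) (\<lambda>i \<omega>. Y i \<omega> - \<mu>) {1..n}"
    by (rule indep_vars_compose2) measurable
  then have "(CLINT \<omega>|M. iexp (\<Sum>i=1..n. v i \<bullet> (Y i \<omega> - \<mu>))) = (\<Prod>i=1..n. CLINT \<omega>|M. iexp (v i \<bullet> (Y i \<omega> - \<mu>)))"
    by (intro indep_vars_iexp_sum) auto
  also have "\<dots> = (\<Prod>i=1..n. step_char M Y \<mu> (v i))"
    unfolding step_char_def
    by (intro prod.cong refl iid_steps_integral[OF assms, where f="\<lambda>y. iexp (_ \<bullet> (y - \<mu>))"]) auto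
  finally show ?thesis .
qed

lemma centred_walk_char:
  fixes Y :: "nat \<Rightarrow> 'w \<Rightarrow> 'b::euclidean_space"
  assumes "prob_space M" "iid_steps M Y"
  shows "(CLINT \<omega>|M. iexp (v \<bullet> centred_walk Y \<mu> k \<omega>)) = step_char M Y \<mu> v ^ k"
  using iid_steps_char[OF assms, where n = k and v = "\<lambda>_. v" and \<mu> = \<mu>]
  by (simp add: centred_walk_eq_sum inner_sum_right)

lemma centred_walk_diff_char:
  fixes Y :: "nat \<Rightarrow> 'w \<Rightarrow> 'b::euclidean_space"
  assumes "prob_space M" "iid_steps M Y" "j \<le> l"
  shows "(CLINT \<omega>|M. iexp (v \<bullet> (centred_walk Y \<mu> l \<omega> - centred_walk Y \<mu> j \<omega>))) = step_char M Y \<mu> v ^ (l - j)"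
proof -
  interpret prob_space M by fact
  \<comment> \<open>Frequency 0 switches off the first \<open>j\<close> steps and reduces the
    increment to \<open>iid_steps_char\<close>.\<close>
  define w where "w = (\<lambda>i. if i \<le> j then 0 else v)"
  have "v \<bullet> (centred_walk Y \<mu> l \<omega> - centred_walk Y \<mu> j \<omega>) = (\<Sum>i=1..l. w i \<bullet> (Y i \<omega> - \<mu>))" for \<omega>
  proof -
    have "(\<Sum>i=1..l. w i \<bullet> (Y i \<omega> - \<mu>)) = (\<Sum>i=Suc j..l. v \<bullet> (Y i \<omega> - \<mu>))"
      by (rule sum.mono_neutral_cong_right) (auto simp: w_def)
    then show ?thesis by (simp add: centred_walk_diff[OF assms(3)] inner_sum_right)
  qed
  then have "(CLINT \<omega>|M. iexp (v \<bullet> (centred_walk Y \<mu> l \<omega> - centred_walk Y \<mu> j \<omega>))) = (\<Prod>i=1..l. step_char M Y \<mu> (w i))"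
    by (simp only: iid_steps_char[OF assms(1,2)])
  also have "\<dots> = (\<Prod>i=Suc j..l. step_char M Y \<mu> v)"
    by (rule prod.mono_neutral_cong_right) (auto simp: w_def step_char_def prob_space)
  finally show ?thesis using assms(3) by (simp add: Suc_diff_le)
qed

text \<open>The argument runs along the segment from 0 to \<open>u\<close>, since the branch of the
  logarithm is pinned down by \<open>g 0 = 0\<close> and continuity. The same \<open>g\<close> will
  describe the increments of the limit process, which is why it is exported together with its
  defining properties.\<close>

theorem walk_direction:
  fixes Y :: "nat \<Rightarrow> 'w \<Rightarrow> 'b::euclidean_space" and W' :: "'v \<Rightarrow> real"
  assumes M: "prob_space M" and N: "prob_space N" and iid: "iid_steps M Y"
    and conv: "conv_in_distr M (\<lambda>n \<omega>. u \<bullet> ((1 / b n) *\<^sub>R centred_walk Y \<mu> n \<omega>)) N W'"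
    and nz: "\<And>s. s \<in> {0..1} \<Longrightarrow> (CLINT \<omega>|N. iexp (s * W' \<omega>)) \<noteq> 0"
  shows "\<exists>g. continuous_on {0..1} g \<and> g 0 = 0 \<and> (\<forall>s\<in>{0..1}. exp (g s) = (CLINT \<omega>|N. iexp (s * W' \<omega>))) \<and>
    (\<forall>k \<theta>. (\<lambda>n. real (k n) / real n) \<longlonglongrightarrow> \<theta> \<longrightarrow>
       (\<lambda>n. step_char M Y \<mu> ((1 / b n) *\<^sub>R u) ^ k n) \<longlonglongrightarrow> exp (of_real \<theta> * g 1)) \<and>
    (\<exists>C\<ge>0. \<forall>\<^sub>F n in sequentially. \<forall>j l. j \<le> l \<longrightarrow> l \<le> n \<longrightarrow>
       measure M {\<omega>\<in>space M. \<bar>u \<bullet> ((1 / b n) *\<^sub>R (centred_walk Y \<mu> l \<omega> - centred_walk Y \<mu> j \<omega>))\<bar> \<ge> 2} \<le> C * (real (l - j) / real n))"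
proof -
  interpret M: prob_space M by fact
  interpret N: prob_space N by fact
  have [measurable]: "centred_walk Y \<mu> k \<in> borel_measurable M" for k
    by (rule random_walk_measurable[OF M iid])
  have [measurable]: "Y 1 \<in> borel_measurable M" using iid_steps_measurable[OF M iid] by simp
  have W' [measurable]: "W' \<in> borel_measurable N" using conv by (simp add: conv_in_distr_def)
  define \<phi> where "\<phi> = (\<lambda>s. CLINT \<omega>|N. iexp (s * W' \<omega>))"
  obtain g0 where g0: "continuous_on {0..1} g0" "\<And>s. s \<in> {0..1} \<Longrightarrow> \<phi> s = exp (g0 s)"
    using continuous_logarithm_on_contractible[OF N.continuous_on_char[OF W', of "{0..1}"]
        convex_imp_contractible[of "{0..1::real}"]] nz by (auto simp: \<phi>_def)
  \<comment> \<open>The exponential is unchanged, because \<open>exp (g0 0)\<close> is the value 1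
    of the characteristic function at 0.\<close>
  define g where "g = (\<lambda>s. g0 s - g0 0)"
  have "\<phi> 0 = 1" by (simp add: \<phi>_def N.prob_space)
  then have e0: "exp (g0 0) = 1" using g0(2)[of 0] by simp
  have g: "continuous_on {0..1} g" "g 0 = 0" "\<And>s. s \<in> {0..1} \<Longrightarrow> exp (g s) = \<phi> s"
    using g0 e0 by (auto simp: g_def exp_diff intro!: continuous_intros)
  define f where "f = (\<lambda>n s. step_char M Y \<mu> ((s / b n) *\<^sub>R u))"
  have f_char: "f n s ^ k = (CLINT \<omega>|M. iexp (s * (u \<bullet> ((1 / b n) *\<^sub>R centred_walk Y \<mu> k \<omega>))))" for n s k
    using centred_walk_char[OF M iid, of "(s / b n) *\<^sub>R u" \<mu> k] by (simp add: f_def)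
  have f1: "f n s = (CLINT \<omega>|M. iexp (s * ((1 / b n) *\<^sub>R u \<bullet> (Y 1 \<omega> - \<mu>))))" for n s
    by (simp add: f_def step_char_def)
  have f_cont: "continuous_on {0..1} (f n)" for n
    unfolding f1 by (rule M.continuous_on_char) measurable
  have f0: "f n 0 = 1" for n by (simp add: f1 M.prob_space)
  have "uniform_limit {0..1} (\<lambda>n s. f n s ^ n) \<phi> sequentially"
    unfolding f_char \<phi>_def by (rule conv_in_distr_char_uniform[OF M N conv])
  then have "uniform_limit {0..1} (\<lambda>n s. f n s ^ n) (\<lambda>s. exp (g s)) sequentially"
    by (rule uniform_limit_cong'[THEN iffD1, rotated 2]) (auto simp: g(3))
  then obtain h where h: "\<forall>\<^sub>F n in sequentially. \<forall>s\<in>{0..1}. f n s = exp (h n s / of_nat n)"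
    "uniform_limit {0..1} h g sequentially"
    using power_exp_uniform_limit_root[where f = f, OF f_cont f0 g(1,2)] by blast
  have "(\<lambda>n. step_char M Y \<mu> ((1 / b n) *\<^sub>R u) ^ k n) \<longlonglongrightarrow> exp (of_real \<theta> * g 1)"
    if "(\<lambda>n. real (k n) / real n) \<longlonglongrightarrow> \<theta>" for k \<theta>
    using power_fraction_tendsto[OF h that, of 1] by (simp add: f_def)
  moreover obtain C where C: "C \<ge> 0" "\<forall>\<^sub>F n in sequentially. \<forall>k\<le>n. \<forall>s\<in>{0..1}. norm (1 - f n s ^ k) \<le> C * (real k / real n)"
    using power_minus_one_le[OF h g(1)] by blast
  have f_char_diff: "f n s ^ (l - j) = (CLINT \<omega>|M. iexp (s * (u \<bullet> ((1 / b n) *\<^sub>R (centred_walk Y \<mu> l \<omega> - centred_walk Y \<mu> j \<omega>)))))"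
    if "j \<le> l" for n s j l
    using centred_walk_diff_char[OF M iid that, of "(s / b n) *\<^sub>R u" \<mu>] by (simp add: f_def)
  have "\<forall>\<^sub>F n in sequentially. \<forall>j l. j \<le> l \<longrightarrow> l \<le> n \<longrightarrow>
       measure M {\<omega>\<in>space M. \<bar>u \<bullet> ((1 / b n) *\<^sub>R (centred_walk Y \<mu> l \<omega> - centred_walk Y \<mu> j \<omega>))\<bar> \<ge> 2} \<le> (2 * C) * (real (l - j) / real n)"
    using C(2)
  proof eventually_elim
    case (elim n)
    show ?case
    proof (intro allI impI)
      fix j l assume jl: "j \<le> l" "l \<le> n"
      have "M.prob {\<omega> \<in> space M. 2 \<le> \<bar>u \<bullet> ((1 / b n) *\<^sub>R (centred_walk Y \<mu> l \<omega> - centred_walk Y \<mu> j \<omega>))\<bar>} \<le> 2 * (C * (real (l - j) / real n))"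
      proof (rule M.tail_bound_char)
        have "l - j \<le> n" using jl by simp
        fix s :: real assume "s \<in> {0..1}"
        then show "norm (1 - (CLINT \<omega>|M. iexp (s * (u \<bullet> ((1 / b n) *\<^sub>R (centred_walk Y \<mu> l \<omega> - centred_walk Y \<mu> j \<omega>)))))) \<le> C * (real (l - j) / real n)"
          unfolding f_char_diff[OF jl(1), symmetric] using elim \<open>l - j \<le> n\<close> by blast
      qed measurable
      then show "M.prob {\<omega> \<in> space M. 2 \<le> \<bar>u \<bullet> ((1 / b n) *\<^sub>R (centred_walk Y \<mu> l \<omega> - centred_walk Y \<mu> j \<omega>))\<bar>} \<le> 2 * C * (real (l - j) / real n)"
        by simp
    qed
  qed
  ultimately show ?thesis
    using g C(1) unfolding \<phi>_def by (intro exI[of _ g] conjI allI impI exI[of _ "2 * C"]) auto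
qed

text \<open>A vector of norm at least \<epsilon> has a coordinate of modulus at least
  \<open>\<epsilon> / DIM('b)\<close>; the factor \<open>2 * DIM('b) / \<epsilon>\<close> lifts it
  to the threshold 2 of \<open>tail_bound_char\<close>.\<close>

lemma (in prob_space) norm_tail_le_sum_directions:
  fixes V :: "'a \<Rightarrow> 'b::euclidean_space"
  assumes [measurable]: "V \<in> borel_measurable M" and \<epsilon>: "\<epsilon> > 0"
  shows "prob {\<omega>\<in>space M. norm (V \<omega>) \<ge> \<epsilon>} \<le> (\<Sum>i\<in>Basis. prob {\<omega>\<in>space M. \<bar>((2 * DIM('b) / \<epsilon>) *\<^sub>R i) \<bullet> V \<omega>\<bar> \<ge> 2})"
proof -
  define u where "u = (\<lambda>i::'b. (2 * DIM('b) / \<epsilon>) *\<^sub>R i)"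
  have "\<exists>i\<in>Basis. \<bar>u i \<bullet> x\<bar> \<ge> 2" if "norm x \<ge> \<epsilon>" for x :: 'b
  proof (rule ccontr)
    assume *: "\<not> ?thesis"
    have "\<bar>x \<bullet> i\<bar> < \<epsilon> / DIM('b)" if "i \<in> Basis" for i
    proof -
      have "(2 * DIM('b) / \<epsilon>) * \<bar>x \<bullet> i\<bar> < 2"
        using * that \<epsilon> by (force simp: u_def inner_commute abs_mult not_le)
      then show ?thesis using \<epsilon> by (simp add: field_simps)
    qed
    then have "(\<Sum>i\<in>Basis. \<bar>x \<bullet> i\<bar>) < (\<Sum>i\<in>(Basis::'b set). \<epsilon> / DIM('b))"
      by (intro sum_strict_mono) auto
    also have "\<dots> = \<epsilon>" by simp
    finally show False using norm_le_l1[of x] that by linarith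
  qed
  then have "prob {\<omega>\<in>space M. norm (V \<omega>) \<ge> \<epsilon>} \<le> prob (\<Union>i\<in>Basis. {\<omega>\<in>space M. \<bar>u i \<bullet> V \<omega>\<bar> \<ge> 2})"
    by (intro finite_measure_mono subsetI) (auto intro!: sets.finite_UN)
  also have "\<dots> \<le> (\<Sum>i\<in>Basis. prob {\<omega>\<in>space M. \<bar>u i \<bullet> V \<omega>\<bar> \<ge> 2})"
    by (intro finite_measure_subadditive_finite) auto
  finally show ?thesis by (simp add: u_def)
qed

theorem walk_tail:
  fixes Y :: "nat \<Rightarrow> 'w \<Rightarrow> 'b::euclidean_space" and X' :: "'v \<Rightarrow> 'b"
  assumes M: "prob_space M" and N: "prob_space N" and iid: "iid_steps M Y"
    and conv: "conv_in_distr M (\<lambda>n \<omega>. (1 / b n) *\<^sub>R centred_walk Y \<mu> n \<omega>) N X'"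
    and nz: "\<And>u. (CLINT \<omega>|N. iexp (u \<bullet> X' \<omega>)) \<noteq> 0" and \<epsilon>: "\<epsilon> > 0"
  shows "\<exists>C\<ge>0. \<forall>\<^sub>F n in sequentially. \<forall>j l. j \<le> l \<longrightarrow> l \<le> n \<longrightarrow>
    measure M {\<omega>\<in>space M. norm ((1 / b n) *\<^sub>R (centred_walk Y \<mu> l \<omega> - centred_walk Y \<mu> j \<omega>)) \<ge> \<epsilon>} \<le> C * (real (l - j) / real n)"
proof -
  interpret M: prob_space M by fact
  have [measurable]: "centred_walk Y \<mu> k \<in> borel_measurable M" for k
    by (rule random_walk_measurable[OF M iid])
  define u where "u = (\<lambda>i::'b. (2 * DIM('b) / \<epsilon>) *\<^sub>R i)"
  define P where "P = (\<lambda>i C. C \<ge> 0 \<and> (\<forall>\<^sub>F n in sequentially. \<forall>j l. j \<le> l \<longrightarrow> l \<le> n \<longrightarrow>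
       measure M {\<omega>\<in>space M. \<bar>u i \<bullet> ((1 / b n) *\<^sub>R (centred_walk Y \<mu> l \<omega> - centred_walk Y \<mu> j \<omega>))\<bar> \<ge> 2} \<le> C * (real (l - j) / real n)))"
  have "\<exists>C. P i C" for i
  proof -
    have 1: "conv_in_distr M (\<lambda>n \<omega>. u i \<bullet> ((1 / b n) *\<^sub>R centred_walk Y \<mu> n \<omega>)) N (\<lambda>\<omega>. u i \<bullet> X' \<omega>)"
      by (rule conv_in_distr_continuous_map[OF conv]) (intro continuous_intros)
    have 2: "(CLINT \<omega>|N. iexp (s * (u i \<bullet> X' \<omega>))) \<noteq> 0" for s
      using nz[of "s *\<^sub>R u i"] by simp
    show ?thesis unfolding P_def using walk_direction[OF M N iid 1 2] by blast
  qed
  then obtain C where "\<And>i. P i (C i)" by metis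
  then have C: "\<And>i. C i \<ge> 0" "\<And>i. \<forall>\<^sub>F n in sequentially. \<forall>j l. j \<le> l \<longrightarrow> l \<le> n \<longrightarrow>
       measure M {\<omega>\<in>space M. \<bar>u i \<bullet> ((1 / b n) *\<^sub>R (centred_walk Y \<mu> l \<omega> - centred_walk Y \<mu> j \<omega>))\<bar> \<ge> 2} \<le> C i * (real (l - j) / real n)"
    unfolding P_def by blast+
  have "\<forall>\<^sub>F n in sequentially. \<forall>i\<in>(Basis::'b set). \<forall>j l. j \<le> l \<longrightarrow> l \<le> n \<longrightarrow>
       measure M {\<omega>\<in>space M. \<bar>u i \<bullet> ((1 / b n) *\<^sub>R (centred_walk Y \<mu> l \<omega> - centred_walk Y \<mu> j \<omega>))\<bar> \<ge> 2} \<le> C i * (real (l - j) / real n)"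
    using C(2) by (intro eventually_ball_finite) auto
  then have "\<forall>\<^sub>F n in sequentially. \<forall>j l. j \<le> l \<longrightarrow> l \<le> n \<longrightarrow>
    measure M {\<omega>\<in>space M. norm ((1 / b n) *\<^sub>R (centred_walk Y \<mu> l \<omega> - centred_walk Y \<mu> j \<omega>)) \<ge> \<epsilon>} \<le> (\<Sum>i\<in>Basis. C i) * (real (l - j) / real n)"
  proof eventually_elim
    case (elim n)
    show ?case
    proof (intro allI impI)
      fix j l assume jl: "j \<le> l" "l \<le> n"
      have "measure M {\<omega>\<in>space M. norm ((1 / b n) *\<^sub>R (centred_walk Y \<mu> l \<omega> - centred_walk Y \<mu> j \<omega>)) \<ge> \<epsilon>}
        \<le> (\<Sum>i\<in>Basis. measure M {\<omega>\<in>space M. \<bar>u i \<bullet> ((1 / b n) *\<^sub>R (centred_walk Y \<mu> l \<omega> - centred_walk Y \<mu> j \<omega>))\<bar> \<ge> 2})"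
        unfolding u_def by (rule M.norm_tail_le_sum_directions) (use \<epsilon> in measurable)
      also have "\<dots> \<le> (\<Sum>i\<in>Basis. C i * (real (l - j) / real n))"
        using elim jl by (intro sum_mono) auto
      finally show "measure M {\<omega>\<in>space M. norm ((1 / b n) *\<^sub>R (centred_walk Y \<mu> l \<omega> - centred_walk Y \<mu> j \<omega>)) \<ge> \<epsilon>} \<le> (\<Sum>i\<in>Basis. C i) * (real (l - j) / real n)"
        unfolding sum_distrib_right .
    qed
  qed
  then show ?thesis
    using C(1) by (intro exI[of _ "\<Sum>i\<in>Basis. C i"]) (auto intro: sum_nonneg)
qed

section \<open>Increments over a time grid\<close>

definition grid_incr :: "(real \<Rightarrow> 'v \<Rightarrow> 'b::real_vector) \<Rightarrow> nat \<Rightarrow> nat \<Rightarrow> 'v \<Rightarrow> 'b" where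
  "grid_incr X K j \<omega> = X (real (Suc j) / real K) \<omega> - X (real j / real K) \<omega>"

text \<open>The increment over the first cell stands for all of them. \<open>X 0\<close> is
  subtracted as it vanishes only almost surely.\<close>

definition grid_char :: "'v measure \<Rightarrow> (real \<Rightarrow> 'v \<Rightarrow> 'b::euclidean_space) \<Rightarrow> nat \<Rightarrow> 'b \<Rightarrow> complex" where
  "grid_char N X K v = (CLINT \<omega>|N. iexp (v \<bullet> (X (1 / real K) \<omega> - X 0 \<omega>)))"

lemma levy_process_measurable:
  "levy_process N X \<Longrightarrow> t \<ge> 0 \<Longrightarrow> X t \<in> borel_measurable N"
  by (simp add: levy_process_def)

lemma grid_incr_measurable:
  fixes X :: "real \<Rightarrow> 'v \<Rightarrow> 'b::euclidean_space"
  assumes "levy_process N X"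
  shows "grid_incr X K j \<in> borel_measurable N"
  unfolding grid_incr_def[abs_def]
  by (intro borel_measurable_diff levy_process_measurable[OF assms]) auto

lemma grid_incr_char:
  fixes X :: "real \<Rightarrow> 'v \<Rightarrow> 'b::euclidean_space"
  assumes levy: "levy_process N X" and K: "K \<ge> 1"
  shows "(CLINT \<omega>|N. iexp (\<Sum>j<K. v j \<bullet> grid_incr X K j \<omega>)) = (\<Prod>j<K. grid_char N X K (v j))"
proof -
  interpret N: prob_space N using levy by (simp add: levy_process_def)
  note X [measurable] = levy_process_measurable[OF levy]
  have "N.indep_vars (\<lambda>_. borel) (\<lambda>i \<omega>. X (real (Suc i) / real K) \<omega> - X (real i / real K) \<omega>) {..<K}"
    using levy K unfolding levy_process_def by (auto simp: divide_strict_right_mono dest!: spec[of _ "\<lambda>i. real i / real K"])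
  then have "N.indep_vars (\<lambda>_. borel) (grid_incr X K) {..<K}"
    by (simp add: grid_incr_def[abs_def])
  then have "(CLINT \<omega>|N. iexp (\<Sum>j<K. v j \<bullet> grid_incr X K j \<omega>)) = (\<Prod>j<K. CLINT \<omega>|N. iexp (v j \<bullet> grid_incr X K j \<omega>))"
    by (intro N.indep_vars_iexp_sum) auto
  also have "\<dots> = (\<Prod>j<K. grid_char N X K (v j))"
  proof (rule prod.cong[OF refl])
    fix j
    let ?f = "\<lambda>x. iexp (v j \<bullet> x)"
    have eq: "distr N borel (grid_incr X K j) = distr N borel (\<lambda>\<omega>. X (1 / real K) \<omega> - X 0 \<omega>)"
    proof -
      have "\<forall>s\<ge>0. \<forall>h\<ge>0. distr N borel (\<lambda>\<omega>. X (s + h) \<omega> - X s \<omega>) = distr N borel (\<lambda>\<omega>. X h \<omega> - X 0 \<omega>)"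
        using levy by (simp add: levy_process_def)
      then have "distr N borel (\<lambda>\<omega>. X (real j / real K + 1 / real K) \<omega> - X (real j / real K) \<omega>)
          = distr N borel (\<lambda>\<omega>. X (1 / real K) \<omega> - X 0 \<omega>)"
        by (metis divide_nonneg_nonneg of_nat_0_le_iff zero_le_one)
      moreover have "real j / real K + 1 / real K = real (Suc j) / real K"
        by (simp add: add_divide_distrib add.commute)
      ultimately show ?thesis by (simp add: grid_incr_def[abs_def])
    qed
    have m: "?f \<in> borel_measurable borel" by measurable
    have m': "(\<lambda>\<omega>. X (1 / real K) \<omega> - X 0 \<omega>) \<in> borel_measurable N" by measurable
    have "(CLINT \<omega>|N. iexp (v j \<bullet> grid_incr X K j \<omega>)) = integral\<^sup>L (distr N borel (grid_incr X K j)) ?f"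
      by (rule integral_distr[OF grid_incr_measurable[OF levy] m, symmetric])
    also have "\<dots> = grid_char N X K (v j)"
      unfolding eq grid_char_def by (rule integral_distr[OF m' m])
    finally show "(CLINT \<omega>|N. iexp (v j \<bullet> grid_incr X K j \<omega>)) = grid_char N X K (v j)" .
  qed
  finally show ?thesis .
qed

lemma sum_grid_incr:
  fixes X :: "real \<Rightarrow> 'v \<Rightarrow> 'b::real_vector"
  shows "(\<Sum>l<j. grid_incr X K l \<omega>) = X (real j / real K) \<omega> - X 0 \<omega>"
  by (induction j) (simp_all add: grid_incr_def)

lemma grid_char_power:
  fixes X :: "real \<Rightarrow> 'v \<Rightarrow> 'b::euclidean_space"
  assumes levy: "levy_process N X" and K: "K \<ge> 1"
  shows "grid_char N X K v ^ K = (CLINT \<omega>|N. iexp (v \<bullet> X 1 \<omega>))"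
proof -
  note X [measurable] = levy_process_measurable[OF levy]
  have [measurable]: "X 0 \<in> borel_measurable N" "X 1 \<in> borel_measurable N" by (auto intro: X)
  have "grid_char N X K v ^ K = (CLINT \<omega>|N. iexp (\<Sum>j<K. v \<bullet> grid_incr X K j \<omega>))"
    by (subst grid_incr_char[OF levy K]) simp
  also have "\<dots> = (CLINT \<omega>|N. iexp (v \<bullet> (X 1 \<omega> - X 0 \<omega>)))"
    using K by (simp add: inner_sum_right[symmetric] sum_grid_incr)
  also have "\<dots> = (CLINT \<omega>|N. iexp (v \<bullet> X 1 \<omega>))"
  proof (rule integral_cong_AE)
    have "AE \<omega> in N. X 0 \<omega> = 0" using levy by (simp add: levy_process_def)
    then show "AE \<omega> in N. iexp (v \<bullet> (X 1 \<omega> - X 0 \<omega>)) = iexp (v \<bullet> X 1 \<omega>)" by eventually_elim simp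
  qed measurable
  finally show ?thesis .
qed

lemma grid_char_tendsto_1:
  fixes X :: "real \<Rightarrow> 'v \<Rightarrow> 'b::euclidean_space"
  assumes levy: "levy_process N X"
  shows "(\<lambda>K. grid_char N X K v) \<longlonglongrightarrow> 1"
proof (rule LIMSEQ_I)
  interpret N: prob_space N using levy by (simp add: levy_process_def)
  note X = levy_process_measurable[OF levy]
  fix r :: real assume r: "r > 0"
  \<comment> \<open>Off the exceptional event the inner product with \<open>v\<close> is then at
    most \<open>r / 4\<close>; the event itself costs less than \<open>2 * (r / 4)\<close>. The
    added 1 covers \<open>v = 0\<close>.\<close>
  define c where "c = r / (4 * (norm v + 1))"
  have nv: "norm v + 1 > 0" by (simp add: add_nonneg_pos)
  then have c: "c > 0" using r by (simp add: c_def)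
  have "((\<lambda>s. measure N {\<omega> \<in> space N. norm (X s \<omega> - X 0 \<omega>) > c}) \<longlongrightarrow> 0) (at 0 within {0..})"
    using levy c by (simp add: levy_process_def)
  \<comment> \<open>The index \<open>Suc K\<close> keeps the argument away from 0, which the filter
    excludes; \<open>1 / real 0\<close> would be 0.\<close>
  moreover have "filterlim (\<lambda>K. 1 / real (Suc K)) (at 0 within {0..}) sequentially"
    unfolding filterlim_at using LIMSEQ_inverse_real_of_nat[unfolded inverse_eq_divide]
    by (auto intro!: always_eventually simp del: of_nat_Suc)
  ultimately have "(\<lambda>K. measure N {\<omega> \<in> space N. norm (X (1 / real (Suc K)) \<omega> - X 0 \<omega>) > c}) \<longlonglongrightarrow> 0"
    by (rule filterlim_compose)
  then have "(\<lambda>K. measure N {\<omega> \<in> space N. norm (X (1 / real K) \<omega> - X 0 \<omega>) > c}) \<longlonglongrightarrow> 0"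
    by (subst (asm) filterlim_sequentially_Suc)
  then have "eventually (\<lambda>K. measure N {\<omega> \<in> space N. norm (X (1 / real K) \<omega> - X 0 \<omega>) > c} < r / 4) sequentially"
    using r by (intro order_tendstoD(2)) auto
  then have "eventually (\<lambda>K. norm (grid_char N X K v - 1) < r) sequentially"
  proof eventually_elim
    case (elim K)
    define D where "D = (\<lambda>\<omega>. X (1 / real K) \<omega> - X 0 \<omega>)"
    have [measurable]: "D \<in> borel_measurable N"
      unfolding D_def by (intro borel_measurable_diff X) auto
    define B where "B = {\<omega>\<in>space N. norm (D \<omega>) > c}"
    have [measurable]: "B \<in> sets N" unfolding B_def by measurable
    have int: "integrable N (\<lambda>\<omega>. iexp (v \<bullet> D \<omega>))"
      by (rule N.integrable_iexp_borel[of "\<lambda>\<omega>. v \<bullet> D \<omega>"]) measurable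
    have "grid_char N X K v - 1 = (CLINT \<omega>|N. iexp (v \<bullet> D \<omega>) - 1)"
      using int by (simp add: grid_char_def D_def N.prob_space)
    also have "norm \<dots> \<le> (\<integral>\<omega>. norm (iexp (v \<bullet> D \<omega>) - 1) \<partial>N)"
      by (rule integral_norm_bound)
    also have "\<dots> \<le> (\<integral>\<omega>. r / 4 + 2 * indicator B \<omega> \<partial>N)"
    proof (rule integral_mono)
      show "integrable N (\<lambda>\<omega>. norm (iexp (v \<bullet> D \<omega>) - 1))"
        by (intro integrable_norm Bochner_Integration.integrable_diff int) simp
      show "integrable N (\<lambda>\<omega>. r / 4 + 2 * indicator B \<omega> :: real)"
        by (auto simp: N.emeasure_eq_measure)
      fix \<omega> assume \<omega>: "\<omega> \<in> space N"
      have *: "norm (iexp (v \<bullet> D \<omega>) - 1) \<le> min 2 \<bar>v \<bullet> D \<omega>\<bar>"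
        using norm_iexp_diff_le[of "v \<bullet> D \<omega>" 0] by simp
      show "norm (iexp (v \<bullet> D \<omega>) - 1) \<le> r / 4 + 2 * indicator B \<omega>"
      proof (cases "\<omega> \<in> B")
        case True
        then show ?thesis using * r by simp
      next
        case False
        then have "norm (D \<omega>) \<le> c" using \<omega> by (simp add: B_def)
        then have "\<bar>v \<bullet> D \<omega>\<bar> \<le> norm v * c"
          using Cauchy_Schwarz_ineq2[of v "D \<omega>"] mult_left_mono[OF \<open>norm (D \<omega>) \<le> c\<close> norm_ge_zero[of v]]
            by linarith
        also have "\<dots> \<le> (norm v + 1) * c" using c by simp
        also have "\<dots> = r / 4"
        proof -
          have "a * (r / (4 * a)) = r / 4" if "a > 0" for a :: real using that by simp
          from this[OF nv] show ?thesis by (simp only: c_def)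
        qed
        finally show ?thesis using * False by simp
      qed
    qed
    also have "\<dots> = r / 4 + 2 * N.prob B"
      by (subst Bochner_Integration.integral_add) (auto simp: N.prob_space N.emeasure_eq_measure)
    also have "\<dots> < r" using elim r by (simp add: B_def D_def)
    finally show ?case .
  qed
  then show "\<exists>no. \<forall>K\<ge>no. norm (grid_char N X K v - 1) < r"
    by (simp add: eventually_sequentially)
qed

text \<open>By independence and stationarity of the increments the value is the \<open>K\<close>-th
  power of \<open>grid_char\<close>, which tends to 1 by stochastic continuity.\<close>

lemma levy_char_nonzero:
  fixes X :: "real \<Rightarrow> 'v \<Rightarrow> 'b::euclidean_space"
  assumes levy: "levy_process N X"
  shows "(CLINT \<omega>|N. iexp (v \<bullet> X 1 \<omega>)) \<noteq> 0"
proof -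
  have "eventually (\<lambda>K. grid_char N X K v \<noteq> 0) sequentially"
    by (rule tendsto_imp_eventually_ne[OF grid_char_tendsto_1[OF levy]]) simp
  then have "eventually (\<lambda>K. grid_char N X K v \<noteq> 0 \<and> K \<ge> 1) sequentially"
    using eventually_ge_at_top[of 1] by eventually_elim simp
  then obtain K where K: "grid_char N X K v \<noteq> 0" "K \<ge> 1"
    using eventually_happens'[OF sequentially_bot] by blast
  then show ?thesis by (simp flip: grid_char_power[OF levy K(2), of v])
qed

text \<open>Along the segment from 0 to \<open>v\<close> the increment has as characteristic
  function a continuous \<open>K\<close>-th root of \<open>exp g\<close> with value 1 at 0, hence
  \<open>exp (g / K)\<close>. The blocks of the walk converge to the same branch, which identifies
  their limit.\<close>

lemma grid_char_eq_exp:
  fixes X :: "real \<Rightarrow> 'v \<Rightarrow> 'b::euclidean_space"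
  assumes levy: "levy_process N X" and K: "K \<ge> 1"
    and g: "continuous_on {0..1} g" "g 0 = 0" "\<forall>s\<in>{0..1}. exp (g s) = (CLINT \<omega>|N. iexp (s * (v \<bullet> X 1 \<omega>)))"
  shows "grid_char N X K v = exp (of_real (1 / real K) * g 1)"
proof -
  interpret N: prob_space N using levy by (simp add: levy_process_def)
  note X = levy_process_measurable[OF levy]
  define D where "D = (\<lambda>\<omega>. v \<bullet> (X (1 / real K) \<omega> - X 0 \<omega>))"
  have D: "D \<in> borel_measurable N"
    unfolding D_def by (intro borel_measurable_inner borel_measurable_diff borel_measurable_const X) auto
  define \<psi> where "\<psi> = (\<lambda>s. CLINT \<omega>|N. iexp (s * D \<omega>))"
  have \<psi>: "grid_char N X K (s *\<^sub>R v) = \<psi> s" for s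
    by (simp add: grid_char_def \<psi>_def D_def)
  define q where "q = (\<lambda>s. \<psi> s * exp (- (g s / of_nat K)))"
  have "q 1 = 1"
  proof (rule continuous_root_of_unity[of q K])
    show "continuous_on {0..1} q"
      unfolding q_def \<psi>_def using K by (intro continuous_intros N.continuous_on_char D g) auto
    show "q 0 = 1" by (simp add: q_def \<psi>_def N.prob_space g(2))
    fix s :: real assume s: "s \<in> {0..1}"
    have "q s ^ K = \<psi> s ^ K * exp (- g s)"
      using K by (simp add: q_def power_mult_distrib exp_of_nat_mult[symmetric])
    also have "\<psi> s ^ K = exp (g s)"
      using grid_char_power[OF levy K, of "s *\<^sub>R v"] g(3) s by (simp add: \<psi>)
    finally show "q s ^ K = 1" by (simp flip: exp_add)
  qed (use K in auto)
  then have "\<psi> 1 = exp (g 1 / of_nat K)"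
    by (simp add: q_def exp_minus field_simps)
  then show ?thesis using \<psi>[of 1] by simp
qed

text \<open>\<open>v\<close> repeats the frequency of a block on each of its steps, so that
  \<open>iid_steps_char\<close> applies to the whole family of blocks. Both identities sit under one
  existential because they must share \<open>v\<close>, which moreover may not depend on the
  outcome.\<close>

lemma block_sum_representation:
  fixes \<kappa> :: "nat \<Rightarrow> nat" and c :: "'b::euclidean_space \<Rightarrow> complex"
  assumes "\<kappa> 0 = 0" "mono \<kappa>"
  shows "\<exists>v. (\<forall>Y \<mu> \<omega>. (\<Sum>j<m. w j \<bullet> (centred_walk Y \<mu> (\<kappa> (Suc j)) \<omega> - centred_walk Y \<mu> (\<kappa> j) \<omega>))
       = (\<Sum>i=1..\<kappa> m. v i \<bullet> (Y i (\<omega>::'w) - \<mu>))) \<and>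
    (\<Prod>i=1..\<kappa> m. c (v i)) = (\<Prod>j<m. c (w j) ^ (\<kappa> (Suc j) - \<kappa> j))"
proof (induction m)
  case 0
  then show ?case using assms(1) by simp
next
  case (Suc m)
  then obtain v where v: "\<And>Y \<mu> (\<omega>::'w). (\<Sum>j<m. w j \<bullet> (centred_walk Y \<mu> (\<kappa> (Suc j)) \<omega> - centred_walk Y \<mu> (\<kappa> j) \<omega>))
       = (\<Sum>i=1..\<kappa> m. v i \<bullet> (Y i \<omega> - \<mu>))"
    "(\<Prod>i=1..\<kappa> m. c (v i)) = (\<Prod>j<m. c (w j) ^ (\<kappa> (Suc j) - \<kappa> j))" by blast
  define v' where "v' = (\<lambda>i. if i \<le> \<kappa> m then v i else w m)"
  have le: "\<kappa> m \<le> \<kappa> (Suc m)" using assms(2) by (simp add: monoD)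
  then have split: "{1..\<kappa> (Suc m)} = {1..\<kappa> m} \<union> {Suc (\<kappa> m)..\<kappa> (Suc m)}" by auto
  show ?case
  proof (intro exI[of _ v'] conjI allI)
    fix Y \<mu> and \<omega> :: 'w
    have "(\<Sum>i=1..\<kappa> (Suc m). v' i \<bullet> (Y i \<omega> - \<mu>)) = (\<Sum>i=1..\<kappa> m. v' i \<bullet> (Y i \<omega> - \<mu>)) + (\<Sum>i=Suc (\<kappa> m)..\<kappa> (Suc m). v' i \<bullet> (Y i \<omega> - \<mu>))"
      unfolding split by (rule sum.union_disjoint) auto
    also have "(\<Sum>i=1..\<kappa> m. v' i \<bullet> (Y i \<omega> - \<mu>)) = (\<Sum>i=1..\<kappa> m. v i \<bullet> (Y i \<omega> - \<mu>))"
      by (intro sum.cong) (auto simp: v'_def)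
    also have "(\<Sum>i=Suc (\<kappa> m)..\<kappa> (Suc m). v' i \<bullet> (Y i \<omega> - \<mu>)) = (\<Sum>i=Suc (\<kappa> m)..\<kappa> (Suc m). w m \<bullet> (Y i \<omega> - \<mu>))"
      by (intro sum.cong) (auto simp: v'_def)
    finally show "(\<Sum>j<Suc m. w j \<bullet> (centred_walk Y \<mu> (\<kappa> (Suc j)) \<omega> - centred_walk Y \<mu> (\<kappa> j) \<omega>))
       = (\<Sum>i=1..\<kappa> (Suc m). v' i \<bullet> (Y i \<omega> - \<mu>))"
      by (simp add: v(1) centred_walk_diff[OF le] inner_sum_right)
  next
    have "(\<Prod>i=1..\<kappa> (Suc m). c (v' i)) = (\<Prod>i=1..\<kappa> m. c (v' i)) * (\<Prod>i=Suc (\<kappa> m)..\<kappa> (Suc m). c (v' i))"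
      unfolding split by (rule prod.union_disjoint) auto
    also have "(\<Prod>i=1..\<kappa> m. c (v' i)) = (\<Prod>i=1..\<kappa> m. c (v i))"
      by (intro prod.cong) (auto simp: v'_def)
    also have "(\<Prod>i=Suc (\<kappa> m)..\<kappa> (Suc m). c (v' i)) = (\<Prod>i=Suc (\<kappa> m)..\<kappa> (Suc m). c (w m))"
      by (intro prod.cong) (auto simp: v'_def)
    finally show "(\<Prod>i=1..\<kappa> (Suc m). c (v' i)) = (\<Prod>j<Suc m. c (w j) ^ (\<kappa> (Suc j) - \<kappa> j))"
      unfolding v(2) using le by (simp add: Suc_diff_le)
  qed
qed

text \<open>The integer part of \<open>j * n / K\<close>. Multiplying before dividing makes the last
  index exactly \<open>n\<close> and each block length differ from \<open>n / K\<close> by less than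
  one.\<close>

definition grid_index :: "nat \<Rightarrow> nat \<Rightarrow> nat \<Rightarrow> nat" where
  "grid_index K n j = j * n div K"

lemma grid_index_0 [simp]: "grid_index K n 0 = 0"
  by (simp add: grid_index_def)

lemma grid_index_K [simp]: "K \<ge> 1 \<Longrightarrow> grid_index K n K = n"
  by (simp add: grid_index_def)

lemma mono_grid_index: "mono (grid_index K n)"
  unfolding grid_index_def by (intro monoI div_le_mono mult_le_mono1)

lemma grid_index_bounds:
  assumes "K \<ge> 1"
  shows "real (grid_index K n j) \<le> real j * real n / real K" "real j * real n / real K - 1 \<le> real (grid_index K n j)"
proof -
  have 1: "real (K * grid_index K n j) \<le> real (j * n)"
    unfolding grid_index_def of_nat_le_iff by (rule times_div_less_eq_dividend)
  have "j * n = K * grid_index K n j + j * n mod K"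
    by (simp add: grid_index_def)
  moreover have "j * n mod K \<le> K" using assms by (simp add: less_imp_le)
  ultimately have "j * n \<le> K * grid_index K n j + K" by linarith
  then have 2: "real (j * n) \<le> real (K * grid_index K n j + K)" by (simp only: of_nat_le_iff)
  show "real (grid_index K n j) \<le> real j * real n / real K" "real j * real n / real K - 1 \<le> real (grid_index K n j)"
    using 1 2 assms by (simp_all add: field_simps)
qed

lemma grid_index_limit:
  assumes K: "K \<ge> 1"
  shows "(\<lambda>n. real (grid_index K n j) / real n) \<longlonglongrightarrow> real j / real K"
proof (rule tendsto_sandwich)
  have "(\<lambda>n. real j / real K - 1 / real n) \<longlonglongrightarrow> real j / real K - 0"
    by (intro tendsto_diff tendsto_const lim_1_over_n)
  then show "(\<lambda>n. real j / real K - 1 / real n) \<longlonglongrightarrow> real j / real K" by simp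
  show "\<forall>\<^sub>F n in sequentially. real j / real K - 1 / real n \<le> real (grid_index K n j) / real n"
    using eventually_gt_at_top[of 0]
  proof eventually_elim
    case (elim n)
    have "(real j * real n / real K - 1) / real n \<le> real (grid_index K n j) / real n"
      using grid_index_bounds(2)[OF K, of j n] elim by (intro divide_right_mono) auto
    then show ?case using elim by (simp add: diff_divide_distrib)
  qed
  show "\<forall>\<^sub>F n in sequentially. real (grid_index K n j) / real n \<le> real j / real K"
    using eventually_gt_at_top[of 0]
  proof eventually_elim
    case (elim n)
    have "real (grid_index K n j) / real n \<le> (real j * real n / real K) / real n"
      using grid_index_bounds(1)[OF K, of n j] elim by (intro divide_right_mono) auto
    then show ?case using elim by simp
  qed
qed simp

lemma grid_index_gap_limit:
  assumes K: "K \<ge> 1"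
  shows "(\<lambda>n. real (grid_index K n (Suc j) - grid_index K n j) / real n) \<longlonglongrightarrow> 1 / real K"
proof -
  have "(\<lambda>n. real (grid_index K n (Suc j)) / real n - real (grid_index K n j) / real n) \<longlonglongrightarrow> real (Suc j) / real K - real j / real K"
    by (intro tendsto_diff grid_index_limit K)
  moreover have "real (grid_index K n (Suc j)) / real n - real (grid_index K n j) / real n
      = real (grid_index K n (Suc j) - grid_index K n j) / real n" for n
    using monoD[OF mono_grid_index, of j "Suc j" K n] by (simp add: of_nat_diff diff_divide_distrib)
  moreover have "real (Suc j) / real K - real j / real K = 1 / real K"
    by (simp flip: diff_divide_distrib)
  ultimately show ?thesis by simp
qed

text \<open>The value 0 from \<open>K\<close> on keeps the sequences inside the compact sets of
  \<open>compact_blocks\<close>.\<close>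

definition walk_blocks :: "(nat \<Rightarrow> 'w \<Rightarrow> 'b::real_vector) \<Rightarrow> 'b \<Rightarrow> (nat \<Rightarrow> real) \<Rightarrow> nat \<Rightarrow> nat \<Rightarrow> 'w \<Rightarrow> nat \<Rightarrow> 'b" where
  "walk_blocks Y \<mu> b K n \<omega> j = (if j < K then (1 / b n) *\<^sub>R
     (centred_walk Y \<mu> (grid_index K n (Suc j)) \<omega> - centred_walk Y \<mu> (grid_index K n j) \<omega>) else 0)"

definition levy_blocks :: "(real \<Rightarrow> 'v \<Rightarrow> 'b::real_vector) \<Rightarrow> nat \<Rightarrow> 'v \<Rightarrow> nat \<Rightarrow> 'b" where
  "levy_blocks X K \<omega> j = (if j < K then grid_incr X K j \<omega> else 0)"

lemma walk_blocks_char: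
  fixes Y :: "nat \<Rightarrow> 'w \<Rightarrow> 'b::euclidean_space"
  assumes M: "prob_space M" and iid: "iid_steps M Y"
  shows "(CLINT \<omega>|M. iexp (block_inner K u (walk_blocks Y \<mu> b K n \<omega>)))
    = (\<Prod>j<K. step_char M Y \<mu> ((1 / b n) *\<^sub>R u j) ^ (grid_index K n (Suc j) - grid_index K n j))"
proof -
  obtain v where v: "\<And>Y \<mu> (\<omega>::'w). (\<Sum>j<K. ((1 / b n) *\<^sub>R u j) \<bullet> (centred_walk Y \<mu> (grid_index K n (Suc j)) \<omega> - centred_walk Y \<mu> (grid_index K n j) \<omega>))
       = (\<Sum>i=1..grid_index K n K. v i \<bullet> (Y i \<omega> - \<mu>))"
    "(\<Prod>i=1..grid_index K n K. step_char M Y \<mu> (v i)) = (\<Prod>j<K. step_char M Y \<mu> ((1 / b n) *\<^sub>R u j) ^ (grid_index K n (Suc j) - grid_index K n j))"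
    using block_sum_representation[OF grid_index_0 mono_grid_index, where m = K and w = "\<lambda>j. (1 / b n) *\<^sub>R u j" and c = "step_char M Y \<mu>"]
    by blast
  have "block_inner K u (walk_blocks Y \<mu> b K n \<omega>) = (\<Sum>i=1..grid_index K n K. v i \<bullet> (Y i \<omega> - \<mu>))" for \<omega>
    unfolding v(1)[symmetric] block_inner_def by (intro sum.cong) (auto simp: walk_blocks_def)
  then show ?thesis using iid_steps_char[OF M iid] v(2) by simp
qed

text \<open>The joint characteristic function factorises over the blocks, and each block has
  asymptotically \<open>n / K\<close> steps, so \<open>walk_direction\<close> applies with \<theta>
  equal to \<open>1 / real K\<close>.\<close>

theorem walk_blocks_tendsto:
  fixes Y :: "nat \<Rightarrow> 'w \<Rightarrow> 'b::euclidean_space" and X :: "real \<Rightarrow> 'v \<Rightarrow> 'b" and F :: "(nat \<Rightarrow> 'b) \<Rightarrow> real"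
  assumes M: "prob_space M" and iid: "iid_steps M Y" and levy: "levy_process N X"
    and conv: "conv_in_distr M (\<lambda>n \<omega>. (1 / b n) *\<^sub>R centred_walk Y \<mu> n \<omega>) N (X 1)"
    and K: "K \<ge> 1" and F: "continuous_on UNIV F" "bounded (range F)"
  shows "(\<lambda>n. \<integral>\<omega>. F (walk_blocks Y \<mu> b K n \<omega>) \<partial>M) \<longlonglongrightarrow> (\<integral>\<omega>. F (levy_blocks X K \<omega>) \<partial>N)"
proof -
  have N: "prob_space N" using levy by (simp add: levy_process_def)
  have step: "(\<lambda>n. step_char M Y \<mu> ((1 / b n) *\<^sub>R u) ^ (grid_index K n (Suc j) - grid_index K n j)) \<longlonglongrightarrow> grid_char N X K u" for u j
  proof -
    have 1: "conv_in_distr M (\<lambda>n \<omega>. u \<bullet> ((1 / b n) *\<^sub>R centred_walk Y \<mu> n \<omega>)) N (\<lambda>\<omega>. u \<bullet> X 1 \<omega>)"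
      by (rule conv_in_distr_continuous_map[OF conv]) (intro continuous_intros)
    have 2: "(CLINT \<omega>|N. iexp (s * (u \<bullet> X 1 \<omega>))) \<noteq> 0" for s
      using levy_char_nonzero[OF levy, of "s *\<^sub>R u"] by simp
    obtain g where g: "continuous_on {0..1} g" "g 0 = 0" "\<forall>s\<in>{0..1}. exp (g s) = (CLINT \<omega>|N. iexp (s * (u \<bullet> X 1 \<omega>)))"
      "\<And>k \<theta>. (\<lambda>n. real (k n) / real n) \<longlonglongrightarrow> \<theta> \<Longrightarrow>
        (\<lambda>n. step_char M Y \<mu> ((1 / b n) *\<^sub>R u) ^ k n) \<longlonglongrightarrow> exp (of_real \<theta> * g 1)"
      using walk_direction[OF M N iid 1 2] by blast
    show ?thesis
      using g(4)[OF grid_index_gap_limit[OF K, of j]] grid_char_eq_exp[OF levy K g(1-3)] by simp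
  qed
  show ?thesis
  proof (rule expectation_tendsto_blocks[where Z = "walk_blocks Y \<mu> b K" and Z' = "levy_blocks X K" and K = K, OF M N])
    show "(\<lambda>\<omega>. walk_blocks Y \<mu> b K n \<omega> j) \<in> borel_measurable M" for n j
      unfolding walk_blocks_def
      by (cases "j < K") (auto intro!: borel_measurable_scaleR borel_measurable_diff random_walk_measurable[OF M iid])
    show "(\<lambda>\<omega>. levy_blocks X K \<omega> j) \<in> borel_measurable N" for j
      unfolding levy_blocks_def by (cases "j < K") (auto intro: grid_incr_measurable[OF levy])
    fix u :: "nat \<Rightarrow> 'b"
    have "(\<lambda>n. \<Prod>j<K. step_char M Y \<mu> ((1 / b n) *\<^sub>R u j) ^ (grid_index K n (Suc j) - grid_index K n j)) \<longlonglongrightarrow> (\<Prod>j<K. grid_char N X K (u j))"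
      by (intro tendsto_prod step)
    moreover have "block_inner K u (levy_blocks X K \<omega>) = (\<Sum>j<K. u j \<bullet> grid_incr X K j \<omega>)" for \<omega>
      unfolding block_inner_def by (intro sum.cong) (auto simp: levy_blocks_def)
    ultimately show "(\<lambda>n. CLINT \<omega>|M. iexp (block_inner K u (walk_blocks Y \<mu> b K n \<omega>))) \<longlonglongrightarrow> (CLINT \<omega>|N. iexp (block_inner K u (levy_blocks X K \<omega>)))"
      by (simp only: walk_blocks_char[OF M iid] grid_incr_char[OF levy K])
  qed (use F in \<open>auto simp: walk_blocks_def levy_blocks_def\<close>)
qed

section \<open>Maximal inequalities\<close>

definition exceed :: "'w measure \<Rightarrow> (nat \<Rightarrow> 'w \<Rightarrow> 'b::euclidean_space) \<Rightarrow> 'b \<Rightarrow> nat \<Rightarrow> nat set \<Rightarrow> real \<Rightarrow> 'w set" where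
  "exceed M Y \<mu> k J a = {\<omega>\<in>space M. \<exists>j\<in>J. norm (centred_walk Y \<mu> j \<omega> - centred_walk Y \<mu> k \<omega>) \<ge> a}"

definition first_passage :: "'w measure \<Rightarrow> (nat \<Rightarrow> 'w \<Rightarrow> 'b::euclidean_space) \<Rightarrow> 'b \<Rightarrow> nat \<Rightarrow> real \<Rightarrow> nat \<Rightarrow> 'w set" where
  "first_passage M Y \<mu> k\<^sub>0 a k = {\<omega>\<in>space M. norm (centred_walk Y \<mu> k \<omega> - centred_walk Y \<mu> k\<^sub>0 \<omega>) \<ge> a \<and>
     (\<forall>j\<in>{k\<^sub>0..<k}. norm (centred_walk Y \<mu> j \<omega> - centred_walk Y \<mu> k\<^sub>0 \<omega>) < a)}"

text \<open>The first passage at time \<open>k\<close> is decided by the steps up to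
  \<open>k\<close>, the exceedance by later ones. The set \<open>J\<close> is kept general: a single
  end time serves Ottaviani's inequality, a whole interval the second excursion, and the empty set
  gives plain measurability.\<close>

lemma first_passage_indep:
  fixes Y :: "nat \<Rightarrow> 'w \<Rightarrow> 'b::euclidean_space"
  assumes M: "prob_space M" and iid: "iid_steps M Y" and J: "finite J" "J \<subseteq> {k..}" and k: "k\<^sub>0 \<le> k"
  shows "measure M (first_passage M Y \<mu> k\<^sub>0 c k \<inter> exceed M Y \<mu> k J a)
      = measure M (first_passage M Y \<mu> k\<^sub>0 c k) * measure M (exceed M Y \<mu> k J a)"
    "first_passage M Y \<mu> k\<^sub>0 c k \<in> sets M" "exceed M Y \<mu> k J a \<in> sets M"
proof -
  interpret prob_space M by fact
  obtain m where m: "\<forall>j\<in>J. j \<le> m" using J(1) unfolding finite_nat_set_iff_bounded_le ..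
  \<comment> \<open>Partial sums as functions of a sequence, so that they can be evaluated on the
    two restricted families \<open>YA\<close> and \<open>YB\<close>.\<close>
  define ps where "ps = (\<lambda>(x :: nat \<Rightarrow> 'b) i j. \<Sum>l=Suc i..j. x l - \<mu>)"
  define IA where "IA = {1..k}"
  define IB where "IB = {Suc k..m}"
  define YA where "YA = (\<lambda>\<omega>. restrict (\<lambda>i. Y i \<omega>) IA)"
  define YB where "YB = (\<lambda>\<omega>. restrict (\<lambda>i. Y i \<omega>) IB)"
  have ind: "indep_vars (\<lambda>_. borel) Y {1..}" using iid by (simp add: iid_steps_def)
  have ind2: "indep_var (PiM IA (\<lambda>_. borel)) YA (PiM IB (\<lambda>_. borel)) YB"
    unfolding YA_def YB_def by (rule indep_var_restrict[OF ind]) (auto simp: IA_def IB_def)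
  have T_diff: "centred_walk Y \<mu> j \<omega> - centred_walk Y \<mu> i \<omega> = ps (\<lambda>i. Y i \<omega>) i j" if "i \<le> j" for i j \<omega>
    unfolding ps_def by (rule centred_walk_diff[OF that])
  have psA: "ps (YA \<omega>) i j = ps (\<lambda>i. Y i \<omega>) i j" if "j \<le> k" for i j \<omega>
    unfolding ps_def YA_def using that by (intro sum.cong) (auto simp: IA_def)
  have psB: "ps (YB \<omega>) k j = ps (\<lambda>i. Y i \<omega>) k j" if "j \<le> m" for j \<omega>
    unfolding ps_def YB_def using that by (intro sum.cong) (auto simp: IB_def)
  have mA [measurable]: "(\<lambda>x. ps x i j) \<in> borel_measurable (PiM IA (\<lambda>_. borel))" if "j \<le> k" for i j
    unfolding ps_def using that
    by (intro borel_measurable_sum borel_measurable_diff borel_measurable_const measurable_component_singleton) (auto simp: IA_def)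
  have mB [measurable]: "(\<lambda>x. ps x k j) \<in> borel_measurable (PiM IB (\<lambda>_. borel))" if "j \<le> m" for j
    unfolding ps_def using that
    by (intro borel_measurable_sum borel_measurable_diff borel_measurable_const measurable_component_singleton) (auto simp: IB_def)
  define SA where "SA = {x\<in>space (PiM IA (\<lambda>_. borel)). norm (ps x k\<^sub>0 k) \<ge> c \<and> (\<forall>j\<in>{k\<^sub>0..<k}. norm (ps x k\<^sub>0 j) < c)}"
  define SB where "SB = {x\<in>space (PiM IB (\<lambda>_. borel)). \<exists>j\<in>J. norm (ps x k j) \<ge> a}"
  have SA: "SA \<in> sets (PiM IA (\<lambda>_. borel))"
    unfolding SA_def by (intro sets.sets_Collect_conj sets.sets_Collect_finite_All borel_measurable_le borel_measurable_less
        borel_measurable_norm mA borel_measurable_const) auto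
  have SB: "SB \<in> sets (PiM IB (\<lambda>_. borel))"
    unfolding SB_def using m J(1) by (intro sets.sets_Collect_finite_Ex borel_measurable_le
        borel_measurable_norm mB borel_measurable_const) auto
  have rvA: "YA \<in> measurable M (PiM IA (\<lambda>_. borel))" and rvB: "YB \<in> measurable M (PiM IB (\<lambda>_. borel))"
    using indep_var_rv1[OF ind2] indep_var_rv2[OF ind2] by auto
  define A where "A = first_passage M Y \<mu> k\<^sub>0 c k"
  define B where "B = exceed M Y \<mu> k J a"
  have A: "A = YA -` SA \<inter> space M"
    using k measurable_space[OF rvA] by (auto simp: A_def first_passage_def SA_def T_diff psA)
  have B: "B = YB -` SB \<inter> space M"
    using m J(2) measurable_space[OF rvB] by (auto simp: B_def exceed_def SB_def T_diff psB subset_iff)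
  show "first_passage M Y \<mu> k\<^sub>0 c k \<in> sets M" unfolding A_def[symmetric] A by (rule measurable_sets[OF rvA SA])
  show "exceed M Y \<mu> k J a \<in> sets M" unfolding B_def[symmetric] B by (rule measurable_sets[OF rvB SB])
  have "A \<inter> B = (\<lambda>\<omega>. (YA \<omega>, YB \<omega>)) -` (SA \<times> SB) \<inter> space M"
    unfolding A B by auto
  then have "measure M (A \<inter> B) = measure M A * measure M B"
    using indep_varD[OF ind2 SA SB] by (simp add: A B)
  then show "measure M (first_passage M Y \<mu> k\<^sub>0 c k \<inter> exceed M Y \<mu> k J a)
      = measure M (first_passage M Y \<mu> k\<^sub>0 c k) * measure M (exceed M Y \<mu> k J a)"
    by (simp add: A_def B_def)
qed

lemma disjoint_first_passage: "disjoint_family_on (first_passage M Y \<mu> k\<^sub>0 a) {k\<^sub>0..m}"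
proof -
  have "first_passage M Y \<mu> k\<^sub>0 a i \<inter> first_passage M Y \<mu> k\<^sub>0 a j = {}" if "i \<in> {k\<^sub>0..m}" "i < j" for i j
  proof (rule equals0I)
    fix \<omega> assume \<omega>: "\<omega> \<in> first_passage M Y \<mu> k\<^sub>0 a i \<inter> first_passage M Y \<mu> k\<^sub>0 a j"
    have "i \<in> {k\<^sub>0..<j}" using that by auto
    then have "norm (centred_walk Y \<mu> i \<omega> - centred_walk Y \<mu> k\<^sub>0 \<omega>) < a"
      using \<omega> unfolding first_passage_def by blast
    then show False using \<omega> by (simp add: first_passage_def)
  qed
  then show ?thesis unfolding disjoint_family_on_def by (metis Int_commute linorder_neqE_nat)
qed

lemma exceed_eq_first_passage: "exceed M Y \<mu> k\<^sub>0 {k\<^sub>0..m} a = (\<Union>k\<in>{k\<^sub>0..m}. first_passage M Y \<mu> k\<^sub>0 a k)"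
proof (intro subset_antisym subsetI)
  fix \<omega> assume "\<omega> \<in> exceed M Y \<mu> k\<^sub>0 {k\<^sub>0..m} a"
  then have \<omega>: "\<omega> \<in> space M" and ex: "\<exists>k. k \<in> {k\<^sub>0..m} \<and> norm (centred_walk Y \<mu> k \<omega> - centred_walk Y \<mu> k\<^sub>0 \<omega>) \<ge> a"
    by (auto simp: exceed_def)
  define k where "k = (LEAST k. k \<in> {k\<^sub>0..m} \<and> norm (centred_walk Y \<mu> k \<omega> - centred_walk Y \<mu> k\<^sub>0 \<omega>) \<ge> a)"
  have k: "k \<in> {k\<^sub>0..m}" "norm (centred_walk Y \<mu> k \<omega> - centred_walk Y \<mu> k\<^sub>0 \<omega>) \<ge> a"
    using LeastI_ex[OF ex] by (simp_all add: k_def)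
  have "norm (centred_walk Y \<mu> j \<omega> - centred_walk Y \<mu> k\<^sub>0 \<omega>) < a" if "j \<in> {k\<^sub>0..<k}" for j
    using not_less_Least[of j "\<lambda>k. k \<in> {k\<^sub>0..m} \<and> norm (centred_walk Y \<mu> k \<omega> - centred_walk Y \<mu> k\<^sub>0 \<omega>) \<ge> a"] that k(1)
    unfolding k_def[symmetric] by auto
  with k \<omega> show "\<omega> \<in> (\<Union>k\<in>{k\<^sub>0..m}. first_passage M Y \<mu> k\<^sub>0 a k)" by (auto simp: first_passage_def)
qed (auto simp: exceed_def first_passage_def)

text \<open>After the first passage of level \<open>2 * a\<close> the remaining increment is
  independent and smaller than \<open>a\<close> with probability at least 1/2. In that case the
  endpoint is still at distance at least \<open>a\<close> from the start.\<close>

lemma ottaviani: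
  fixes Y :: "nat \<Rightarrow> 'w \<Rightarrow> 'b::euclidean_space"
  assumes M: "prob_space M" and iid: "iid_steps M Y" and "k\<^sub>0 \<le> m"
    and half: "\<And>k. k \<in> {k\<^sub>0..m} \<Longrightarrow> measure M {\<omega>\<in>space M. norm (centred_walk Y \<mu> m \<omega> - centred_walk Y \<mu> k \<omega>) \<ge> a} \<le> 1 / 2"
  shows "measure M (exceed M Y \<mu> k\<^sub>0 {k\<^sub>0..m} (2 * a))
    \<le> 2 * measure M {\<omega>\<in>space M. norm (centred_walk Y \<mu> m \<omega> - centred_walk Y \<mu> k\<^sub>0 \<omega>) \<ge> a}"
proof -
  interpret prob_space M by fact
  have [measurable]: "centred_walk Y \<mu> k \<in> borel_measurable M" for k
    by (rule random_walk_measurable[OF M iid])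
  define F where "F = first_passage M Y \<mu> k\<^sub>0 (2 * a)"
  have disj: "disjoint_family_on F {k\<^sub>0..m}" unfolding F_def by (rule disjoint_first_passage)
  define B where "B = (\<lambda>k. {\<omega>\<in>space M. norm (centred_walk Y \<mu> m \<omega> - centred_walk Y \<mu> k \<omega>) \<ge> a})"
  define G where "G = {\<omega>\<in>space M. norm (centred_walk Y \<mu> m \<omega> - centred_walk Y \<mu> k\<^sub>0 \<omega>) \<ge> a}"
  have [measurable]: "G \<in> sets M" "B k \<in> sets M" for k unfolding G_def B_def by measurable
  have B: "B k = exceed M Y \<mu> k {m} a" for k by (auto simp: B_def exceed_def)
  have FB: "prob (F k \<inter> B k) = prob (F k) * prob (B k)" if "k \<in> {k\<^sub>0..m}" for k
    unfolding F_def B using that by (intro first_passage_indep(1)[OF M iid]) auto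
  have [measurable]: "F k \<in> sets M" if "k \<in> {k\<^sub>0..m}" for k
    unfolding F_def using that by (intro first_passage_indep(2)[OF M iid, of "{}"]) auto
  have half_le: "prob (F k) \<le> 2 * prob (F k \<inter> G)" if k: "k \<in> {k\<^sub>0..m}" for k
  proof -
    have sub: "F k - B k \<subseteq> F k \<inter> G"
    proof
      fix \<omega> assume \<omega>: "\<omega> \<in> F k - B k"
      then have "norm (centred_walk Y \<mu> k \<omega> - centred_walk Y \<mu> k\<^sub>0 \<omega>) \<ge> 2 * a"
        "norm (centred_walk Y \<mu> m \<omega> - centred_walk Y \<mu> k \<omega>) < a" "\<omega> \<in> space M"
        by (auto simp: F_def B_def first_passage_def)
      moreover have "norm (centred_walk Y \<mu> k \<omega> - centred_walk Y \<mu> k\<^sub>0 \<omega>)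
        \<le> norm (centred_walk Y \<mu> m \<omega> - centred_walk Y \<mu> k\<^sub>0 \<omega>) + norm (centred_walk Y \<mu> m \<omega> - centred_walk Y \<mu> k \<omega>)"
        using norm_triangle_ineq4[of "centred_walk Y \<mu> m \<omega> - centred_walk Y \<mu> k\<^sub>0 \<omega>" "centred_walk Y \<mu> m \<omega> - centred_walk Y \<mu> k \<omega>"]
        by simp
      ultimately show "\<omega> \<in> F k \<inter> G" using \<omega> by (auto simp: G_def)
    qed
    have "prob (F k) - prob (F k) * prob (B k) = prob (F k - B k)"
      using k by (subst finite_measure_Diff') (auto simp: FB)
    also have "\<dots> \<le> prob (F k \<inter> G)"
      using sub k by (intro finite_measure_mono) auto
    finally have 1: "prob (F k) - prob (F k) * prob (B k) \<le> prob (F k \<inter> G)" .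
    have "prob (F k) * prob (B k) \<le> prob (F k) * (1 / 2)"
      using half[OF k] by (intro mult_left_mono) (auto simp: B_def)
    with 1 show ?thesis by linarith
  qed
  have "prob (exceed M Y \<mu> k\<^sub>0 {k\<^sub>0..m} (2 * a)) = (\<Sum>k\<in>{k\<^sub>0..m}. prob (F k))"
    unfolding exceed_eq_first_passage F_def
    by (rule finite_measure_finite_Union) (use disj in \<open>auto simp: F_def[symmetric]\<close>)
  also have "\<dots> \<le> (\<Sum>k\<in>{k\<^sub>0..m}. 2 * prob (F k \<inter> G))"
    by (intro sum_mono half_le)
  also have "\<dots> = 2 * prob (\<Union>k\<in>{k\<^sub>0..m}. F k \<inter> G)"
    using disj by (subst finite_measure_finite_Union) (auto simp: disjoint_family_on_def sum_distrib_left)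
  also have "\<dots> \<le> 2 * prob G"
    by (intro mult_left_mono finite_measure_mono) auto
  finally show ?thesis by (simp add: G_def)
qed

text \<open>
  If the walk is far both from its start and from its end at some time, then after the first
  passage it makes a second, independent, excursion.
\<close>

lemma two_excursions:
  fixes Y :: "nat \<Rightarrow> 'w \<Rightarrow> 'b::euclidean_space"
  assumes M: "prob_space M" and iid: "iid_steps M Y" and a: "a > 0"
    and q: "\<And>k. k \<in> {k\<^sub>0..m} \<Longrightarrow> measure M (exceed M Y \<mu> k {k..m} a) \<le> q" and le: "k\<^sub>0 \<le> m"
  shows "measure M {\<omega>\<in>space M. \<exists>k\<in>{k\<^sub>0..m}. norm (centred_walk Y \<mu> k \<omega> - centred_walk Y \<mu> k\<^sub>0 \<omega>) \<ge> 2 * a \<and>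
    norm (centred_walk Y \<mu> m \<omega> - centred_walk Y \<mu> k \<omega>) \<ge> 2 * a} \<le> q\<^sup>2"
proof -
  interpret prob_space M by fact
  have [measurable]: "centred_walk Y \<mu> k \<in> borel_measurable M" for k
    by (rule random_walk_measurable[OF M iid])
  define F where "F = first_passage M Y \<mu> k\<^sub>0 a"
  have disj: "disjoint_family_on F {k\<^sub>0..m}" unfolding F_def by (rule disjoint_first_passage)
  define B where "B = (\<lambda>k. exceed M Y \<mu> k {k..m} a)"
  have FB: "prob (F k \<inter> B k) = prob (F k) * prob (B k)" if "k \<in> {k\<^sub>0..m}" for k
    unfolding F_def B_def using that by (intro first_passage_indep(1)[OF M iid]) auto
  have [measurable]: "F k \<in> sets M" "B k \<in> sets M" if "k \<in> {k\<^sub>0..m}" for k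
    unfolding F_def B_def using that
    by (auto intro: first_passage_indep(2)[OF M iid, of "{}"] first_passage_indep(3)[OF M iid])
  have sub: "{\<omega>\<in>space M. \<exists>k\<in>{k\<^sub>0..m}. norm (centred_walk Y \<mu> k \<omega> - centred_walk Y \<mu> k\<^sub>0 \<omega>) \<ge> 2 * a \<and>
    norm (centred_walk Y \<mu> m \<omega> - centred_walk Y \<mu> k \<omega>) \<ge> 2 * a} \<subseteq> (\<Union>k\<in>{k\<^sub>0..m}. F k \<inter> B k)"
  proof
    fix \<omega> assume "\<omega> \<in> {\<omega>\<in>space M. \<exists>k\<in>{k\<^sub>0..m}. norm (centred_walk Y \<mu> k \<omega> - centred_walk Y \<mu> k\<^sub>0 \<omega>) \<ge> 2 * a \<and>
      norm (centred_walk Y \<mu> m \<omega> - centred_walk Y \<mu> k \<omega>) \<ge> 2 * a}"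
    then obtain k where \<omega>: "\<omega> \<in> space M" and k: "k \<in> {k\<^sub>0..m}" "norm (centred_walk Y \<mu> k \<omega> - centred_walk Y \<mu> k\<^sub>0 \<omega>) \<ge> 2 * a"
      "norm (centred_walk Y \<mu> m \<omega> - centred_walk Y \<mu> k \<omega>) \<ge> 2 * a" by blast
    \<comment> \<open>As \<open>a > 0\<close>, being beyond \<open>2 * a\<close> at time
      \<open>k\<close> forces a passage of level \<open>a\<close> at or before
      \<open>k\<close>.\<close>
    have "\<omega> \<in> exceed M Y \<mu> k\<^sub>0 {k\<^sub>0..k} a" using \<omega> k a by (auto simp: exceed_def intro!: bexI[of _ k])
    then obtain i where i: "i \<in> {k\<^sub>0..k}" "\<omega> \<in> F i" unfolding exceed_eq_first_passage F_def by blast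
    have "\<omega> \<in> B i"
    proof (rule ccontr)
      assume "\<omega> \<notin> B i"
      then have "norm (centred_walk Y \<mu> k \<omega> - centred_walk Y \<mu> i \<omega>) < a"
        "norm (centred_walk Y \<mu> m \<omega> - centred_walk Y \<mu> i \<omega>) < a"
        using \<omega> i k(1) by (auto simp: B_def exceed_def not_le)
      then have "norm (centred_walk Y \<mu> m \<omega> - centred_walk Y \<mu> k \<omega>) < 2 * a"
        using norm_triangle_ineq4[of "centred_walk Y \<mu> m \<omega> - centred_walk Y \<mu> i \<omega>" "centred_walk Y \<mu> k \<omega> - centred_walk Y \<mu> i \<omega>"] by simp
      with k(3) show False by simp
    qed
    then show "\<omega> \<in> (\<Union>k\<in>{k\<^sub>0..m}. F k \<inter> B k)" using i k(1) by auto
  qed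
  have "0 \<le> q" using q[of k\<^sub>0] le measure_nonneg order.trans by (metis atLeastAtMost_iff order_refl)
  have "prob {\<omega>\<in>space M. \<exists>k\<in>{k\<^sub>0..m}. norm (centred_walk Y \<mu> k \<omega> - centred_walk Y \<mu> k\<^sub>0 \<omega>) \<ge> 2 * a \<and>
    norm (centred_walk Y \<mu> m \<omega> - centred_walk Y \<mu> k \<omega>) \<ge> 2 * a} \<le> prob (\<Union>k\<in>{k\<^sub>0..m}. F k \<inter> B k)"
    by (rule finite_measure_mono[OF sub]) (auto intro!: sets.finite_UN)
  also have "\<dots> \<le> (\<Sum>k\<in>{k\<^sub>0..m}. prob (F k \<inter> B k))"
    by (intro finite_measure_subadditive_finite) auto
  also have "\<dots> \<le> (\<Sum>k\<in>{k\<^sub>0..m}. prob (F k) * q)"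
  proof (rule sum_mono)
    fix k assume k: "k \<in> {k\<^sub>0..m}"
    show "prob (F k \<inter> B k) \<le> prob (F k) * q"
      unfolding FB[OF k] using q[OF k] by (intro mult_left_mono) (auto simp: B_def)
  qed
  \<comment> \<open>The first-passage events are disjoint, so their probabilities add up to the
    probability of a first excursion, which is again at most \<open>q\<close>.\<close>
  also have "\<dots> = prob (exceed M Y \<mu> k\<^sub>0 {k\<^sub>0..m} a) * q"
    unfolding exceed_eq_first_passage sum_distrib_right[symmetric] F_def
    by (subst finite_measure_finite_Union) (use disj in \<open>auto simp: F_def[symmetric]\<close>)
  also have "\<dots> \<le> q * q" using q[of k\<^sub>0] le \<open>0 \<le> q\<close> by (intro mult_right_mono) auto
  finally show ?thesis by (simp add: power2_eq_square)
qed

text \<open>The level doubles twice: tails are taken at \<open>\<epsilon> / 4\<close>, Ottaviani's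
  inequality leads to \<open>\<epsilon> / 2\<close>, two excursions to \<epsilon>. One excursion in
  a block has probability at most \<open>4 * C / K\<close>, so \<open>K\<close> blocks contribute at
  most \<open>16 * C\<^sup>2 / K\<close>.\<close>

theorem walk_oscillation:
  fixes Y :: "nat \<Rightarrow> 'w \<Rightarrow> 'b::euclidean_space" and X' :: "'v \<Rightarrow> 'b"
  assumes M: "prob_space M" and N: "prob_space N" and iid: "iid_steps M Y"
    and b: "\<And>n. n \<ge> 1 \<Longrightarrow> b n > 0"
    and conv: "conv_in_distr M (\<lambda>n \<omega>. (1 / b n) *\<^sub>R centred_walk Y \<mu> n \<omega>) N X'"
    and nz: "\<And>u. (CLINT \<omega>|N. iexp (u \<bullet> X' \<omega>)) \<noteq> 0" and \<epsilon>: "\<epsilon> > 0"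
  shows "\<exists>C. \<forall>K\<ge>1. \<forall>\<^sub>F n in sequentially.
    measure M {\<omega>\<in>space M. \<exists>j<K. \<exists>k\<in>{grid_index K n j..grid_index K n (Suc j)}.
      norm (centred_walk Y \<mu> k \<omega> - centred_walk Y \<mu> (grid_index K n j) \<omega>) \<ge> \<epsilon> * b n \<and>
      norm (centred_walk Y \<mu> (grid_index K n (Suc j)) \<omega> - centred_walk Y \<mu> k \<omega>) \<ge> \<epsilon> * b n} \<le> C / real K"
proof -
  interpret M: prob_space M by fact
  have T [measurable]: "centred_walk Y \<mu> k \<in> borel_measurable M" for k
    by (rule random_walk_measurable[OF M iid])
  obtain C where C: "C \<ge> 0" "\<forall>\<^sub>F n in sequentially. \<forall>j l. j \<le> l \<longrightarrow> l \<le> n \<longrightarrow>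
    measure M {\<omega>\<in>space M. norm ((1 / b n) *\<^sub>R (centred_walk Y \<mu> l \<omega> - centred_walk Y \<mu> j \<omega>)) \<ge> \<epsilon> / 4} \<le> C * (real (l - j) / real n)"
    using walk_tail[OF M N iid conv nz, of "\<epsilon> / 4"] \<epsilon> by auto
  define bad where "bad = (\<lambda>K n j. {\<omega>\<in>space M. \<exists>k\<in>{grid_index K n j..grid_index K n (Suc j)}.
      norm (centred_walk Y \<mu> k \<omega> - centred_walk Y \<mu> (grid_index K n j) \<omega>) \<ge> \<epsilon> * b n \<and>
      norm (centred_walk Y \<mu> (grid_index K n (Suc j)) \<omega> - centred_walk Y \<mu> k \<omega>) \<ge> \<epsilon> * b n})"
  have [measurable]: "bad K n j \<in> sets M" for K n j unfolding bad_def by measurable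
  have bad_Un: "{\<omega>\<in>space M. \<exists>j<K. \<exists>k\<in>{grid_index K n j..grid_index K n (Suc j)}.
      norm (centred_walk Y \<mu> k \<omega> - centred_walk Y \<mu> (grid_index K n j) \<omega>) \<ge> \<epsilon> * b n \<and>
      norm (centred_walk Y \<mu> (grid_index K n (Suc j)) \<omega> - centred_walk Y \<mu> k \<omega>) \<ge> \<epsilon> * b n} = (\<Union>j<K. bad K n j)" for K n
    by (auto simp: bad_def)
  have "\<forall>\<^sub>F n in sequentially. measure M (\<Union>j<K. bad K n j) \<le> (16 * C\<^sup>2 + 4 * C) / real K" if K: "K \<ge> 1" for K
  proof (cases "2 * C / real K \<le> 1 / 2")
    \<comment> \<open>Ottaviani's inequality needs tails of at most 1/2. If \<open>K\<close> is too
      small for this, the claimed bound exceeds 1, which is the purpose of the summand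
      \<open>4 * C\<close>.\<close>
    case False
    then have "1 \<le> 4 * C / real K" using K by (simp add: field_simps)
    also have "\<dots> \<le> (16 * C\<^sup>2 + 4 * C) / real K" by (intro divide_right_mono) auto
    finally have "measure M (\<Union>j<K. bad K n j) \<le> (16 * C\<^sup>2 + 4 * C) / real K" for n
      using M.prob_le_1[of "\<Union>j<K. bad K n j"] by linarith
    then show ?thesis by simp
  next
    case True
    show ?thesis
      using C(2) eventually_ge_at_top[of K]
    proof eventually_elim
      case (elim n)
      have n: "n \<ge> 1" using elim(2) K by simp
      have bn: "b n > 0" by (rule b[OF n])
      have tail: "measure M {\<omega>\<in>space M. norm (centred_walk Y \<mu> l \<omega> - centred_walk Y \<mu> i \<omega>) \<ge> \<epsilon> / 4 * b n} \<le> 2 * C / real K"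
        if "j < K" "grid_index K n j \<le> i" "i \<le> l" "l \<le> grid_index K n (Suc j)" for i j l
      proof -
        have ln: "l \<le> n"
          using that monoD[OF mono_grid_index, of "Suc j" K K n] grid_index_K[OF K, of n] by simp
        have "real l - real i \<le> real (grid_index K n (Suc j)) - real (grid_index K n j)"
          using that by simp
        also have "\<dots> \<le> real (Suc j) * real n / real K - (real j * real n / real K - 1)"
          by (intro diff_mono grid_index_bounds[OF K])
        also have "\<dots> = real n / real K + 1" by (simp add: distrib_right add_divide_distrib)
        \<comment> \<open>\<open>n \<ge> K\<close> absorbs the rounding error 1 into the block
          length.\<close>
        also have "\<dots> \<le> 2 * real n / real K"
          using elim(2) K by (simp add: field_simps)
        finally have "real (l - i) \<le> 2 * real n / real K" using that by (simp add: of_nat_diff)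
        then have "real (l - i) / real n \<le> (2 * real n / real K) / real n"
          by (rule divide_right_mono) simp
        then have len: "real (l - i) / real n \<le> 2 / real K" using n by simp
        have "norm ((1 / b n) *\<^sub>R x) \<ge> \<epsilon> / 4 \<longleftrightarrow> norm x \<ge> \<epsilon> / 4 * b n" for x :: 'b
          using bn by (simp add: field_simps)
        then have "measure M {\<omega>\<in>space M. norm (centred_walk Y \<mu> l \<omega> - centred_walk Y \<mu> i \<omega>) \<ge> \<epsilon> / 4 * b n} \<le> C * (real (l - i) / real n)"
          using elim(1) that(3) ln by simp
        also have "\<dots> \<le> C * (2 / real K)" using len C(1) by (rule mult_left_mono)
        also have "\<dots> = 2 * C / real K" by simp
        finally show ?thesis .
      qed
      have "measure M (bad K n j) \<le> (4 * C / real K)\<^sup>2" if j: "j < K" for j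
      proof -
        define a where "a = \<epsilon> / 4 * b n"
        have a: "a > 0" using \<epsilon> bn by (simp add: a_def)
        have le: "grid_index K n j \<le> grid_index K n (Suc j)" using monoD[OF mono_grid_index] by simp
        have "measure M (exceed M Y \<mu> k {k..grid_index K n (Suc j)} (2 * a)) \<le> 4 * C / real K"
          if k: "k \<in> {grid_index K n j..grid_index K n (Suc j)}" for k
        proof -
          have "measure M (exceed M Y \<mu> k {k..grid_index K n (Suc j)} (2 * a))
            \<le> 2 * measure M {\<omega>\<in>space M. norm (centred_walk Y \<mu> (grid_index K n (Suc j)) \<omega> - centred_walk Y \<mu> k \<omega>) \<ge> a}"
          proof (rule ottaviani[OF M iid])
            show "measure M {\<omega>\<in>space M. norm (centred_walk Y \<mu> (grid_index K n (Suc j)) \<omega> - centred_walk Y \<mu> i \<omega>) \<ge> a} \<le> 1 / 2"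
              if "i \<in> {k..grid_index K n (Suc j)}" for i
              using tail[OF j, of i "grid_index K n (Suc j)"] that k True unfolding a_def by force
          qed (use k in auto)
          also have "\<dots> \<le> 2 * (2 * C / real K)"
            using tail[OF j, of k "grid_index K n (Suc j)"] k unfolding a_def by (intro mult_left_mono) auto
          finally show ?thesis by simp
        qed
        from two_excursions[OF M iid _ this le] a
        show ?thesis unfolding bad_def by (simp add: a_def)
      qed
      then have "(\<Sum>j<K. measure M (bad K n j)) \<le> (\<Sum>j<K. (4 * C / real K)\<^sup>2)"
        by (intro sum_mono) auto
      also have "\<dots> = 16 * C\<^sup>2 / real K" using K by (simp add: power2_eq_square field_simps)
      also have "\<dots> \<le> (16 * C\<^sup>2 + 4 * C) / real K" using C(1) by (intro divide_right_mono) auto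
      finally show ?case
        using M.finite_measure_subadditive_finite[of "{..<K}" "bad K n"] by fastforce
    qed
  qed
  then show ?thesis unfolding bad_Un by (intro exI[of _ "16 * C\<^sup>2 + 4 * C"]) blast
qed

text \<open>The step is centred, so the linear Taylor term integrates to 0. The minimum of the two
  remainder bounds is dominated by a multiple of the modulus of the step and tends to 0 pointwise in
  \<open>n\<close>; integrability therefore makes the right-hand side \<open>o(1/n)\<close>.\<close>

lemma norm_step_char_minus_one_le:
  fixes Y :: "nat \<Rightarrow> 'w \<Rightarrow> 'b::euclidean_space"
  assumes M: "prob_space M" and [measurable]: "Y 1 \<in> borel_measurable M"
    and int: "integrable M (Y 1)" and \<mu>: "\<mu> = (\<integral>\<omega>. Y 1 \<omega> \<partial>M)"
    and s: "s \<in> {0..1}" and n: "n \<ge> 1"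
  shows "norm (1 - step_char M Y \<mu> ((s / real n) *\<^sub>R u))
    \<le> (\<integral>\<omega>. min (2 * \<bar>u \<bullet> (Y 1 \<omega> - \<mu>)\<bar>) ((u \<bullet> (Y 1 \<omega> - \<mu>))\<^sup>2 / (2 * real n)) \<partial>M) / real n"
proof -
  interpret M: prob_space M by fact
  define x where "x = (\<lambda>\<omega>. u \<bullet> (Y 1 \<omega> - \<mu>))"
  have xint: "integrable M x" unfolding x_def using int by simp
  have [measurable]: "x \<in> borel_measurable M" unfolding x_def by measurable
  have x0: "(\<integral>\<omega>. x \<omega> \<partial>M) = 0"
    unfolding x_def using int by (simp add: M.prob_space \<mu>)
  define t where "t = s / real n"
  have t: "0 \<le> t" "t \<le> 1 / real n" using s n by (auto simp: t_def divide_right_mono)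
  have e_int: "integrable M (\<lambda>\<omega>. iexp (t * x \<omega>))"
    by (rule M.integrable_iexp_borel[of "\<lambda>\<omega>. t * x \<omega>"]) measurable
  have i_int: "integrable M (\<lambda>\<omega>. \<i> * complex_of_real (t * x \<omega>))"
    using xint by simp
  have "(CLINT \<omega>|M. \<i> * complex_of_real (t * x \<omega>)) = 0"
    using x0 by simp
  then have "step_char M Y \<mu> (t *\<^sub>R u) - 1 = (CLINT \<omega>|M. iexp (t * x \<omega>) - 1 - \<i> * complex_of_real (t * x \<omega>))"
    using e_int i_int by (simp add: step_char_def x_def M.prob_space del: of_real_mult)
  also have "norm \<dots> \<le> (\<integral>\<omega>. norm (iexp (t * x \<omega>) - 1 - \<i> * complex_of_real (t * x \<omega>)) \<partial>M)"
    by (rule integral_norm_bound)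
  also have "\<dots> \<le> (\<integral>\<omega>. min (2 * \<bar>x \<omega>\<bar>) ((x \<omega>)\<^sup>2 / (2 * real n)) / real n \<partial>M)"
  proof (rule integral_mono)
    show "integrable M (\<lambda>\<omega>. norm (iexp (t * x \<omega>) - 1 - \<i> * complex_of_real (t * x \<omega>)))"
      by (intro integrable_norm Bochner_Integration.integrable_diff e_int i_int) simp
    have "integrable M (\<lambda>\<omega>. min (2 * \<bar>x \<omega>\<bar>) ((x \<omega>)\<^sup>2 / (2 * real n)))"
      by (rule Bochner_Integration.integrable_bound[of _ "\<lambda>\<omega>. 2 * \<bar>x \<omega>\<bar>"]) (use xint in auto)
    then show "integrable M (\<lambda>\<omega>. min (2 * \<bar>x \<omega>\<bar>) ((x \<omega>)\<^sup>2 / (2 * real n)) / real n)" by simp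
    fix \<omega>
    define y where "y = x \<omega>"
    have ty: "\<bar>t * y\<bar> \<le> \<bar>y\<bar> / real n"
      using t mult_right_mono[of t "1 / real n" "\<bar>y\<bar>"] by (simp add: abs_mult)
    have sum: "(\<Sum>k\<le>1. (\<i> * complex_of_real (t * y)) ^ k / fact k) = 1 + \<i> * complex_of_real (t * y)"
      by simp
    have "norm (iexp (t * y) - 1 - \<i> * complex_of_real (t * y)) \<le> 2 * \<bar>t * y\<bar>"
      using iexp_approx2[of "t * y" 1] unfolding sum by (simp add: diff_diff_eq)
    also have "\<dots> \<le> 2 * \<bar>y\<bar> / real n" using ty by simp
    finally have 1: "norm (iexp (t * y) - 1 - \<i> * complex_of_real (t * y)) \<le> 2 * \<bar>y\<bar> / real n" .
    have "norm (iexp (t * y) - 1 - \<i> * complex_of_real (t * y)) \<le> \<bar>t * y\<bar>\<^sup>2 / 2"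
      using iexp_approx1[of "t * y" 1] unfolding sum by (simp add: diff_diff_eq power2_eq_square)
    also have "\<dots> \<le> (\<bar>y\<bar> / real n)\<^sup>2 / 2" using ty by (intro divide_right_mono power_mono) auto
    also have "\<dots> = y\<^sup>2 / (2 * real n) / real n" by (simp add: power2_eq_square)
    finally have 2: "norm (iexp (t * y) - 1 - \<i> * complex_of_real (t * y)) \<le> y\<^sup>2 / (2 * real n) / real n" .
    show "norm (iexp (t * x \<omega>) - 1 - \<i> * complex_of_real (t * x \<omega>)) \<le> min (2 * \<bar>x \<omega>\<bar>) ((x \<omega>)\<^sup>2 / (2 * real n)) / real n"
      using 1 2 unfolding y_def min_def by (simp split: if_splits)
  qed
  also have "\<dots> = (\<integral>\<omega>. min (2 * \<bar>x \<omega>\<bar>) ((x \<omega>)\<^sup>2 / (2 * real n)) \<partial>M) / real n" by simp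
  finally show ?thesis unfolding t_def x_def by (simp add: norm_minus_commute)
qed

text \<open>One step has characteristic function within \<open>o(1/n)\<close> of 1, hence any window
  of at most \<open>n\<close> steps one within \<open>o(1)\<close>. Ottaviani's inequality passes
  from the windows ending at \<open>n\<close> to the maximum.\<close>

theorem walk_max_weak_law:
  fixes Y :: "nat \<Rightarrow> 'w \<Rightarrow> 'b::euclidean_space"
  assumes M: "prob_space M" and iid: "iid_steps M Y"
    and int: "integrable M (Y 1)" and \<mu>: "\<mu> = (\<integral>\<omega>. Y 1 \<omega> \<partial>M)" and \<epsilon>: "\<epsilon> > 0"
  shows "(\<lambda>n. measure M (exceed M Y \<mu> 0 {0..n} (\<epsilon> * real n))) \<longlonglongrightarrow> 0"
proof -
  interpret M: prob_space M by fact
  have [measurable]: "centred_walk Y \<mu> k \<in> borel_measurable M" for k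
    by (rule random_walk_measurable[OF M iid])
  have Y1 [measurable]: "Y 1 \<in> borel_measurable M" using iid_steps_measurable[OF M iid] by simp
  have [measurable]: "Y (Suc 0) \<in> borel_measurable M" using Y1 by simp
  define u where "u = (\<lambda>i::'b. (2 * DIM('b) / (\<epsilon> / 2)) *\<^sub>R i)"
  define \<delta> where "\<delta> = (\<lambda>i n. \<integral>\<omega>. min (2 * \<bar>u i \<bullet> (Y 1 \<omega> - \<mu>)\<bar>) ((u i \<bullet> (Y 1 \<omega> - \<mu>))\<^sup>2 / (2 * real n)) \<partial>M)"
  have \<delta>_lim: "\<delta> i \<longlonglongrightarrow> 0" for i
  proof -
    have "\<delta> i \<longlonglongrightarrow> (\<integral>\<omega>. 0 \<partial>M)"
      unfolding \<delta>_def
    proof (rule integral_dominated_convergence[where w="\<lambda>\<omega>. 2 * \<bar>u i \<bullet> (Y 1 \<omega> - \<mu>)\<bar>"])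
      show "integrable M (\<lambda>\<omega>. 2 * \<bar>u i \<bullet> (Y 1 \<omega> - \<mu>)\<bar>)" using int by simp
      show "AE \<omega> in M. (\<lambda>n. min (2 * \<bar>u i \<bullet> (Y 1 \<omega> - \<mu>)\<bar>) ((u i \<bullet> (Y 1 \<omega> - \<mu>))\<^sup>2 / (2 * real n))) \<longlonglongrightarrow> 0"
      proof (rule AE_I2)
        fix \<omega>
        define z where "z = u i \<bullet> (Y 1 \<omega> - \<mu>)"
        have "(\<lambda>n. min (2 * \<bar>z\<bar>) (z\<^sup>2 / 2 * (1 / real n))) \<longlonglongrightarrow> min (2 * \<bar>z\<bar>) (z\<^sup>2 / 2 * 0)"
          by (intro tendsto_min tendsto_mult tendsto_const lim_1_over_n)
        then show "(\<lambda>n. min (2 * \<bar>z\<bar>) (z\<^sup>2 / (2 * real n))) \<longlonglongrightarrow> 0" by simp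
      qed
    qed auto
    then show ?thesis by simp
  qed
  define q where "q = (\<lambda>n. \<Sum>i\<in>Basis. 2 * \<delta> i n)"
  have q_lim: "q \<longlonglongrightarrow> 0"
    unfolding q_def using tendsto_sum[of Basis "\<lambda>i n. 2 * \<delta> i n" "\<lambda>_. 0"] tendsto_mult_right_zero[OF \<delta>_lim] by simp
  have tail: "measure M {\<omega>\<in>space M. norm (centred_walk Y \<mu> l \<omega> - centred_walk Y \<mu> j \<omega>) \<ge> \<epsilon> / 2 * real n} \<le> q n"
    if "j \<le> l" "l \<le> n" "n \<ge> 1" for j l n
  proof -
    define V where "V = (\<lambda>\<omega>. (1 / real n) *\<^sub>R (centred_walk Y \<mu> l \<omega> - centred_walk Y \<mu> j \<omega>))"
    have [measurable]: "V \<in> borel_measurable M" unfolding V_def by measurable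
    have dir: "measure M {\<omega>\<in>space M. \<bar>u i \<bullet> V \<omega>\<bar> \<ge> 2} \<le> 2 * \<delta> i n" for i
    proof (rule M.tail_bound_char)
      fix s :: real assume s: "s \<in> {0..1}"
      define c where "c = step_char M Y \<mu> ((s / real n) *\<^sub>R u i)"
      have c1: "norm c \<le> 1"
      proof -
        have "norm c \<le> (\<integral>\<omega>. norm (iexp (((s / real n) *\<^sub>R u i) \<bullet> (Y 1 \<omega> - \<mu>))) \<partial>M)"
          unfolding c_def step_char_def by (rule integral_norm_bound)
        then show ?thesis by (simp add: M.prob_space)
      qed
      have "\<delta> i n \<ge> 0" unfolding \<delta>_def by (intro integral_nonneg_AE) auto
      have "(CLINT \<omega>|M. iexp (s * (u i \<bullet> V \<omega>))) = c ^ (l - j)"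
        using centred_walk_diff_char[OF M iid that(1), of "(s / real n) *\<^sub>R u i" \<mu>] by (simp add: V_def c_def)
      then have "norm (1 - (CLINT \<omega>|M. iexp (s * (u i \<bullet> V \<omega>)))) = norm (1 ^ (l - j) - c ^ (l - j))" by simp
      also have "\<dots> \<le> real (l - j) * norm (1 - c)" using c1 by (intro norm_power_diff) auto
      also have "\<dots> \<le> real n * (\<delta> i n / real n)"
        using norm_step_char_minus_one_le[where Y = Y and u = "u i", OF M Y1 int \<mu> s that(3)] that
        unfolding \<delta>_def c_def by (intro mult_mono) auto
      finally show "norm (1 - (CLINT \<omega>|M. iexp (s * (u i \<bullet> V \<omega>)))) \<le> \<delta> i n" using that(3) by simp
    qed measurable
    have "norm (V \<omega>) \<ge> \<epsilon> / 2 \<longleftrightarrow> norm (centred_walk Y \<mu> l \<omega> - centred_walk Y \<mu> j \<omega>) \<ge> \<epsilon> / 2 * real n" for \<omega>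
    proof -
      have "norm ((1 / real n) *\<^sub>R x) \<ge> \<epsilon> / 2 \<longleftrightarrow> norm x \<ge> \<epsilon> / 2 * real n" for x :: 'b
        using that(3) by (simp add: field_simps)
      then show ?thesis unfolding V_def .
    qed
    then have "measure M {\<omega>\<in>space M. norm (centred_walk Y \<mu> l \<omega> - centred_walk Y \<mu> j \<omega>) \<ge> \<epsilon> / 2 * real n}
      = measure M {\<omega>\<in>space M. norm (V \<omega>) \<ge> \<epsilon> / 2}" by simp
    also have "\<dots> \<le> (\<Sum>i\<in>Basis. measure M {\<omega>\<in>space M. \<bar>u i \<bullet> V \<omega>\<bar> \<ge> 2})"
      unfolding u_def by (rule M.norm_tail_le_sum_directions) (use \<epsilon> in auto)
    also have "\<dots> \<le> q n" unfolding q_def by (intro sum_mono dir)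
    finally show ?thesis .
  qed
  have "eventually (\<lambda>n. q n < 1 / 2) sequentially" using q_lim by (rule order_tendstoD(2)) simp
  then have upper: "eventually (\<lambda>n. measure M (exceed M Y \<mu> 0 {0..n} (\<epsilon> * real n)) \<le> 2 * q n) sequentially"
    using eventually_ge_at_top[of 1]
  proof eventually_elim
    case (elim n)
    have "measure M (exceed M Y \<mu> 0 {0..n} (2 * (\<epsilon> / 2 * real n)))
      \<le> 2 * measure M {\<omega>\<in>space M. norm (centred_walk Y \<mu> n \<omega> - centred_walk Y \<mu> 0 \<omega>) \<ge> \<epsilon> / 2 * real n}"
      by (rule ottaviani[OF M iid]) (use tail[of _ n n] elim in force)+
    also have "\<dots> \<le> 2 * q n" using tail[of 0 n n] elim by simp
    finally show ?case by simp
  qed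
  show ?thesis
    by (rule tendsto_sandwich[OF _ upper tendsto_const tendsto_mult_right_zero[OF q_lim]]) simp
qed

section \<open>Convergence of the convex hulls\<close>

lemma abs_intrinsic_volume_le:
  fixes A :: "'b::euclidean_space set"
  assumes A: "compact A" "convex A" "A \<noteq> {}" and m: "m \<le> DIM('b)" and R: "A \<subseteq> cball 0 R"
  shows "\<bar>intrinsic_volume m A\<bar> \<le> (\<Sum>j\<in>{1..Suc DIM('b)}.
    \<bar>intrinsic_volume_weight DIM('b) m j\<bar> * measure lebesgue (cball (0::'b) (R + real j)))"
  unfolding intrinsic_volume_eq_sum[OF A m]
proof (rule order.trans[OF sum_abs], rule sum_mono)
  fix j
  show "\<bar>intrinsic_volume_weight DIM('b) m j * measure lebesgue (parallel_body A (real j))\<bar>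
    \<le> \<bar>intrinsic_volume_weight DIM('b) m j\<bar> * measure lebesgue (cball (0::'b) (R + real j))"
    unfolding abs_mult abs_of_nonneg[OF measure_nonneg]
    by (intro mult_left_mono measure_parallel_body_le_cball[OF A(1) R]) auto
qed

text \<open>The intrinsic volumes of bodies in a fixed ball stay in a compact interval, on which the
  test function \<open>f\<close> is uniformly continuous.\<close>

lemma continuous_intrinsic_volume_uniformly_continuous:
  fixes f :: "real \<Rightarrow> real"
  assumes m: "m \<le> DIM('b::euclidean_space)" and f: "continuous_on UNIV f" and r: "r > 0"
  shows "\<exists>\<delta>>0. \<forall>A B :: 'b set. compact A \<longrightarrow> convex A \<longrightarrow> A \<noteq> {} \<longrightarrow> compact B \<longrightarrow> convex B \<longrightarrow> B \<noteq> {} \<longrightarrow>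
    A \<subseteq> cball 0 R \<longrightarrow> B \<subseteq> cball 0 R \<longrightarrow> A \<subseteq> parallel_body B \<delta> \<longrightarrow> B \<subseteq> parallel_body A \<delta> \<longrightarrow>
    \<bar>f (intrinsic_volume m A) - f (intrinsic_volume m B)\<bar> < r"
proof -
  define V where "V = (\<Sum>j\<in>{1..Suc DIM('b)}.
    \<bar>intrinsic_volume_weight DIM('b) m j\<bar> * measure lebesgue (cball (0::'b) (R + real j)))"
  have "uniformly_continuous_on {-V..V} f"
    by (intro compact_uniformly_continuous continuous_on_subset[OF f]) auto
  then obtain \<eta> where \<eta>: "\<eta> > 0" "\<And>x y. x \<in> {-V..V} \<Longrightarrow> y \<in> {-V..V} \<Longrightarrow> dist y x < \<eta> \<Longrightarrow> dist (f y) (f x) < r"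
    using r unfolding uniformly_continuous_on_def by metis
  obtain \<delta> where \<delta>: "\<delta> > 0" "\<And>A B :: 'b set. compact A \<Longrightarrow> convex A \<Longrightarrow> A \<noteq> {} \<Longrightarrow> compact B \<Longrightarrow> convex B \<Longrightarrow> B \<noteq> {} \<Longrightarrow>
    A \<subseteq> cball 0 R \<Longrightarrow> B \<subseteq> cball 0 R \<Longrightarrow> A \<subseteq> parallel_body B \<delta> \<Longrightarrow> B \<subseteq> parallel_body A \<delta> \<Longrightarrow>
    \<bar>intrinsic_volume m A - intrinsic_volume m B\<bar> < \<eta>"
    using intrinsic_volume_uniformly_continuous[OF m \<eta>(1), of R] by metis
  show ?thesis
  proof (intro exI[of _ \<delta>] conjI allI impI \<delta>(1))
    fix A B :: "'b set"
    assume A: "compact A" "convex A" "A \<noteq> {}" and B: "compact B" "convex B" "B \<noteq> {}"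
      and sub: "A \<subseteq> cball 0 R" "B \<subseteq> cball 0 R" "A \<subseteq> parallel_body B \<delta>" "B \<subseteq> parallel_body A \<delta>"
    have "intrinsic_volume m A \<in> {-V..V}" "intrinsic_volume m B \<in> {-V..V}"
      using abs_intrinsic_volume_le[OF A m sub(1)] abs_intrinsic_volume_le[OF B m sub(2)]
      unfolding V_def[symmetric] by (auto simp: abs_le_iff)
    then show "\<bar>f (intrinsic_volume m A) - f (intrinsic_volume m B)\<bar> < r"
      using \<eta>(2)[of "intrinsic_volume m B" "intrinsic_volume m A"] \<delta>(2)[OF A B sub]
      by (simp add: dist_real_def)
  qed
qed

text \<open>One continuous map turns the blocks of the walk and those of the limit process into
  skeletons. Its coordinate \<open>i\<^sub>1\<close> is deterministic: the fluctuations along the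
  mean are left to the comparison with the scaled walk.\<close>

definition skeleton_map :: "'n \<Rightarrow> ('n \<Rightarrow> real^'n) \<Rightarrow> real^'n \<Rightarrow> nat \<Rightarrow> (nat \<Rightarrow> real^'n) \<Rightarrow> nat \<Rightarrow> real^'n::finite" where
  "skeleton_map i\<^sub>1 e \<mu> K x j = (\<chi> i. if i = i\<^sub>1 then norm \<mu> * (real j / real K) else (\<Sum>l<j. x l) \<bullet> e i)"

definition scaled_walk :: "'n \<Rightarrow> ('n \<Rightarrow> real^'n) \<Rightarrow> (nat \<Rightarrow> real) \<Rightarrow> (nat \<Rightarrow> 'w \<Rightarrow> real^'n) \<Rightarrow> nat \<Rightarrow> nat \<Rightarrow> 'w \<Rightarrow> real^'n::finite" where
  "scaled_walk i\<^sub>1 e b Y n k \<omega> = scaling_matrix i\<^sub>1 b n *v basis_coords e (random_walk Y k \<omega>)"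

lemma continuous_on_skeleton_map: "continuous_on UNIV (skeleton_map i\<^sub>1 e \<mu> K)"
proof (rule continuous_on_coordinatewise_then_product)
  fix j
  have "continuous_on UNIV (\<lambda>x. if i = i\<^sub>1 then norm \<mu> * (real j / real K) else (\<Sum>l<j. x l) \<bullet> e i)" for i
    by (cases "i = i\<^sub>1") (auto intro!: continuous_intros continuous_on_product_coordinates)
  then show "continuous_on UNIV (\<lambda>x. skeleton_map i\<^sub>1 e \<mu> K x j)"
    unfolding skeleton_map_def by (intro continuous_on_vec_lambda)
qed

lemma cadlag_limit_process:
  assumes "cadlag (\<lambda>t. X t \<omega>)"
  shows "cadlag (\<lambda>t. limit_process i\<^sub>1 e \<mu> X t \<omega>)"
  unfolding cadlag_def
proof (intro conjI allI impI)
  fix t :: real assume "t \<ge> 0"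
  then have "((\<lambda>t. X t \<omega>) \<longlongrightarrow> X t \<omega>) (at_right t)" using assms by (simp add: cadlag_def)
  then have "((\<lambda>s. if i = i\<^sub>1 then norm \<mu> * s else X s \<omega> \<bullet> e i) \<longlongrightarrow> (if i = i\<^sub>1 then norm \<mu> * t else X t \<omega> \<bullet> e i)) (at_right t)" for i
    by (cases "i = i\<^sub>1") (auto intro!: tendsto_intros)
  then show "((\<lambda>t. limit_process i\<^sub>1 e \<mu> X t \<omega>) \<longlongrightarrow> limit_process i\<^sub>1 e \<mu> X t \<omega>) (at_right t)"
    unfolding limit_process_def by (intro tendsto_vec_lambda)
next
  fix t :: real assume "t > 0"
  then obtain l where l: "((\<lambda>t. X t \<omega>) \<longlongrightarrow> l) (at_left t)" using assms by (auto simp: cadlag_def)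
  then have "((\<lambda>s. if i = i\<^sub>1 then norm \<mu> * s else X s \<omega> \<bullet> e i) \<longlongrightarrow> (if i = i\<^sub>1 then norm \<mu> * t else l \<bullet> e i)) (at_left t)" for i
    by (cases "i = i\<^sub>1") (auto intro!: tendsto_intros)
  then have "((\<lambda>t. limit_process i\<^sub>1 e \<mu> X t \<omega>) \<longlongrightarrow> (\<chi> i. if i = i\<^sub>1 then norm \<mu> * t else l \<bullet> e i)) (at_left t)"
    unfolding limit_process_def by (intro tendsto_vec_lambda)
  then show "\<exists>l. ((\<lambda>t. limit_process i\<^sub>1 e \<mu> X t \<omega>) \<longlongrightarrow> l) (at_left t)" by blast
qed

lemma limit_process_measurable:
  assumes "levy_process N X" "t \<ge> 0"
  shows "limit_process i\<^sub>1 e \<mu> X t \<in> borel_measurable N"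
proof -
  have [measurable]: "X t \<in> borel_measurable N" by (rule levy_process_measurable[OF assms])
  have "(\<lambda>\<omega>. if i = i\<^sub>1 then norm \<mu> * t else X t \<omega> \<bullet> e i) \<in> borel_measurable N" for i
    by (cases "i = i\<^sub>1") auto
  then have "(\<lambda>\<omega>. limit_process i\<^sub>1 e \<mu> X t \<omega> \<bullet> v) \<in> borel_measurable N" if "v \<in> Basis" for v
    using that by (auto simp: Basis_vec_def inner_axis limit_process_def)
  then show ?thesis by (subst borel_measurable_euclidean_space) blast
qed

lemma block_exists:
  assumes K: "K \<ge> 1" and k: "k \<le> n"
  shows "\<exists>j<K. grid_index K n j \<le> k \<and> k \<le> grid_index K n (Suc j)"
proof -
  define j where "j = (LEAST j. k \<le> grid_index K n (Suc j))"
  have ex: "k \<le> grid_index K n (Suc (K - 1))" using K k by simp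
  then have "k \<le> grid_index K n (Suc j)" "j \<le> K - 1"
    unfolding j_def by (rule LeastI, rule Least_le)
  moreover have "grid_index K n j \<le> k"
  proof (cases j)
    case (Suc i)
    then have "\<not> k \<le> grid_index K n (Suc i)" using not_less_Least[of i "\<lambda>j. k \<le> grid_index K n (Suc j)"]
      unfolding j_def[symmetric] by simp
    then show ?thesis by (simp add: Suc)
  qed simp
  ultimately show ?thesis using K by (intro exI[of _ j]) auto
qed

section \<open>Comparison of the scaled walk with its skeleton\<close>

locale attracted_walk =
  fixes M :: "'w measure" and N :: "'v measure"
    and Y :: "nat \<Rightarrow> 'w \<Rightarrow> real^'n" and X :: "real \<Rightarrow> 'v \<Rightarrow> real^'n"
    and \<mu> :: "real^'n" and e :: "'n::finite \<Rightarrow> real^'n" and i\<^sub>1 :: 'n and b :: "nat \<Rightarrow> real"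
  assumes M: "prob_space M" and iid: "iid_steps M Y"
    and mean: "integrable M (Y 1)" "\<mu> = (\<integral>\<omega>. Y 1 \<omega> \<partial>M)" "\<mu> \<noteq> 0"
    and levy: "levy_process N X"
    and b_pos: "\<And>n. n \<ge> 1 \<Longrightarrow> b n > 0"
    and attraction: "conv_in_distr M (\<lambda>n \<omega>. (1 / b n) *\<^sub>R centred_walk Y \<mu> n \<omega>) N (X 1)"
    and basis: "\<And>i j. e i \<bullet> e j = (if i = j then 1 else 0)" "e i\<^sub>1 = (1 / norm \<mu>) *\<^sub>R \<mu>"
begin

sublocale M: prob_space M by (rule M)

sublocale N: prob_space N using levy by (simp add: levy_process_def)

abbreviation "T \<equiv> centred_walk Y \<mu>"
abbreviation "S \<equiv> scaled_walk i\<^sub>1 e b Y"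
abbreviation "W K n \<omega> \<equiv> skeleton_map i\<^sub>1 e \<mu> K (walk_blocks Y \<mu> b K n \<omega>)"

lemma T_measurable [measurable]: "T k \<in> borel_measurable M"
  by (rule random_walk_measurable[OF M iid])

lemma S_measurable [measurable]: "S n k \<in> borel_measurable M"
proof -
  have "random_walk Y k \<in> borel_measurable M" by (rule random_walk_measurable[OF M iid])
  moreover have "(\<lambda>x. scaling_matrix i\<^sub>1 b n *v basis_coords e x) \<in> borel_measurable borel"
    using linear_scaling_basis_coords
    by (intro borel_measurable_continuous_onI linear_continuous_on) (simp add: linear_conv_bounded_linear)
  ultimately show ?thesis
    unfolding scaled_walk_def[abs_def] by (rule measurable_compose)
qed

lemma walk_blocks_measurable [measurable]: "(\<lambda>\<omega>. walk_blocks Y \<mu> b K n \<omega>) \<in> borel_measurable M"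
proof (rule measurable_coordinatewise_then_product)
  show "(\<lambda>\<omega>. walk_blocks Y \<mu> b K n \<omega> j) \<in> borel_measurable M" for j
    unfolding walk_blocks_def by (cases "j < K") auto
qed

lemma levy_blocks_measurable [measurable]: "(\<lambda>\<omega>. levy_blocks X K \<omega>) \<in> borel_measurable N"
proof (rule measurable_coordinatewise_then_product)
  show "(\<lambda>\<omega>. levy_blocks X K \<omega> j) \<in> borel_measurable N" for j
    unfolding levy_blocks_def by (cases "j < K") (auto intro: grid_incr_measurable[OF levy])
qed

lemma walk_blocks_conv_in_distr:
  fixes G :: "(nat \<Rightarrow> real^'n) \<Rightarrow> real"
  assumes "K \<ge> 1" "continuous_on UNIV G"
  shows "conv_in_distr M (\<lambda>n \<omega>. G (walk_blocks Y \<mu> b K n \<omega>)) N (\<lambda>\<omega>. G (levy_blocks X K \<omega>))"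
  unfolding conv_in_distr_def
proof (intro conjI allI impI)
  have [measurable]: "G \<in> borel_measurable borel" using assms(2) by (rule borel_measurable_continuous_onI)
  show "(\<lambda>\<omega>. G (walk_blocks Y \<mu> b K n \<omega>)) \<in> borel_measurable M" for n by measurable
  show "(\<lambda>\<omega>. G (levy_blocks X K \<omega>)) \<in> borel_measurable N" by measurable
  fix f :: "real \<Rightarrow> real" assume f: "continuous_on UNIV f" "bounded (range f)"
  have "continuous_on UNIV (\<lambda>x. f (G x))"
    by (rule continuous_on_compose2[OF f(1) assms(2)]) auto
  moreover have "bounded (range (\<lambda>x. f (G x)))"
    using f(2) by (rule bounded_subset) auto
  ultimately show "(\<lambda>n. \<integral>\<omega>. f (G (walk_blocks Y \<mu> b K n \<omega>)) \<partial>M) \<longlonglongrightarrow> (\<integral>\<omega>. f (G (levy_blocks X K \<omega>)) \<partial>N)"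
    by (rule walk_blocks_tendsto[OF M iid levy attraction assms(1)])
qed

lemma mu_inner: "\<mu> \<bullet> e i = (if i = i\<^sub>1 then norm \<mu> else 0)"
proof -
  have "\<mu> = norm \<mu> *\<^sub>R e i\<^sub>1" using mean(3) by (simp add: basis(2))
  then have "\<mu> \<bullet> e i = norm \<mu> * (e i\<^sub>1 \<bullet> e i)" by (metis inner_scaleR_left)
  then show ?thesis by (simp add: basis(1))
qed

lemma S_component:
  assumes "n \<ge> 1"
  shows "S n k \<omega> $ i = (if i = i\<^sub>1 then (T k \<omega> \<bullet> e i) / real n + norm \<mu> * (real k / real n) else (T k \<omega> \<bullet> e i) / b n)"
proof -
  have "random_walk Y k \<omega> = T k \<omega> + real k *\<^sub>R \<mu>" by (simp add: centred_walk_def)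
  then have "random_walk Y k \<omega> \<bullet> e i = T k \<omega> \<bullet> e i + real k * (\<mu> \<bullet> e i)" by (simp add: inner_add_left)
  then show ?thesis
    unfolding scaled_walk_def scaling_basis_coords_component mu_inner by (simp add: add_divide_distrib)
qed

lemma W_component:
  assumes "j \<le> K"
  shows "W K n \<omega> j $ i = (if i = i\<^sub>1 then norm \<mu> * (real j / real K) else (T (grid_index K n j) \<omega> \<bullet> e i) / b n)"
proof -
  have "(\<Sum>l<j. walk_blocks Y \<mu> b K n \<omega> l) = (1 / b n) *\<^sub>R T (grid_index K n j) \<omega>" if "j \<le> K" for j
    using that
  proof (induction j)
    case (Suc j)
    then have "(\<Sum>l<Suc j. walk_blocks Y \<mu> b K n \<omega> l) = (1 / b n) *\<^sub>R T (grid_index K n j) \<omega> + walk_blocks Y \<mu> b K n \<omega> j"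
      by simp
    also have "\<dots> = (1 / b n) *\<^sub>R T (grid_index K n (Suc j)) \<omega>"
      using Suc.prems by (simp add: walk_blocks_def flip: scaleR_add_right)
    finally show ?case .
  qed simp
  then show ?thesis using assms by (simp add: skeleton_map_def)
qed

text \<open>Along the mean the error consists of a fluctuation on scale \<open>n\<close> and the
  time shift \<open>2 / K\<close>; in the other directions it is a fluctuation on scale
  \<open>b n\<close>. The factor \<open>CARD('n)\<close> comes from summing over the
  coordinates.\<close>

lemma S_W_dist:
  assumes n: "n \<ge> 1" and j: "j \<le> K" and \<epsilon>: "\<epsilon> \<ge> 0"
    and 1: "norm (T k \<omega>) \<le> \<epsilon> * real n" and 2: "norm (T k \<omega> - T (grid_index K n j) \<omega>) \<le> \<epsilon> * b n"
    and 3: "\<bar>real k / real n - real j / real K\<bar> \<le> 2 / real K"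
  shows "dist (S n k \<omega>) (W K n \<omega> j) \<le> CARD('n) * (\<epsilon> + 2 * norm \<mu> / real K)"
proof -
  have ne: "norm (e i) = 1" for i using basis(1)[of i i] by (simp add: norm_eq_1)
  have bn: "b n > 0" by (rule b_pos[OF n])
  have "\<bar>(S n k \<omega> - W K n \<omega> j) $ i\<bar> \<le> \<epsilon> + 2 * norm \<mu> / real K" for i
  proof (cases "i = i\<^sub>1")
    case True
    have "(S n k \<omega> - W K n \<omega> j) $ i = (T k \<omega> \<bullet> e i) / real n + norm \<mu> * (real k / real n - real j / real K)"
      by (simp add: True S_component[OF n] W_component[OF j] right_diff_distrib)
    also have "\<bar>\<dots>\<bar> \<le> \<bar>(T k \<omega> \<bullet> e i) / real n\<bar> + \<bar>norm \<mu> * (real k / real n - real j / real K)\<bar>"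
      by (rule abs_triangle_ineq)
    also have "\<bar>(T k \<omega> \<bullet> e i) / real n\<bar> \<le> \<epsilon>"
    proof -
      have "\<bar>T k \<omega> \<bullet> e i\<bar> \<le> \<epsilon> * real n" using Cauchy_Schwarz_ineq2[of "T k \<omega>" "e i"] 1 by (simp add: ne)
      then show ?thesis using n by (simp add: divide_le_eq)
    qed
    also have "\<bar>norm \<mu> * (real k / real n - real j / real K)\<bar> \<le> norm \<mu> * (2 / real K)"
      unfolding abs_mult using 3 by (intro mult_mono) auto
    finally show ?thesis by (simp add: mult.commute)
  next
    case False
    have "(S n k \<omega> - W K n \<omega> j) $ i = ((T k \<omega> - T (grid_index K n j) \<omega>) \<bullet> e i) / b n"
      by (simp add: False S_component[OF n] W_component[OF j] inner_diff_left diff_divide_distrib)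
    moreover have "\<bar>(T k \<omega> - T (grid_index K n j) \<omega>) \<bullet> e i\<bar> \<le> \<epsilon> * b n"
      using Cauchy_Schwarz_ineq2[of "T k \<omega> - T (grid_index K n j) \<omega>" "e i"] 2 by (simp add: ne)
    ultimately have "\<bar>(S n k \<omega> - W K n \<omega> j) $ i\<bar> \<le> \<epsilon>" using bn by (simp add: divide_le_eq)
    then show ?thesis by (rule order.trans) simp
  qed
  then have "(\<Sum>i\<in>UNIV. \<bar>(S n k \<omega> - W K n \<omega> j) $ i\<bar>) \<le> (\<Sum>i\<in>(UNIV::'n set). \<epsilon> + 2 * norm \<mu> / real K)"
    by (intro sum_mono)
  then show ?thesis
    using norm_le_l1_cart[of "S n k \<omega> - W K n \<omega> j"] by (simp add: dist_norm)
qed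

definition bad :: "real \<Rightarrow> nat \<Rightarrow> nat \<Rightarrow> 'w set" where
  "bad \<epsilon> K n = exceed M Y \<mu> 0 {0..n} (\<epsilon> * real n) \<union>
    {\<omega>\<in>space M. \<exists>j<K. \<exists>k\<in>{grid_index K n j..grid_index K n (Suc j)}.
      norm (T k \<omega> - T (grid_index K n j) \<omega>) \<ge> \<epsilon> * b n \<and> norm (T (grid_index K n (Suc j)) \<omega> - T k \<omega>) \<ge> \<epsilon> * b n}"

lemma bad_measurable [measurable]: "bad \<epsilon> K n \<in> sets M"
  unfolding bad_def exceed_def by measurable

text \<open>\<open>C\<close> is chosen before \<open>K\<close>, so the first summand can be made
  small by a large \<open>K\<close>; \<eta> absorbs the weak law, which becomes small only as
  \<open>n\<close> grows.\<close>

lemma prob_bad: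
  assumes "\<epsilon> > 0"
  shows "\<exists>C. \<forall>K\<ge>1. \<forall>\<eta>>0. \<forall>\<^sub>F n in sequentially. M.prob (bad \<epsilon> K n) \<le> C / real K + \<eta>"
proof -
  obtain C where C: "\<And>K. K \<ge> 1 \<Longrightarrow> \<forall>\<^sub>F n in sequentially.
    measure M {\<omega>\<in>space M. \<exists>j<K. \<exists>k\<in>{grid_index K n j..grid_index K n (Suc j)}.
      norm (T k \<omega> - T (grid_index K n j) \<omega>) \<ge> \<epsilon> * b n \<and>
      norm (T (grid_index K n (Suc j)) \<omega> - T k \<omega>) \<ge> \<epsilon> * b n} \<le> C / real K"
    using walk_oscillation[OF M N.prob_space_axioms iid b_pos attraction levy_char_nonzero[OF levy] assms] by blast
  show ?thesis
  proof (intro exI[of _ C] allI impI)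
    fix K :: nat and \<eta> :: real assume K: "K \<ge> 1" and \<eta>: "\<eta> > 0"
    have "\<forall>\<^sub>F n in sequentially. measure M (exceed M Y \<mu> 0 {0..n} (\<epsilon> * real n)) < \<eta>"
      using walk_max_weak_law[OF M iid mean(1,2) assms] \<eta> by (rule order_tendstoD(2))
    with C[OF K] show "\<forall>\<^sub>F n in sequentially. M.prob (bad \<epsilon> K n) \<le> C / real K + \<eta>"
    proof eventually_elim
      case (elim n)
      have "M.prob (bad \<epsilon> K n) \<le> measure M (exceed M Y \<mu> 0 {0..n} (\<epsilon> * real n)) +
        measure M {\<omega>\<in>space M. \<exists>j<K. \<exists>k\<in>{grid_index K n j..grid_index K n (Suc j)}.
      norm (T k \<omega> - T (grid_index K n j) \<omega>) \<ge> \<epsilon> * b n \<and>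
      norm (T (grid_index K n (Suc j)) \<omega> - T k \<omega>) \<ge> \<epsilon> * b n}"
        unfolding bad_def by (intro measure_Un_le) (auto simp: exceed_def)
      then show ?case using elim by linarith
    qed
  qed
qed

text \<open>The two halves of the Hausdorff estimate between the walk and its skeleton. The term
  \<open>2 / real K\<close> in \<gamma> is one block length \<open>1 / K\<close> plus the rounding
  error \<open>1 / n\<close>, which is at most \<open>1 / K\<close>.\<close>

lemma good_close:
  assumes \<omega>: "\<omega> \<in> space M" "\<omega> \<notin> bad \<epsilon> K n" and K: "K \<ge> 1" and n: "n \<ge> K" and \<epsilon>: "\<epsilon> \<ge> 0"
  defines "\<gamma> \<equiv> CARD('n) * (\<epsilon> + 2 * norm \<mu> / real K)"
  shows "k \<le> n \<Longrightarrow> \<exists>j\<in>{0..K}. dist (S n k \<omega>) (W K n \<omega> j) \<le> \<gamma>"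
    and "j \<le> K \<Longrightarrow> \<exists>k\<in>{0..n}. dist (W K n \<omega> j) (S n k \<omega>) \<le> \<gamma>"
proof -
  have n1: "n \<ge> 1" using K n by simp
  have inv: "1 / real n \<le> 1 / real K" using K n by (intro divide_left_mono) auto
  have small: "norm (T k \<omega>) \<le> \<epsilon> * real n" if "k \<le> n" for k
    using \<omega> that by (force simp: bad_def exceed_def)
  have idx: "real k / real n \<le> real (Suc j) / real K" "real j / real K - 1 / real n \<le> real k / real n"
    if "grid_index K n j \<le> k" "k \<le> grid_index K n (Suc j)" for j k
  proof -
    have "real k \<le> real (Suc j) * real n / real K"
      using that(2) grid_index_bounds(1)[OF K, of n "Suc j"] by linarith
    then have "real k / real n \<le> (real (Suc j) * real n / real K) / real n" by (rule divide_right_mono) simp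
    then show "real k / real n \<le> real (Suc j) / real K" using n1 by simp
    have "real j * real n / real K - 1 \<le> real k"
      using that(1) grid_index_bounds(2)[OF K, of j n] by linarith
    then have "(real j * real n / real K - 1) / real n \<le> real k / real n" by (rule divide_right_mono) simp
    then show "real j / real K - 1 / real n \<le> real k / real n" using n1 by (simp add: diff_divide_distrib)
  qed
  have step: "real (Suc j) / real K = real j / real K + 1 / real K" for j
    by (simp add: add_divide_distrib)
  have two: "2 / real K = 1 / real K + 1 / real K" by simp
  have Kp: "1 / real K \<ge> 0" by simp
  show "\<exists>j\<in>{0..K}. dist (S n k \<omega>) (W K n \<omega> j) \<le> \<gamma>" if k: "k \<le> n" for k
  proof -
    obtain j where j: "j < K" "grid_index K n j \<le> k" "k \<le> grid_index K n (Suc j)"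
      using block_exists[OF K k] by blast
    \<comment> \<open>The complement of the bad event gives no choice of the end: the point is near
      the left or near the right end of its block, and either suffices.\<close>
    have "norm (T k \<omega> - T (grid_index K n j) \<omega>) < \<epsilon> * b n \<or> norm (T (grid_index K n (Suc j)) \<omega> - T k \<omega>) < \<epsilon> * b n"
      using \<omega> j by (force simp: bad_def)
    then show ?thesis
    proof
      assume "norm (T k \<omega> - T (grid_index K n j) \<omega>) < \<epsilon> * b n"
      moreover have "\<bar>real k / real n - real j / real K\<bar> \<le> 2 / real K"
        using idx[OF j(2,3)] inv Kp unfolding step two by linarith
      ultimately have "dist (S n k \<omega>) (W K n \<omega> j) \<le> \<gamma>"
        unfolding \<gamma>_def using j(1) by (intro S_W_dist[OF n1 _ \<epsilon> small[OF k]]) auto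
      then show ?thesis using j(1) by (intro bexI[of _ j]) auto
    next
      assume "norm (T (grid_index K n (Suc j)) \<omega> - T k \<omega>) < \<epsilon> * b n"
      then have "norm (T k \<omega> - T (grid_index K n (Suc j)) \<omega>) \<le> \<epsilon> * b n"
        by (simp add: norm_minus_commute)
      moreover have "\<bar>real k / real n - real (Suc j) / real K\<bar> \<le> 2 / real K"
        using idx[OF j(2,3)] inv Kp unfolding step two by linarith
      ultimately have "dist (S n k \<omega>) (W K n \<omega> (Suc j)) \<le> \<gamma>"
        unfolding \<gamma>_def using j(1) by (intro S_W_dist[OF n1 _ \<epsilon> small[OF k]]) auto
      then show ?thesis using j(1) by (intro bexI[of _ "Suc j"]) auto
    qed
  qed
  show "\<exists>k\<in>{0..n}. dist (W K n \<omega> j) (S n k \<omega>) \<le> \<gamma>" if j: "j \<le> K" for j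
  proof -
    \<comment> \<open>At the grid time itself walk and skeleton can differ only along the
      mean.\<close>
    define k where "k = grid_index K n j"
    have k: "k \<le> n" using monoD[OF mono_grid_index j, of K n] grid_index_K[OF K, of n] by (simp add: k_def)
    have "k \<le> grid_index K n (Suc j)" using monoD[OF mono_grid_index, of j "Suc j"] by (simp add: k_def)
    moreover have "real k / real n \<le> real j / real K"
    proof -
      have "real k / real n \<le> (real j * real n / real K) / real n"
        using grid_index_bounds(1)[OF K, of n j] unfolding k_def by (rule divide_right_mono) simp
      then show ?thesis using n1 by simp
    qed
    ultimately have "\<bar>real k / real n - real j / real K\<bar> \<le> 2 / real K"
      using idx(2)[of j k] inv Kp unfolding k_def two by linarith
    moreover have "norm (T k \<omega> - T (grid_index K n j) \<omega>) \<le> \<epsilon> * b n"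
      using \<epsilon> b_pos[OF n1] by (simp add: k_def)
    ultimately have "dist (S n k \<omega>) (W K n \<omega> j) \<le> \<gamma>"
      unfolding \<gamma>_def by (intro S_W_dist[OF n1 j \<epsilon> small[OF k]])
    then show ?thesis using k by (intro bexI[of _ k]) (auto simp: dist_commute)
  qed
qed

text \<open>All \<open>n + 1\<close> points are controlled through finitely many skeleton points for
  one fixed \<open>K\<close>, where tightness follows from convergence in distribution; the
  remaining points are within \<gamma> of these off an event of small probability.\<close>

lemma S_tight:
  assumes \<eta>: "\<eta> > 0"
  shows "\<exists>R. \<forall>\<^sub>F n in sequentially. M.prob {\<omega>\<in>space M. \<exists>k\<in>{0..n}. norm (S n k \<omega>) > R} \<le> \<eta>"
proof -
  obtain C where C: "\<And>K \<eta>. K \<ge> 1 \<Longrightarrow> \<eta> > 0 \<Longrightarrow> \<forall>\<^sub>F n in sequentially. M.prob (bad 1 K n) \<le> C / real K + \<eta>"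
    using prob_bad[of 1] by auto
  obtain K :: nat where K: "K \<ge> 1" "C / real K \<le> \<eta> / 3"
  proof -
    obtain k :: nat where "3 * C / \<eta> \<le> real k" using real_arch_simple by blast
    then have "C / real (Suc k) \<le> \<eta> / 3" using \<eta> by (simp add: field_simps)
    then show ?thesis by (intro that[of "Suc k"]) auto
  qed
  define G where "G = (\<lambda>x. \<Sum>j\<in>{0..K}. norm (skeleton_map i\<^sub>1 e \<mu> K x j))"
  have "continuous_on UNIV (\<lambda>x. skeleton_map i\<^sub>1 e \<mu> K x j)" for j
    by (rule continuous_on_compose2[OF continuous_on_product_coordinates continuous_on_skeleton_map]) simp
  then have Gc: "continuous_on UNIV G" unfolding G_def by (intro continuous_intros)
  then have [measurable]: "G \<in> borel_measurable borel" by (rule borel_measurable_continuous_onI)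
  obtain R where R: "\<forall>\<^sub>F n in sequentially. M.prob {\<omega>\<in>space M. norm (G (walk_blocks Y \<mu> b K n \<omega>)) > R} \<le> \<eta> / 3"
    using conv_in_distr_tight[OF M N.prob_space_axioms walk_blocks_conv_in_distr[OF K(1) Gc], of "\<eta> / 3"] \<eta> by auto
  define \<gamma> where "\<gamma> = CARD('n) * (1 + 2 * norm \<mu> / real K)"
  have "\<forall>\<^sub>F n in sequentially. M.prob (bad 1 K n) \<le> C / real K + \<eta> / 3"
    using C K(1) \<eta> by simp
  with R eventually_ge_at_top[of K]
  have "\<forall>\<^sub>F n in sequentially. M.prob {\<omega>\<in>space M. \<exists>k\<in>{0..n}. norm (S n k \<omega>) > R + \<gamma>} \<le> \<eta>"
  proof eventually_elim
    case (elim n)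
    let ?B = "{\<omega>\<in>space M. norm (G (walk_blocks Y \<mu> b K n \<omega>)) > R}"
    have "{\<omega>\<in>space M. \<exists>k\<in>{0..n}. norm (S n k \<omega>) > R + \<gamma>} \<subseteq> ?B \<union> bad 1 K n"
    proof
      fix \<omega> assume "\<omega> \<in> {\<omega>\<in>space M. \<exists>k\<in>{0..n}. norm (S n k \<omega>) > R + \<gamma>}"
      then obtain k where \<omega>: "\<omega> \<in> space M" and k: "k \<le> n" "norm (S n k \<omega>) > R + \<gamma>" by auto
      show "\<omega> \<in> ?B \<union> bad 1 K n"
      proof (cases "\<omega> \<in> bad 1 K n")
        case False
        then obtain j where j: "j \<in> {0..K}" "dist (S n k \<omega>) (W K n \<omega> j) \<le> \<gamma>"
          using good_close(1)[OF \<omega> False K(1) elim(2) _ k(1)] by (auto simp: \<gamma>_def)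
        have "norm (W K n \<omega> j) \<le> G (walk_blocks Y \<mu> b K n \<omega>)"
          unfolding G_def using j(1) by (intro member_le_sum) auto
        moreover have "norm (S n k \<omega>) \<le> norm (W K n \<omega> j) + \<gamma>"
          using j(2) norm_triangle_sub[of "S n k \<omega>" "W K n \<omega> j"] by (simp add: dist_norm)
        ultimately have "norm (G (walk_blocks Y \<mu> b K n \<omega>)) > R" using k(2) by simp
        then show ?thesis using \<omega> by simp
      qed simp
    qed
    then have "M.prob {\<omega>\<in>space M. \<exists>k\<in>{0..n}. norm (S n k \<omega>) > R + \<gamma>} \<le> M.prob (?B \<union> bad 1 K n)"
      by (rule M.finite_measure_mono) measurable
    also have "\<dots> \<le> M.prob ?B + M.prob (bad 1 K n)"
      by (intro measure_Un_le) measurable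
    finally show ?case using elim K(2) by linarith
  qed
  then show ?thesis by blast
qed

text \<open>The constants are fixed in the order \<open>R\<close> by tightness, \<delta> by uniform
  continuity on the ball, \<epsilon>, then \<open>K\<close>, and only then large
  \<open>n\<close>.\<close>

lemma expectation_skeleton_approx:
  fixes f :: "real \<Rightarrow> real"
  assumes m: "m \<le> CARD('n)" and f: "continuous_on UNIV f" "bounded (range f)" and r: "r > 0"
  shows "\<exists>K\<^sub>0. \<forall>K\<ge>K\<^sub>0. \<forall>\<^sub>F n in sequentially.
    \<bar>(\<integral>\<omega>. f (hull_volume m n (\<lambda>k. S n k \<omega>)) \<partial>M) - (\<integral>\<omega>. f (hull_volume m K (W K n \<omega>)) \<partial>M)\<bar> \<le> r"
proof -
  have m': "m \<le> DIM(real^'n)" using m by simp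
  obtain F where F: "F > 0" "\<And>x. \<bar>f x\<bar> \<le> F" using f(2) unfolding bounded_pos by auto
  \<comment> \<open>The exceptional event has probability at most \<open>3 * \<eta>\<close> and the
    integrands differ there by at most \<open>2 * F\<close>, which costs \<open>r / 2\<close>; the
    other half is spent off the event.\<close>
  define \<eta> where "\<eta> = r / (12 * F)"
  have \<eta>: "\<eta> > 0" using r F(1) by (simp add: \<eta>_def)
  obtain R where R: "\<forall>\<^sub>F n in sequentially. M.prob {\<omega>\<in>space M. \<exists>k\<in>{0..n}. norm (S n k \<omega>) > R} \<le> \<eta>"
    using S_tight[OF \<eta>] by blast
  obtain \<delta>\<^sub>0 where \<delta>\<^sub>0: "\<delta>\<^sub>0 > 0" "\<And>A B :: (real^'n) set. compact A \<Longrightarrow> convex A \<Longrightarrow> A \<noteq> {} \<Longrightarrow> compact B \<Longrightarrow> convex B \<Longrightarrow> B \<noteq> {} \<Longrightarrow>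
    A \<subseteq> cball 0 (R + 1) \<Longrightarrow> B \<subseteq> cball 0 (R + 1) \<Longrightarrow> A \<subseteq> parallel_body B \<delta>\<^sub>0 \<Longrightarrow> B \<subseteq> parallel_body A \<delta>\<^sub>0 \<Longrightarrow>
    \<bar>f (intrinsic_volume m A) - f (intrinsic_volume m B)\<bar> < r / 2"
    using continuous_intrinsic_volume_uniformly_continuous[OF m' f(1), of "r / 2" "R + 1"] r by (metis half_gt_zero)
  \<comment> \<open>The cap 1 keeps the skeleton in the ball of radius \<open>R + 1\<close> once the
    walk is in the ball of radius \<open>R\<close>.\<close>
  define \<delta> where "\<delta> = min \<delta>\<^sub>0 1"
  have \<delta>: "\<delta> > 0" "\<delta> \<le> 1" "\<delta> \<le> \<delta>\<^sub>0" using \<delta>\<^sub>0(1) by (auto simp: \<delta>_def)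
  \<comment> \<open>For \<open>K \<ge> K\<^sub>0\<close> the time shift is also at most \<epsilon>,
    so the distance in \<open>good_close\<close> is at most
    \<open>CARD('n) * (2 * \<epsilon>) = \<delta>\<close>.\<close>
  define \<epsilon> where "\<epsilon> = \<delta> / (2 * CARD('n))"
  have \<epsilon>: "\<epsilon> > 0" using \<delta> by (simp add: \<epsilon>_def)
  obtain C where C: "\<And>K \<eta>. K \<ge> 1 \<Longrightarrow> \<eta> > 0 \<Longrightarrow> \<forall>\<^sub>F n in sequentially. M.prob (bad \<epsilon> K n) \<le> C / real K + \<eta>"
    using prob_bad[OF \<epsilon>] by blast
  obtain K\<^sub>0 :: nat where K0: "K\<^sub>0 \<ge> 1" "\<And>K. K \<ge> K\<^sub>0 \<Longrightarrow> C / real K \<le> \<eta>" "\<And>K. K \<ge> K\<^sub>0 \<Longrightarrow> 2 * norm \<mu> / real K \<le> \<epsilon>"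
  proof -
    obtain k :: nat where k: "max (C / \<eta>) (2 * norm \<mu> / \<epsilon>) \<le> real k" using real_arch_simple by blast
    have "C / real K \<le> \<eta>" "2 * norm \<mu> / real K \<le> \<epsilon>" if "K \<ge> Suc k" for K
    proof -
      have "real k \<le> real K" using that by simp
      then have "C / \<eta> \<le> real K" "2 * norm \<mu> / \<epsilon> \<le> real K" using k by linarith+
      then show "C / real K \<le> \<eta>" "2 * norm \<mu> / real K \<le> \<epsilon>"
        using \<eta> \<epsilon> that by (simp_all add: field_simps)
    qed
    then show ?thesis by (intro that[of "Suc k"]) auto
  qed
  have "\<forall>\<^sub>F n in sequentially.
    \<bar>(\<integral>\<omega>. f (hull_volume m n (\<lambda>k. S n k \<omega>)) \<partial>M) - (\<integral>\<omega>. f (hull_volume m K (W K n \<omega>)) \<partial>M)\<bar> \<le> r"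
    if K: "K \<ge> K\<^sub>0" for K
  proof -
    have K1: "K \<ge> 1" using K K0(1) by simp
    have "CARD('n) * (\<epsilon> + 2 * norm \<mu> / real K) \<le> CARD('n) * (2 * \<epsilon>)"
      using K0(3)[OF K] by (intro mult_left_mono) auto
    also have "\<dots> = \<delta>" by (simp add: \<epsilon>_def)
    finally have \<gamma>: "CARD('n) * (\<epsilon> + 2 * norm \<mu> / real K) \<le> \<delta>" .
    have [measurable]: "f \<in> borel_measurable borel" using f(1) by (rule borel_measurable_continuous_onI)
    have "\<forall>\<^sub>F n in sequentially. M.prob (bad \<epsilon> K n) \<le> C / real K + \<eta>" by (rule C[OF K1 \<eta>])
    with R eventually_ge_at_top[of K] show ?thesis
    proof eventually_elim
      case (elim n)
      define B where "B = {\<omega>\<in>space M. \<exists>k\<in>{0..n}. norm (S n k \<omega>) > R} \<union> bad \<epsilon> K n"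
      have "\<bar>(\<integral>\<omega>. f (hull_volume m n (\<lambda>k. S n k \<omega>)) \<partial>M) - (\<integral>\<omega>. f (hull_volume m K (W K n \<omega>)) \<partial>M)\<bar> \<le> r / 2 + (F + F) * M.prob B"
      proof (rule M.abs_expectation_diff_le)
        show "(\<lambda>\<omega>. f (hull_volume m n (\<lambda>k. S n k \<omega>))) \<in> borel_measurable M"
          by (rule measurable_compose[OF borel_measurable_hull_volume[OF m' S_measurable]]) measurable
        have "(\<lambda>\<omega>. hull_volume m K (W K n \<omega>)) \<in> borel_measurable M"
          by (intro measurable_compose[OF walk_blocks_measurable] borel_measurable_continuous_onI
              continuous_on_compose2[OF continuous_on_hull_volume[OF m'] continuous_on_skeleton_map]) simp
        then show "(\<lambda>\<omega>. f (hull_volume m K (W K n \<omega>))) \<in> borel_measurable M" by measurable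
        show "B \<in> sets M" unfolding B_def by measurable
        show "0 \<le> r / 2" using r by simp
        fix \<omega> assume \<omega>: "\<omega> \<in> space M" "\<omega> \<notin> B"
        then have nb: "\<omega> \<notin> bad \<epsilon> K n" and S_le: "\<And>k. k \<in> {0..n} \<Longrightarrow> norm (S n k \<omega>) \<le> R"
          by (auto simp: B_def not_less)
        have c1: "\<exists>j\<in>{0..K}. dist (S n k \<omega>) (W K n \<omega> j) \<le> \<delta>" if "k \<in> {0..n}" for k
        proof -
          have "k \<le> n" using that by simp
          from good_close(1)[OF \<omega>(1) nb K1 elim(2) less_imp_le[OF \<epsilon>] this]
          show ?thesis using \<gamma> by (meson order.trans)
        qed
        have c2: "\<exists>k\<in>{0..n}. dist (W K n \<omega> j) (S n k \<omega>) \<le> \<delta>" if "j \<in> {0..K}" for j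
        proof -
          have "j \<le> K" using that by simp
          from good_close(2)[OF \<omega>(1) nb K1 elim(2) less_imp_le[OF \<epsilon>] this]
          show ?thesis using \<gamma> by (meson order.trans)
        qed
        have W_le: "norm (W K n \<omega> j) \<le> R + 1" if j: "j \<in> {0..K}" for j
        proof -
          obtain k where "k \<in> {0..n}" "dist (W K n \<omega> j) (S n k \<omega>) \<le> \<delta>" using c2[OF j] by blast
          then show ?thesis
            using S_le[of k] norm_triangle_sub[of "W K n \<omega> j" "S n k \<omega>"] \<delta>(2) by (simp add: dist_norm)
        qed
        have "\<bar>f (hull_volume m n (\<lambda>k. S n k \<omega>)) - f (hull_volume m K (W K n \<omega>))\<bar> < r / 2"
          unfolding hull_volume_def
        proof (rule \<delta>\<^sub>0(2))
          show "convex hull ((\<lambda>k. S n k \<omega>) ` {0..n}) \<subseteq> cball 0 (R + 1)"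
            using S_le by (intro convex_hull_subset_cball) force
          show "convex hull (W K n \<omega> ` {0..K}) \<subseteq> cball 0 (R + 1)"
            using W_le by (intro convex_hull_subset_cball) force
          show "convex hull ((\<lambda>k. S n k \<omega>) ` {0..n}) \<subseteq> parallel_body (convex hull (W K n \<omega> ` {0..K})) \<delta>\<^sub>0"
          proof (rule convex_hull_subset_parallel_body)
            show "\<exists>y\<in>W K n \<omega> ` {0..K}. dist x y \<le> \<delta>\<^sub>0" if x: "x \<in> (\<lambda>k. S n k \<omega>) ` {0..n}" for x
            proof -
              obtain k where k: "k \<in> {0..n}" "x = S n k \<omega>" using x by blast
              obtain j where "j \<in> {0..K}" "dist x (W K n \<omega> j) \<le> \<delta>" using c1[OF k(1)] k(2) by blast
              then show ?thesis using \<delta>(3) by (intro bexI[of _ "W K n \<omega> j"]) auto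
            qed
          qed (use \<delta>\<^sub>0 in simp)
          show "convex hull (W K n \<omega> ` {0..K}) \<subseteq> parallel_body (convex hull ((\<lambda>k. S n k \<omega>) ` {0..n})) \<delta>\<^sub>0"
          proof (rule convex_hull_subset_parallel_body)
            show "\<exists>y\<in>(\<lambda>k. S n k \<omega>) ` {0..n}. dist x y \<le> \<delta>\<^sub>0" if x: "x \<in> W K n \<omega> ` {0..K}" for x
            proof -
              obtain j where j: "j \<in> {0..K}" "x = W K n \<omega> j" using x by blast
              obtain k where "k \<in> {0..n}" "dist x (S n k \<omega>) \<le> \<delta>" using c2[OF j(1)] j(2) by blast
              then show ?thesis using \<delta>(3) by (intro bexI[of _ "S n k \<omega>"]) auto
            qed
          qed (use \<delta>\<^sub>0 in simp)
        qed (auto intro: compact_hull_points)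
        then show "\<bar>f (hull_volume m n (\<lambda>k. S n k \<omega>)) - f (hull_volume m K (W K n \<omega>))\<bar> \<le> r / 2" by simp
      qed (use F in auto)
      also have "M.prob B \<le> M.prob {\<omega>\<in>space M. \<exists>k\<in>{0..n}. norm (S n k \<omega>) > R} + M.prob (bad \<epsilon> K n)"
        unfolding B_def by (intro measure_Un_le) measurable
      also have "\<dots> \<le> 3 * \<eta>" using elim(1,3) K0(2)[OF K] by linarith
      also have "r / 2 + (F + F) * (3 * \<eta>) = r" using F(1) by (simp add: \<eta>_def)
      finally show ?case using F(1) by simp
    qed
  qed
  then show ?thesis by blast
qed

section \<open>Passage to the limit\<close>

lemma skeleton_map_levy_blocks:
  assumes "X 0 \<omega> = 0" "j \<le> K"
  shows "skeleton_map i\<^sub>1 e \<mu> K (levy_blocks X K \<omega>) j = limit_process i\<^sub>1 e \<mu> X (real j / real K) \<omega>"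
proof -
  have "(\<Sum>l<j. levy_blocks X K \<omega> l) = (\<Sum>l<j. grid_incr X K l \<omega>)"
    using assms(2) by (intro sum.cong) (auto simp: levy_blocks_def)
  then have "(\<Sum>l<j. levy_blocks X K \<omega> l) = X (real j / real K) \<omega>"
    using assms(1) by (simp add: sum_grid_incr)
  then show ?thesis by (simp only: skeleton_map_def limit_process_def)
qed

text \<open>Three comparisons: walk with its \<open>K\<close>-skeleton, skeleton with the skeleton
  of the limit, and that with the full hull. \<open>K\<close> is fixed by the first and the last,
  whereupon the middle one holds for large \<open>n\<close>.\<close>

theorem conv_in_distr_hull_volume:
  assumes m: "m \<le> CARD('n)"
  shows "conv_in_distr M (\<lambda>n \<omega>. hull_volume m n (\<lambda>k. S n k \<omega>))
    N (\<lambda>\<omega>. intrinsic_volume m (convex hull (closed_range (limit_process i\<^sub>1 e \<mu> X) \<omega>)))"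
proof -
  have m': "m \<le> DIM(real^'n)" using m by simp
  define \<Psi> where "\<Psi> = (\<lambda>\<omega>. intrinsic_volume m (convex hull (closed_range (limit_process i\<^sub>1 e \<mu> X) \<omega>)))"
  define \<Psi>\<^sub>K where "\<Psi>\<^sub>K = (\<lambda>K \<omega>. hull_volume m K (\<lambda>j. limit_process i\<^sub>1 e \<mu> X (real j / real K) \<omega>))"
  have \<Psi>K_meas [measurable]: "\<Psi>\<^sub>K K \<in> borel_measurable N" for K
    unfolding \<Psi>\<^sub>K_def by (intro borel_measurable_hull_volume m' limit_process_measurable levy) auto
  have lim: "(\<lambda>K. \<Psi>\<^sub>K K \<omega>) \<longlonglongrightarrow> \<Psi> \<omega>" if "\<omega> \<in> space N" for \<omega>
  proof -
    have "cadlag (\<lambda>t. X t \<omega>)" using levy that by (simp add: levy_process_def)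
    then show ?thesis
      unfolding \<Psi>_def \<Psi>\<^sub>K_def closed_range_def
      by (intro hull_volume_skeleton_tendsto[OF cadlag_limit_process m'])
  qed
  \<comment> \<open>The hull of the closed range involves uncountably many times; measurability is
    inherited from the skeletons as a pointwise limit.\<close>
  have \<Psi>_meas [measurable]: "\<Psi> \<in> borel_measurable N"
    using lim \<Psi>K_meas by (rule borel_measurable_LIMSEQ_real)
  have "conv_in_distr M (\<lambda>n \<omega>. hull_volume m n (\<lambda>k. S n k \<omega>)) N \<Psi>"
    unfolding conv_in_distr_def
  proof (intro conjI allI impI \<Psi>_meas)
    show "(\<lambda>\<omega>. hull_volume m n (\<lambda>k. S n k \<omega>)) \<in> borel_measurable M" for n
      by (rule borel_measurable_hull_volume[OF m' S_measurable])
    fix f :: "real \<Rightarrow> real" assume f: "continuous_on UNIV f" "bounded (range f)"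
    have [measurable]: "f \<in> borel_measurable borel" using f(1) by (rule borel_measurable_continuous_onI)
    obtain F where F: "\<And>x. \<bar>f x\<bar> \<le> F" using f(2) unfolding bounded_iff by auto
    have lim_f: "(\<lambda>K. \<integral>\<omega>. f (\<Psi>\<^sub>K K \<omega>) \<partial>N) \<longlonglongrightarrow> (\<integral>\<omega>. f (\<Psi> \<omega>) \<partial>N)"
    proof (rule integral_dominated_convergence[where w="\<lambda>_. F"])
      have "isCont f x" for x using f(1) by (simp add: continuous_on_eq_continuous_at)
      then show "AE \<omega> in N. (\<lambda>K. f (\<Psi>\<^sub>K K \<omega>)) \<longlonglongrightarrow> f (\<Psi> \<omega>)"
        using isCont_tendsto_compose lim by (intro AE_I2) blast
    qed (use F in auto)
    have skel: "(\<lambda>n. \<integral>\<omega>. f (hull_volume m K (W K n \<omega>)) \<partial>M) \<longlonglongrightarrow> (\<integral>\<omega>. f (\<Psi>\<^sub>K K \<omega>) \<partial>N)" if K: "K \<ge> 1" for K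
    proof -
      have G: "continuous_on UNIV (\<lambda>x. hull_volume m K (skeleton_map i\<^sub>1 e \<mu> K x))"
        by (rule continuous_on_compose2[OF continuous_on_hull_volume[OF m'] continuous_on_skeleton_map]) simp
      then have [measurable]: "(\<lambda>x. hull_volume m K (skeleton_map i\<^sub>1 e \<mu> K x)) \<in> borel_measurable borel"
        by (rule borel_measurable_continuous_onI)
      have "(\<lambda>n. \<integral>\<omega>. f (hull_volume m K (W K n \<omega>)) \<partial>M)
        \<longlonglongrightarrow> (\<integral>\<omega>. f (hull_volume m K (skeleton_map i\<^sub>1 e \<mu> K (levy_blocks X K \<omega>))) \<partial>N)"
        using walk_blocks_conv_in_distr[OF K G] f unfolding conv_in_distr_def by blast
      \<comment> \<open>The process starts at 0 only almost surely, so sums of increments reproduce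
        its values only outside a null set.\<close>
      moreover have "(\<integral>\<omega>. f (hull_volume m K (skeleton_map i\<^sub>1 e \<mu> K (levy_blocks X K \<omega>))) \<partial>N) = (\<integral>\<omega>. f (\<Psi>\<^sub>K K \<omega>) \<partial>N)"
      proof (rule integral_cong_AE)
        have "AE \<omega> in N. X 0 \<omega> = 0" using levy by (simp add: levy_process_def)
        then show "AE \<omega> in N. f (hull_volume m K (skeleton_map i\<^sub>1 e \<mu> K (levy_blocks X K \<omega>))) = f (\<Psi>\<^sub>K K \<omega>)"
        proof eventually_elim
          case (elim \<omega>)
          then have "skeleton_map i\<^sub>1 e \<mu> K (levy_blocks X K \<omega>) ` {0..K} = (\<lambda>j. limit_process i\<^sub>1 e \<mu> X (real j / real K) \<omega>) ` {0..K}"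
            by (intro image_cong) (auto simp: skeleton_map_levy_blocks)
          then show ?case by (simp add: \<Psi>\<^sub>K_def hull_volume_def)
        qed
        show "(\<lambda>\<omega>. f (hull_volume m K (skeleton_map i\<^sub>1 e \<mu> K (levy_blocks X K \<omega>)))) \<in> borel_measurable N"
          using measurable_compose[OF levy_blocks_measurable, of "\<lambda>x. hull_volume m K (skeleton_map i\<^sub>1 e \<mu> K x)" borel K]
          by measurable
      qed measurable
      ultimately show ?thesis by simp
    qed
    show "(\<lambda>n. \<integral>\<omega>. f (hull_volume m n (\<lambda>k. S n k \<omega>)) \<partial>M) \<longlonglongrightarrow> (\<integral>\<omega>. f (\<Psi> \<omega>) \<partial>N)"
    proof (rule LIMSEQ_I)
      fix r :: real assume r: "r > 0"
      obtain K\<^sub>0 where K0: "\<And>K. K \<ge> K\<^sub>0 \<Longrightarrow> \<forall>\<^sub>F n in sequentially.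
        \<bar>(\<integral>\<omega>. f (hull_volume m n (\<lambda>k. S n k \<omega>)) \<partial>M) - (\<integral>\<omega>. f (hull_volume m K (W K n \<omega>)) \<partial>M)\<bar> \<le> r / 3"
        using expectation_skeleton_approx[OF m f, of "r / 3"] r by auto
      have "eventually (\<lambda>K. dist (\<integral>\<omega>. f (\<Psi>\<^sub>K K \<omega>) \<partial>N) (\<integral>\<omega>. f (\<Psi> \<omega>) \<partial>N) < r / 3) sequentially"
        using lim_f r by (intro tendstoD) auto
      then have "eventually (\<lambda>K. dist (\<integral>\<omega>. f (\<Psi>\<^sub>K K \<omega>) \<partial>N) (\<integral>\<omega>. f (\<Psi> \<omega>) \<partial>N) < r / 3 \<and> K \<ge> max 1 K\<^sub>0) sequentially"
        using eventually_ge_at_top[of "max 1 K\<^sub>0"] by eventually_elim simp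
      then obtain K where K: "dist (\<integral>\<omega>. f (\<Psi>\<^sub>K K \<omega>) \<partial>N) (\<integral>\<omega>. f (\<Psi> \<omega>) \<partial>N) < r / 3" "K \<ge> 1" "K \<ge> K\<^sub>0"
        using eventually_happens'[OF sequentially_bot] by force
      have "eventually (\<lambda>n. dist (\<integral>\<omega>. f (hull_volume m K (W K n \<omega>)) \<partial>M) (\<integral>\<omega>. f (\<Psi>\<^sub>K K \<omega>) \<partial>N) < r / 3) sequentially"
        using skel[OF K(2)] r by (intro tendstoD) auto
      with K0[OF K(3)] have "eventually (\<lambda>n. norm ((\<integral>\<omega>. f (hull_volume m n (\<lambda>k. S n k \<omega>)) \<partial>M) - (\<integral>\<omega>. f (\<Psi> \<omega>) \<partial>N)) < r) sequentially"
      proof eventually_elim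
        case (elim n)
        then show ?case using K(1) unfolding dist_real_def real_norm_def by linarith
      qed
      then show "\<exists>no. \<forall>n\<ge>no. norm ((\<integral>\<omega>. f (hull_volume m n (\<lambda>k. S n k \<omega>)) \<partial>M) - (\<integral>\<omega>. f (\<Psi> \<omega>) \<partial>N)) < r"
        by (simp add: eventually_sequentially)
    qed
  qed
  then show ?thesis by (simp only: \<Psi>_def)
qed

lemma hull_volume_scaled_walk:
  "hull_volume m n (\<lambda>k. S n k \<omega>) = intrinsic_volume m ((\<lambda>x. scaling_matrix i\<^sub>1 b n *v basis_coords e x) `
     (convex hull ((\<lambda>k. random_walk Y k \<omega>) ` {0..n})))"
  unfolding hull_volume_def scaled_walk_def convex_hull_linear_image[OF linear_scaling_basis_coords]
  by (simp add: image_image)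

lemma volume_scaled_walk:
  "hull_volume CARD('n) n (\<lambda>k. S n k \<omega>) =
    intrinsic_volume CARD('n) (convex hull ((\<lambda>k. random_walk Y k \<omega>) ` {0..n})) / (real n * b n ^ (CARD('n) - 1))"
proof -
  let ?A = "convex hull ((\<lambda>k. random_walk Y k \<omega>) ` {0..n})"
  let ?B = "convex hull ((\<lambda>k. S n k \<omega>) ` {0..n})"
  have A: "intrinsic_volume CARD('n) ?A = measure lebesgue ?A"
    using intrinsic_volume_DIM[of ?A] by (simp add: compact_hull_points)
  have B: "hull_volume CARD('n) n (\<lambda>k. S n k \<omega>) = measure lebesgue ?B"
    using intrinsic_volume_DIM[of ?B] by (simp add: hull_volume_def compact_hull_points)
  show ?thesis
  proof (cases "n = 0")
    \<comment> \<open>For \<open>n = 0\<close> the hull is a point of volume 0, and the quotient is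
      0 because its denominator is.\<close>
    case True
    then show ?thesis unfolding B by simp
  next
    case False
    have "?B = (\<lambda>x. scaling_matrix i\<^sub>1 b n *v basis_coords e x) ` ?A"
      unfolding scaled_walk_def convex_hull_linear_image[OF linear_scaling_basis_coords]
      by (simp add: image_image)
    then show ?thesis
      unfolding A B using False
      by (simp only:) (intro measure_scaling_basis_coords basis(1) b_pos compact_hull_points; simp)
  qed
qed

end

theorem theorem2p5:
  fixes M :: "'w measure" and N :: "'v measure"
    and Y :: "nat \<Rightarrow> 'w \<Rightarrow> real^'n" and X :: "real \<Rightarrow> 'v \<Rightarrow> real^'n"
    and \<mu> :: "real^'n" and e :: "'n \<Rightarrow> real^'n" and i\<^sub>1 :: 'n
    and \<alpha> :: real and b :: "nat \<Rightarrow> real" and \<l> :: "real \<Rightarrow> real"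
  assumes alpha: "1 < \<alpha>" "\<alpha> \<le> 2"
    and prob: "prob_space M"
    and iid: "iid_steps M Y"
    and mean: "integrable M (Y 1)" "\<mu> = (\<integral>\<omega>. Y 1 \<omega> \<partial>M)" "\<mu> \<noteq> 0"
    and levy: "stable_levy_process \<alpha> N X"
    and norming: "\<And>n. n \<ge> 1 \<Longrightarrow> b n > 0"
      "slowly_varying \<l>" "\<And>n. n \<ge> 1 \<Longrightarrow> b n = real n powr (1 / \<alpha>) * \<l> (real n)"
    and attraction:
      "conv_in_distr M (\<lambda>n \<omega>. (1 / b n) *\<^sub>R (random_walk Y n \<omega> - real n *\<^sub>R \<mu>)) N (X 1)"
    and basis: "\<And>i j. e i \<bullet> e j = (if i = j then 1 else 0)"
      "e i\<^sub>1 = (1 / norm \<mu>) *\<^sub>R \<mu>"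
  shows "(\<forall>m\<in>{1..CARD('n)}.
      conv_in_distr
        M (\<lambda>n \<omega>. intrinsic_volume m
             ((\<lambda>x. scaling_matrix i\<^sub>1 b n *v basis_coords e x) `
                (convex hull ((\<lambda>k. random_walk Y k \<omega>) ` {0..n}))))
        N (\<lambda>\<omega>. intrinsic_volume m (convex hull (closed_range (limit_process i\<^sub>1 e \<mu> X) \<omega>)))) \<and>
    conv_in_distr
      M (\<lambda>n \<omega>. intrinsic_volume CARD('n) (convex hull ((\<lambda>k. random_walk Y k \<omega>) ` {0..n})) /
             (real n * b n ^ (CARD('n) - 1)))
      N (\<lambda>\<omega>. intrinsic_volume CARD('n) (convex hull (closed_range (limit_process i\<^sub>1 e \<mu> X) \<omega>)))"
proof -
  have "levy_process N X" using levy by (simp add: stable_levy_process_def)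
  with prob iid mean norming(1) attraction[folded centred_walk_def] basis
  interpret attracted_walk M N Y X \<mu> e i\<^sub>1 b
    by (intro attracted_walk.intro)
  show ?thesis
  proof (intro conjI ballI)
    fix m assume "m \<in> {1..CARD('n)}"
    then show "conv_in_distr
        M (\<lambda>n \<omega>. intrinsic_volume m
             ((\<lambda>x. scaling_matrix i\<^sub>1 b n *v basis_coords e x) `
                (convex hull ((\<lambda>k. random_walk Y k \<omega>) ` {0..n}))))
        N (\<lambda>\<omega>. intrinsic_volume m (convex hull (closed_range (limit_process i\<^sub>1 e \<mu> X) \<omega>)))"
      using conv_in_distr_hull_volume[of m] by (simp only: hull_volume_scaled_walk atLeastAtMost_iff)
  next
    show "conv_in_distr
      M (\<lambda>n \<omega>. intrinsic_volume CARD('n) (convex hull ((\<lambda>k. random_walk Y k \<omega>) ` {0..n})) /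
             (real n * b n ^ (CARD('n) - 1)))
      N (\<lambda>\<omega>. intrinsic_volume CARD('n) (convex hull (closed_range (limit_process i\<^sub>1 e \<mu> X) \<omega>)))"
      using conv_in_distr_hull_volume[of "CARD('n)"] by (simp only: volume_scaled_walk order_refl)
  qed
qed

end
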